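(* Let $G$ be an l.c.s.c. group, $A$ a Polish $G$-module and $p\geq 0$. Then every class in $\mathrm{H}^p_{\mathrm{m}}(G,A)$ has a representative cocycle in the homogeneous measurable bar resolution, i.e. a $G$-equivariant measurable map $\sigma:G^{p+1}\to A$ with $d\sigma=0$, for which there is a dense $G_\delta$ subset $S\subseteq G^{p+1}$ of full Haar measure, containing the identity $(e,\dots,e)$, such that $\sigma$ is continuous at every point of $S$.
   Context: Measurable cohomology: for an l.c.s.c. group $G$ and a Polish $G$-module $A$ (Polish Abelian group with continuous action of $G$ by automorphisms), cochains are Haar-a.e. classes of measurable maps $G^{p+1}\to A$ with diagonal action $(g\cdot\phi)(g_1,\dots)=g\cdot\phi(g^{-1}g_1,\dots)$; $G$-equivariant means fixed by this action. The differential is $d\sigma(g_1,\dots,g_{p+1})=\sum_{i=1}^{p+1}(-1)^{p+1-i}\sigma(g_1,\dots,\widehat{g_i},\dots,g_{p+1})$, and $\mathrm{H}^p_{\mathrm{m}}(G,A)$ is the homology in degree $p$ (cochains on $G^{p+1}$) of the complex of $G$-equivariant cochains. *)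

theory Defs
  imports "HOL-Analysis.Analysis"
begin

text \<open>The l.c.s.c. group G is a type 'g of class topological_group_add (written
additively, NOT assumed commutative).  G^n is modelled as the extensional
functions {..<n} \<rightarrow> G, i.e. PiE {..<n} (\<lambda>_. UNIV), with the product topology
(subspace of the function-type topology) and the product measure.\<close>

text \<open>Left Haar measure on G (Borel, left invariant, finite on compacts,
positive on nonempty open sets; regularity is automatic for l.c.s.c. groups).\<close>
definition haar_measure :: "'g::topological_group_add measure \<Rightarrow> bool" where
  "haar_measure \<mu> \<longleftrightarrow>
     sets \<mu> = sets borel \<and>
     (\<forall>g A. A \<in> sets borel \<longrightarrow> emeasure \<mu> ((\<lambda>x. g + x) ` A) = emeasure \<mu> A) \<and>
     (\<forall>K. compact K \<longrightarrow> emeasure \<mu> K < \<infinity>) \<and>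
     (\<forall>U. open U \<and> U \<noteq> {} \<longrightarrow> emeasure \<mu> U > 0)"

definition G_module_action :: "('g::topological_group_add \<Rightarrow> 'a::topological_ab_group_add \<Rightarrow> 'a) \<Rightarrow> bool" where
  "G_module_action \<alpha> \<longleftrightarrow>
     (\<forall>a. \<alpha> 0 a = a) \<and>
     (\<forall>g h a. \<alpha> (g + h) a = \<alpha> g (\<alpha> h a)) \<and>
     (\<forall>g a b. \<alpha> g (a + b) = \<alpha> g a + \<alpha> g b) \<and>
     continuous_on UNIV (\<lambda>(g, a). \<alpha> g a)"

definition Gpow :: "nat \<Rightarrow> (nat \<Rightarrow> 'g) set" where
  "Gpow n = PiE {..<n} (\<lambda>_. UNIV)"

definition Mpow :: "'g measure \<Rightarrow> nat \<Rightarrow> (nat \<Rightarrow> 'g) measure" where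
  "Mpow \<mu> n = PiM {..<n} (\<lambda>_. \<mu>)"

definition cochain_act ::
  "('g::group_add \<Rightarrow> 'a \<Rightarrow> 'a) \<Rightarrow> nat \<Rightarrow> 'g \<Rightarrow> ((nat \<Rightarrow> 'g) \<Rightarrow> 'a) \<Rightarrow> (nat \<Rightarrow> 'g) \<Rightarrow> 'a" where
  "cochain_act \<alpha> n g \<phi> x = \<alpha> g (\<phi> (\<lambda>j\<in>{..<n}. - g + x j))"

text \<open>Measurable G-equivariant cochain on G^n: a measurable map whose a.e.-class
is fixed by the action, i.e. for every g, g.phi = phi Haar-a.e.\<close>
definition equiv_cochain ::
  "'g::topological_group_add measure \<Rightarrow> ('g \<Rightarrow> 'a::topological_ab_group_add \<Rightarrow> 'a) \<Rightarrow> nat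
    \<Rightarrow> ((nat \<Rightarrow> 'g) \<Rightarrow> 'a) \<Rightarrow> bool" where
  "equiv_cochain \<mu> \<alpha> n \<phi> \<longleftrightarrow>
     \<phi> \<in> borel_measurable (Mpow \<mu> n) \<and>
     (\<forall>g. AE x in Mpow \<mu> n. cochain_act \<alpha> n g \<phi> x = \<phi> x)"

definition omit :: "nat \<Rightarrow> nat \<Rightarrow> (nat \<Rightarrow> 'g) \<Rightarrow> (nat \<Rightarrow> 'g)" where
  "omit n i x = (\<lambda>j\<in>{..<n}. if j < i then x j else x (Suc j))"

text \<open>Differential from cochains on G^n to cochains on G^(n+1):
  d sigma(g_1..g_{n+1}) = sum_{i=1}^{n+1} (-1)^(n+1-i) sigma(g_1..^g_i..g_{n+1});
  here with 0-based index i, the sign is (-1)^(n-i).\<close>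
definition cobd :: "nat \<Rightarrow> ((nat \<Rightarrow> 'g) \<Rightarrow> 'a::ab_group_add) \<Rightarrow> (nat \<Rightarrow> 'g) \<Rightarrow> 'a" where
  "cobd n \<sigma> x = (\<Sum>i<Suc n. (if even (n - i) then \<sigma> (omit n i x) else - \<sigma> (omit n i x)))"

definition equiv_cocycle ::
  "'g::topological_group_add measure \<Rightarrow> ('g \<Rightarrow> 'a::topological_ab_group_add \<Rightarrow> 'a) \<Rightarrow> nat
    \<Rightarrow> ((nat \<Rightarrow> 'g) \<Rightarrow> 'a) \<Rightarrow> bool" where
  "equiv_cocycle \<mu> \<alpha> p \<sigma> \<longleftrightarrow>
     equiv_cochain \<mu> \<alpha> (Suc p) \<sigma> \<and>
     (AE x in Mpow \<mu> (Suc (Suc p)). cobd (Suc p) \<sigma> x = 0)"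

text \<open>Two degree-p cocycles define the same class in H^p_m(G,A): their difference is
a.e. the differential of an equivariant measurable cochain on G^p (p > 0); in
degree 0 there are no coboundaries, so they must agree a.e.\<close>
definition cohomologous ::
  "'g::topological_group_add measure \<Rightarrow> ('g \<Rightarrow> 'a::topological_ab_group_add \<Rightarrow> 'a) \<Rightarrow> nat
    \<Rightarrow> ((nat \<Rightarrow> 'g) \<Rightarrow> 'a) \<Rightarrow> ((nat \<Rightarrow> 'g) \<Rightarrow> 'a) \<Rightarrow> bool" where
  "cohomologous \<mu> \<alpha> p \<sigma> \<phi> \<longleftrightarrow>
     (if p = 0 then (AE x in Mpow \<mu> (Suc 0). \<sigma> x = \<phi> x)
      else (\<exists>\<psi>. equiv_cochain \<mu> \<alpha> p \<psi> \<and>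
              (AE x in Mpow \<mu> (Suc p). \<sigma> x - \<phi> x = cobd p \<psi> x)))"

end

theory Submission
  imports Defs "HOL-Probability.Probability"
begin

text \<open>
  A cochain on \<open>G^n\<close> is regarded, for each \<open>m\<close>, as a function of its first \<open>m\<close> variables with
  values in the Polish group of measurable functions of the remaining ones, under convergence in
  measure.  For \<open>m = 1\<close> every strictly equivariant cochain is continuous in this sense, because
  translation is continuous in measure.  To pass from \<open>m\<close> to \<open>m + 1\<close>, split the coboundary into
  the faces omitting one of the first \<open>m + 1\<close> variables and the faces omitting a later one: the
  cocycle identity says that the head coboundary of the current function is, up to sign, a tail
  coboundary.  The tail coboundary is an open surjection onto the tail cocycles (a tail cocycle is
  the coboundary of its restriction to a generic value of the last variable), so an almost
  everywhere continuous family of tail cocycles has an almost everywhere continuous family of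
  primitives, built by successive corrections that are constant on open pieces with null
  frontiers; a point mass at the identity forces continuity there.  Two primitives differ by a
  tail coboundary, so that for \<open>m = n\<close> the resulting cochain differs from the given cocycle by a
  coboundary.

  All variables are embedded in the space of sequences with an infinite product of a probability
  measure equivalent to Haar measure, so that the number of variables need not appear in types.
\<close>

section \<open>Convergence in measure\<close>

lemma LIMSEQ_subsubseqI:
  fixes f :: "nat \<Rightarrow> 'c::topological_space"
  assumes "\<And>r::nat \<Rightarrow> nat. strict_mono r \<Longrightarrow> \<exists>s::nat \<Rightarrow> nat. strict_mono s \<and> (\<lambda>k. f (r (s k))) \<longlonglongrightarrow> l"
  shows "f \<longlonglongrightarrow> l"
proof (rule ccontr)
  assume "\<not> f \<longlonglongrightarrow> l"
  then obtain S where S: "open S" "l \<in> S" "\<exists>\<^sub>F k in sequentially. f k \<notin> S"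
    unfolding tendsto_def by (auto simp: not_eventually)
  then have infinite: "infinite {k. f k \<notin> S}"
    by (simp add: frequently_cofinite[symmetric] cofinite_eq_sequentially)
  define r where "r = enumerate {k. f k \<notin> S}"
  have r: "strict_mono r" "\<And>k. f (r k) \<notin> S"
    using infinite unfolding r_def by (auto simp: strict_mono_enumerate dest: enumerate_in_set)
  from assms[OF r(1)] obtain s :: "nat \<Rightarrow> nat" where "(\<lambda>k. f (r (s k))) \<longlonglongrightarrow> l" by blast
  then have "\<forall>\<^sub>F k in sequentially. f (r (s k)) \<in> S"
    using S by (simp add: topological_tendstoD)
  with r(2) show False by simp
qed

lemma LIMSEQ_compose_subseq:
  fixes r :: "nat \<Rightarrow> nat"
  shows "X \<longlonglongrightarrow> l \<Longrightarrow> strict_mono r \<Longrightarrow> (\<lambda>k. X (r k)) \<longlonglongrightarrow> l"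
  using LIMSEQ_subseq_LIMSEQ[of X l r] by (simp add: o_def)

lemma min_1_dist_tendsto_0_iff:
  fixes f :: "'x \<Rightarrow> 'b::metric_space"
  shows "((\<lambda>x. min 1 (dist (f x) l)) \<longlongrightarrow> 0) F \<longleftrightarrow> (f \<longlongrightarrow> l) F"
proof
  assume lim: "((\<lambda>x. min 1 (dist (f x) l)) \<longlongrightarrow> 0) F"
  show "(f \<longlongrightarrow> l) F"
  proof (rule tendstoI)
    fix e :: real assume "0 < e"
    then have "\<forall>\<^sub>F x in F. min 1 (dist (f x) l) < min 1 e"
      by (intro order_tendstoD(2)[OF lim]) simp
    then show "\<forall>\<^sub>F x in F. dist (f x) l < e" by eventually_elim (auto simp: min_def split: if_splits)
  qed
next
  assume "(f \<longlongrightarrow> l) F"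
  then have "((\<lambda>x. min 1 (dist (f x) l)) \<longlongrightarrow> min 1 0) F"
    by (intro tendsto_min tendsto_const) (simp add: tendsto_dist_iff[symmetric])
  then show "((\<lambda>x. min 1 (dist (f x) l)) \<longlongrightarrow> 0) F" by simp
qed

definition meas_dist :: "'x measure \<Rightarrow> ('x \<Rightarrow> 'b::metric_space) \<Rightarrow> ('x \<Rightarrow> 'b) \<Rightarrow> real" where
  "meas_dist M u v = (\<integral>x. min 1 (dist (u x) (v x)) \<partial>M)"

definition tendsto_in_measure ::
  "'x measure \<Rightarrow> (nat \<Rightarrow> 'x \<Rightarrow> 'b::metric_space) \<Rightarrow> ('x \<Rightarrow> 'b) \<Rightarrow> bool" where
  "tendsto_in_measure M U u \<longleftrightarrow> (\<forall>k. U k \<in> borel_measurable M) \<and> u \<in> borel_measurable M \<and>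
     (\<lambda>k. meas_dist M (U k) u) \<longlonglongrightarrow> 0"

definition continuous_in_measure ::
  "'x measure \<Rightarrow> ('t::topological_space \<Rightarrow> 'x \<Rightarrow> 'b::metric_space) \<Rightarrow> 't \<Rightarrow> bool" where
  "continuous_in_measure M b t \<longleftrightarrow> (\<forall>X. X \<longlonglongrightarrow> t \<longrightarrow> tendsto_in_measure M (\<lambda>k. b (X k)) (b t))"

lemma tendsto_in_measureD:
  assumes "tendsto_in_measure M U u"
  shows "U k \<in> borel_measurable M" "u \<in> borel_measurable M" "(\<lambda>k. meas_dist M (U k) u) \<longlonglongrightarrow> 0"
  using assms by (auto simp: tendsto_in_measure_def)

lemma continuous_in_measureD:
  "continuous_in_measure M b t \<Longrightarrow> X \<longlonglongrightarrow> t \<Longrightarrow> tendsto_in_measure M (\<lambda>k. b (X k)) (b t)"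
  by (simp add: continuous_in_measure_def)

lemma tendsto_in_measure_subseq:
  fixes r :: "nat \<Rightarrow> nat"
  shows "tendsto_in_measure M U u \<Longrightarrow> strict_mono r \<Longrightarrow> tendsto_in_measure M (\<lambda>k. U (r k)) u"
  unfolding tendsto_in_measure_def using LIMSEQ_compose_subseq[of "\<lambda>k. meas_dist M (U k) u" 0 r] by auto

lemma meas_dist_self [simp]: "meas_dist M u u = 0"
  by (simp add: meas_dist_def)

lemma meas_dist_nonneg [simp]: "0 \<le> meas_dist M u v"
  unfolding meas_dist_def by (rule integral_nonneg_AE) auto

lemma meas_dist_commute: "meas_dist M u v = meas_dist M v u"
  by (simp add: meas_dist_def dist_commute)

lemma tendsto_in_measure_const: "u \<in> borel_measurable M \<Longrightarrow> tendsto_in_measure M (\<lambda>_. u) u"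
  by (simp add: tendsto_in_measure_def)

lemma tendsto_in_measureI_le:
  assumes "\<And>k. U k \<in> borel_measurable M" "u \<in> borel_measurable M"
    and "\<And>k. meas_dist M (U k) u \<le> a k" "a \<longlonglongrightarrow> 0"
  shows "tendsto_in_measure M U u"
  unfolding tendsto_in_measure_def
  using assms by (auto intro: tendsto_sandwich[OF _ _ tendsto_const assms(4)])

context finite_measure
begin

lemma integrable_min_dist:
  fixes u v :: "'a \<Rightarrow> 'b::{metric_space, second_countable_topology}"
  assumes [measurable]: "u \<in> borel_measurable M" "v \<in> borel_measurable M"
  shows "integrable M (\<lambda>x. min 1 (dist (u x) (v x)))"
  by (rule integrable_const_bound[of _ 1]) auto

lemma meas_dist_triangle:
  fixes u v w :: "'a \<Rightarrow> 'b::{metric_space, second_countable_topology}"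
  assumes "u \<in> borel_measurable M" "v \<in> borel_measurable M" "w \<in> borel_measurable M"
  shows "meas_dist M u w \<le> meas_dist M u v + meas_dist M v w"
proof -
  have "min 1 (dist (u x) (w x)) \<le> min 1 (dist (u x) (v x)) + min 1 (dist (v x) (w x))" for x
    using dist_triangle[of "u x" "w x" "v x"] zero_le_dist[of "u x" "v x"] zero_le_dist[of "v x" "w x"]
    by linarith
  then have "meas_dist M u w \<le> (\<integral>x. min 1 (dist (u x) (v x)) + min 1 (dist (v x) (w x)) \<partial>M)"
    unfolding meas_dist_def
    by (intro integral_mono integrable_min_dist Bochner_Integration.integrable_add assms)
  then show ?thesis
    unfolding meas_dist_def by (simp add: integrable_min_dist assms)
qed

lemma tendsto_in_measure_AE:
  fixes u :: "'a \<Rightarrow> 'b::{metric_space, second_countable_topology}"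
  assumes [measurable]: "\<And>k. U k \<in> borel_measurable M" "u \<in> borel_measurable M"
    and "AE x in M. (\<lambda>k. U k x) \<longlonglongrightarrow> u x"
  shows "tendsto_in_measure M U u"
proof -
  have "(\<lambda>k. meas_dist M (U k) u) \<longlonglongrightarrow> (\<integral>x. 0 \<partial>M)"
    unfolding meas_dist_def
  proof (rule integral_dominated_convergence[where w = "\<lambda>_. 1"])
    show "AE x in M. (\<lambda>k. min 1 (dist (U k x) (u x))) \<longlonglongrightarrow> 0"
      using assms(3) by (simp add: min_1_dist_tendsto_0_iff)
  qed auto
  then show ?thesis by (simp add: tendsto_in_measure_def)
qed

lemma tendsto_in_measure_AE_subseq:
  fixes u :: "'a \<Rightarrow> 'b::{metric_space, second_countable_topology}"
  assumes "tendsto_in_measure M U u"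
  obtains r :: "nat \<Rightarrow> nat" where "strict_mono r" "AE x in M. (\<lambda>k. U (r k) x) \<longlonglongrightarrow> u x"
proof -
  have "(\<lambda>k. \<integral>x. norm (min 1 (dist (U k x) (u x))) \<partial>M) \<longlonglongrightarrow> 0"
    using tendsto_in_measureD(3)[OF assms] by (simp add: meas_dist_def)
  then obtain r :: "nat \<Rightarrow> nat" where "strict_mono r"
    "AE x in M. (\<lambda>k. min 1 (dist (U (r k) x) (u x))) \<longlonglongrightarrow> 0"
    using tendsto_L1_AE_subseq[of M "\<lambda>k x. min 1 (dist (U k x) (u x))"]
      integrable_min_dist tendsto_in_measureD(1,2)[OF assms] by blast
  then show ?thesis by (intro that[of r]) (simp_all add: min_1_dist_tendsto_0_iff)
qed

lemma tendsto_in_measure_subsubseqI: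
  fixes u :: "'a \<Rightarrow> 'b::{metric_space, second_countable_topology}"
  assumes "\<And>k. U k \<in> borel_measurable M" "u \<in> borel_measurable M"
    and sub: "\<And>r::nat \<Rightarrow> nat. strict_mono r \<Longrightarrow>
      \<exists>s::nat \<Rightarrow> nat. strict_mono s \<and> (AE x in M. (\<lambda>k. U (r (s k)) x) \<longlonglongrightarrow> u x)"
  shows "tendsto_in_measure M U u"
proof -
  have "(\<lambda>k. meas_dist M (U k) u) \<longlonglongrightarrow> 0"
  proof (rule LIMSEQ_subsubseqI)
    fix r :: "nat \<Rightarrow> nat" assume "strict_mono r"
    then obtain s :: "nat \<Rightarrow> nat" where s: "strict_mono s" "AE x in M. (\<lambda>k. U (r (s k)) x) \<longlonglongrightarrow> u x"
      using sub by blast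
    then have "tendsto_in_measure M (\<lambda>k. U (r (s k))) u" using assms by (intro tendsto_in_measure_AE)
    with s(1) show "\<exists>s::nat \<Rightarrow> nat. strict_mono s \<and> (\<lambda>k. meas_dist M (U (r (s k))) u) \<longlonglongrightarrow> 0"
      using tendsto_in_measureD(3) by blast
  qed
  with assms show ?thesis by (simp add: tendsto_in_measure_def)
qed

text \<open>The maps taking \<open>U k x\<close> and \<open>U' k x\<close> to \<open>V k x\<close> may vary with \<open>k\<close>, hence the subsequence
  in the last hypothesis.\<close>

lemma tendsto_in_measure_map2:
  fixes u :: "'a \<Rightarrow> 'b::{metric_space, second_countable_topology}"
    and u' :: "'a \<Rightarrow> 'c::{metric_space, second_countable_topology}"
    and v :: "'a \<Rightarrow> 'd::{metric_space, second_countable_topology}"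
  assumes U: "tendsto_in_measure M U u" and U': "tendsto_in_measure M U' u'"
    and V: "\<And>k. V k \<in> borel_measurable M" "v \<in> borel_measurable M"
    and map: "\<And>(r::nat \<Rightarrow> nat) x. strict_mono r \<Longrightarrow> (\<lambda>k. U (r k) x) \<longlonglongrightarrow> u x \<Longrightarrow>
      (\<lambda>k. U' (r k) x) \<longlonglongrightarrow> u' x \<Longrightarrow> (\<lambda>k. V (r k) x) \<longlonglongrightarrow> v x"
  shows "tendsto_in_measure M V v"
proof (rule tendsto_in_measure_subsubseqI[OF V])
  fix r :: "nat \<Rightarrow> nat" assume r: "strict_mono r"
  obtain s :: "nat \<Rightarrow> nat" where s: "strict_mono s" "AE x in M. (\<lambda>k. U (r (s k)) x) \<longlonglongrightarrow> u x"
    using tendsto_in_measure_AE_subseq[OF tendsto_in_measure_subseq[OF U r]] .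
  have rs: "strict_mono (\<lambda>k. r (s k))" using strict_mono_o[OF r s(1)] by (simp add: o_def)
  obtain t :: "nat \<Rightarrow> nat" where t: "strict_mono t" "AE x in M. (\<lambda>k. U' (r (s (t k))) x) \<longlonglongrightarrow> u' x"
    using tendsto_in_measure_AE_subseq[OF tendsto_in_measure_subseq[OF U' rs]] .
  have rst: "strict_mono (\<lambda>k. r (s (t k)))" using strict_mono_o[OF rs t(1)] by (simp add: o_def)
  from s(2) t(2) have "AE x in M. (\<lambda>k. V (r (s (t k))) x) \<longlonglongrightarrow> v x"
    by eventually_elim (auto intro: map[OF rst] LIMSEQ_compose_subseq[OF _ t(1)])
  moreover have "strict_mono (\<lambda>k. s (t k))" using strict_mono_o[OF s(1) t(1)] by (simp add: o_def)
  ultimately show "\<exists>s::nat \<Rightarrow> nat. strict_mono s \<and> (AE x in M. (\<lambda>k. V (r (s k)) x) \<longlonglongrightarrow> v x)"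
    by blast
qed

lemma tendsto_in_measure_map:
  fixes u :: "'a \<Rightarrow> 'b::{metric_space, second_countable_topology}"
    and v :: "'a \<Rightarrow> 'd::{metric_space, second_countable_topology}"
  assumes "tendsto_in_measure M U u" "\<And>k. V k \<in> borel_measurable M" "v \<in> borel_measurable M"
    and "\<And>(r::nat \<Rightarrow> nat) x. strict_mono r \<Longrightarrow> (\<lambda>k. U (r k) x) \<longlonglongrightarrow> u x \<Longrightarrow> (\<lambda>k. V (r k) x) \<longlonglongrightarrow> v x"
  shows "tendsto_in_measure M V v"
  by (rule tendsto_in_measure_map2[OF assms(1,1)]) (use assms in auto)

lemma tendsto_in_measure_unique:
  fixes u v :: "'a \<Rightarrow> 'b::{metric_space, second_countable_topology}"
  assumes U: "tendsto_in_measure M U u" "tendsto_in_measure M U v"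
  shows "AE x in M. u x = v x"
proof -
  obtain r :: "nat \<Rightarrow> nat" where r: "strict_mono r" "AE x in M. (\<lambda>k. U (r k) x) \<longlonglongrightarrow> u x"
    using tendsto_in_measure_AE_subseq[OF U(1)] .
  obtain s :: "nat \<Rightarrow> nat" where s: "strict_mono s" "AE x in M. (\<lambda>k. U (r (s k)) x) \<longlonglongrightarrow> v x"
    using tendsto_in_measure_AE_subseq[OF tendsto_in_measure_subseq[OF U(2) r(1)]] .
  from r(2) s(2) show ?thesis
    by eventually_elim (auto intro: LIMSEQ_unique LIMSEQ_compose_subseq[OF _ s(1)])
qed

lemma tendsto_in_measure_sum:
  fixes u :: "'i \<Rightarrow> 'a \<Rightarrow> 'b::{metric_space, second_countable_topology, topological_ab_group_add}"
  assumes "finite I" "\<And>i. i \<in> I \<Longrightarrow> tendsto_in_measure M (U i) (u i)"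
  shows "tendsto_in_measure M (\<lambda>k x. \<Sum>i\<in>I. U i k x) (\<lambda>x. \<Sum>i\<in>I. u i x)"
  using assms
proof (induction I rule: finite_induct)
  case empty
  then show ?case by (simp add: tendsto_in_measure_const)
next
  case (insert i I)
  have sum: "tendsto_in_measure M (\<lambda>k x. \<Sum>i\<in>I. U i k x) (\<lambda>x. \<Sum>i\<in>I. u i x)"
    and i: "tendsto_in_measure M (U i) (u i)" using insert by auto
  note [measurable] = tendsto_in_measureD(1,2)[OF sum] tendsto_in_measureD(1,2)[OF i]
  show ?case
    by (rule tendsto_in_measure_map2[OF i sum]) (use insert.hyps in \<open>auto intro: tendsto_add\<close>)
qed

lemma continuous_in_measure_if_locally_constant_approx:
  fixes b :: "'t::topological_space \<Rightarrow> 'a \<Rightarrow> 'b::{metric_space, second_countable_topology}"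
  assumes B: "\<And>n x. B n x \<in> borel_measurable M" and b: "\<And>x. b x \<in> borel_measurable M"
    and close: "\<And>n x. meas_dist M (B n x) (b x) \<le> a n" "a \<longlonglongrightarrow> 0"
    and const: "\<And>n::nat. \<forall>\<^sub>F y in nhds x. B n y = B n x"
  shows "continuous_in_measure M b x"
  unfolding continuous_in_measure_def tendsto_in_measure_def
proof (intro allI impI conjI b tendstoI)
  fix X and \<epsilon> :: real assume X: "X \<longlonglongrightarrow> x" and "0 < \<epsilon>"
  then have "\<forall>\<^sub>F n in sequentially. a n < \<epsilon> / 2" by (intro order_tendstoD(2)[OF close(2)]) simp
  then obtain n where n: "a n < \<epsilon> / 2" by (auto simp: eventually_sequentially)
  from filterlim_iff[THEN iffD1, OF X, rule_format, OF const[of n]]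
  show "\<forall>\<^sub>F k in sequentially. dist (meas_dist M (b (X k)) (b x)) 0 < \<epsilon>"
  proof eventually_elim
    case (elim k)
    have "meas_dist M (b (X k)) (b x) \<le> meas_dist M (b (X k)) (B n (X k)) + meas_dist M (B n (X k)) (b x)"
      by (intro meas_dist_triangle B b)
    also have "\<dots> \<le> a n + a n"
      using close(1)[of n "X k"] close(1)[of n x] elim by (simp add: meas_dist_commute[of M "b (X k)"])
    finally show ?case using n by simp
  qed
qed

end

lemma (in prob_space) meas_dist_le_1:
  fixes u v :: "'a \<Rightarrow> 'b::{metric_space, second_countable_topology}"
  assumes "u \<in> borel_measurable M" "v \<in> borel_measurable M"
  shows "meas_dist M u v \<le> 1"
proof -
  have "meas_dist M u v \<le> (\<integral>x. 1 \<partial>M)"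
    unfolding meas_dist_def by (intro integral_mono integrable_min_dist assms) auto
  then show ?thesis by (simp add: prob_space)
qed

lemma Cauchy_if_summable_dist:
  fixes f :: "nat \<Rightarrow> 'b::metric_space"
  assumes "summable (\<lambda>k. dist (f k) (f (Suc k)))"
  shows "Cauchy f"
proof (rule metric_CauchyI)
  fix e :: real assume e: "0 < e"
  let ?a = "\<lambda>k. dist (f k) (f (Suc k))"
  obtain N where N: "\<And>m n. m \<ge> N \<Longrightarrow> norm (sum ?a {m..<n}) < e"
    using assms[unfolded summable_Cauchy] e by meson
  have close: "dist (f m) (f (m + n)) < e" if "m \<ge> N" for m n
  proof -
    have "dist (f m) (f (m + n)) \<le> sum ?a {m..<m + n}"
    proof (induction n)
      case (Suc n)
      then show ?case using dist_triangle[of "f m" "f (m + Suc n)" "f (m + n)"] by simp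
    qed simp
    also have "\<dots> < e" using N[OF that, of "m + n"] by (simp add: abs_less_iff)
    finally show ?thesis .
  qed
  show "\<exists>M. \<forall>m\<ge>M. \<forall>n\<ge>M. dist (f m) (f n) < e"
  proof (intro exI allI impI)
    fix m n assume "m \<ge> N" "n \<ge> N"
    then show "dist (f m) (f n) < e"
      using close[of m "n - m"] close[of n "m - n"] by (cases "m \<le> n") (auto simp: dist_commute)
  qed
qed

lemma summable_min_1D:
  fixes a :: "nat \<Rightarrow> real"
  assumes "summable (\<lambda>k. min 1 (a k))"
  shows "summable a"
proof -
  have "(\<lambda>k. min 1 (a k)) \<longlonglongrightarrow> 0" using assms by (rule summable_LIMSEQ_zero)
  then have "\<forall>\<^sub>F k in sequentially. min 1 (a k) < 1" by (rule order_tendstoD) simp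
  then have "\<forall>\<^sub>F k in sequentially. min 1 (a k) = a k" by eventually_elim auto
  from summable_cong[OF this] assms show ?thesis by simp
qed

text \<open>On a sequence that does not converge, \<open>lim\<close> takes the fixed junk value \<open>THE x. False\<close>.\<close>

lemma borel_measurable_lim_complete:
  fixes f :: "nat \<Rightarrow> 'x \<Rightarrow> 'b::{complete_space, second_countable_topology}"
  assumes [measurable]: "\<And>i. f i \<in> borel_measurable M"
  shows "(\<lambda>x. lim (\<lambda>i. f i x)) \<in> borel_measurable M"
proof (rule borel_measurable_LIMSEQ_metric)
  let ?g = "\<lambda>i x. if Cauchy (\<lambda>i. f i x) then f i x else THE x. False"
  show "?g i \<in> borel_measurable M" for i by measurable
  show "(\<lambda>i. ?g i x) \<longlonglongrightarrow> lim (\<lambda>i. f i x)" for x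
  proof (cases "Cauchy (\<lambda>i. f i x)")
    case True
    then show ?thesis by (simp add: Cauchy_convergent_iff convergent_LIMSEQ_iff)
  next
    case False
    then have "\<nexists>l. (\<lambda>i. f i x) \<longlonglongrightarrow> l" by (auto intro: LIMSEQ_imp_Cauchy)
    then have "lim (\<lambda>i. f i x) = (THE x. False)" by (simp add: lim_def)
    with False show ?thesis by simp
  qed
qed

context finite_measure
begin

lemma AE_convergent_if_geometric_meas_dist:
  fixes U :: "nat \<Rightarrow> 'a \<Rightarrow> 'b::{complete_space, second_countable_topology}"
  assumes [measurable]: "\<And>k. U k \<in> borel_measurable M"
    and le: "\<And>k. meas_dist M (U k) (U (Suc k)) \<le> c / 2 ^ k"
  shows "AE x in M. convergent (\<lambda>k. U k x)"
proof -
  have "0 \<le> c" using order_trans[OF meas_dist_nonneg le[of 0]] by simp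
  let ?a = "\<lambda>k x. min 1 (dist (U k x) (U (Suc k) x))"
  have "(\<integral>\<^sup>+x. (\<Sum>k. ennreal (?a k x)) \<partial>M) = (\<Sum>k. \<integral>\<^sup>+x. ennreal (?a k x) \<partial>M)"
    by (rule nn_integral_suminf) auto
  also have "\<dots> = (\<Sum>k. ennreal (meas_dist M (U k) (U (Suc k))))"
    unfolding meas_dist_def
    by (intro suminf_cong nn_integral_eq_integral integrable_min_dist) auto
  also have "\<dots> \<le> (\<Sum>k. ennreal (c * (1 / 2) ^ k))"
    using le by (intro suminf_le ennreal_leI) (auto simp: power_one_over)
  also have "\<dots> = ennreal (\<Sum>k. c * (1 / 2) ^ k)"
    using \<open>0 \<le> c\<close> by (intro suminf_ennreal2 summable_mult summable_geometric) auto
  finally have "(\<integral>\<^sup>+x. (\<Sum>k. ennreal (?a k x)) \<partial>M) \<noteq> \<infinity>"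
    by (auto simp: top_unique)
  then have "AE x in M. (\<Sum>k. ennreal (?a k x)) \<noteq> \<infinity>"
    by (intro nn_integral_PInf_AE) auto
  then show ?thesis
  proof eventually_elim
    case (elim x)
    then have "summable (\<lambda>k. ?a k x)" by (intro summable_suminf_not_top) auto
    then show ?case
      by (intro Cauchy_convergent Cauchy_if_summable_dist) (rule summable_min_1D)
  qed
qed

lemma meas_dist_lim_le:
  fixes U :: "nat \<Rightarrow> 'a \<Rightarrow> 'b::{complete_space, second_countable_topology}"
  assumes meas: "\<And>k. U k \<in> borel_measurable M"
    and le: "\<And>k. meas_dist M (U k) (U (Suc k)) \<le> c / 2 ^ k"
  shows "meas_dist M (U k) (\<lambda>x. lim (\<lambda>k. U k x)) \<le> 2 * c / 2 ^ k"
proof -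
  define v where "v x = lim (\<lambda>k. U k x)" for x
  have v: "v \<in> borel_measurable M" unfolding v_def using meas by (rule borel_measurable_lim_complete)
  have "AE x in M. (\<lambda>k. U k x) \<longlonglongrightarrow> v x"
    using AE_convergent_if_geometric_meas_dist[OF meas le] by (simp add: v_def convergent_LIMSEQ_iff)
  then have lim: "(\<lambda>j. meas_dist M (U (j + k)) v) \<longlonglongrightarrow> 0"
    by (intro LIMSEQ_ignore_initial_segment tendsto_in_measureD(3) tendsto_in_measure_AE meas v)
  have segment: "meas_dist M (U k) (U (k + j)) \<le> 2 * c / 2 ^ k - 2 * c / 2 ^ (k + j)" for j
  proof (induction j)
    case (Suc j)
    have "meas_dist M (U k) (U (k + Suc j)) \<le>
        meas_dist M (U k) (U (k + j)) + meas_dist M (U (k + j)) (U (k + Suc j))"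
      by (intro meas_dist_triangle meas)
    also have "\<dots> \<le> (2 * c / 2 ^ k - 2 * c / 2 ^ (k + j)) + c / 2 ^ (k + j)"
      using Suc le[of "k + j"] by simp
    finally show ?case by (simp add: field_simps)
  qed simp
  have "0 \<le> c" using order_trans[OF meas_dist_nonneg le[of 0]] by simp
  have "meas_dist M (U k) v - 2 * c / 2 ^ k \<le> meas_dist M (U (j + k)) v" for j
  proof -
    have "0 \<le> 2 * c / 2 ^ (k + j)" using \<open>0 \<le> c\<close> by simp
    then show ?thesis
      using meas_dist_triangle[OF meas[of k] meas[of "k + j"] v] segment[of j] by (simp add: add.commute)
  qed
  then have "meas_dist M (U k) v - 2 * c / 2 ^ k \<le> 0" by (intro LIMSEQ_le_const[OF lim]) auto
  then show ?thesis unfolding v_def by simp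
qed

end

lemma borel_measurable_uminus_group [measurable (raw)]:
  fixes f :: "'x \<Rightarrow> 'b::{second_countable_topology, topological_group_add}"
  assumes "f \<in> borel_measurable M"
  shows "(\<lambda>x. - f x) \<in> borel_measurable M"
  using assms by (rule borel_measurable_continuous_on[rotated]) (intro continuous_intros)

lemma borel_measurable_diff_group [measurable (raw)]:
  fixes f :: "'x \<Rightarrow> 'b::{second_countable_topology, topological_group_add}"
  assumes [measurable]: "f \<in> borel_measurable M" "g \<in> borel_measurable M"
  shows "(\<lambda>x. f x - g x) \<in> borel_measurable M"
  unfolding diff_conv_add_uminus by measurable

lemma measurable_pred_eq:
  fixes f g :: "'x \<Rightarrow> 'b::{second_countable_topology, t2_space}"
  assumes "f \<in> borel_measurable M" "g \<in> borel_measurable M"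
  shows "Measurable.pred M (\<lambda>x. f x = g x)"
  using measurable_equality_set[OF assms] by (simp add: pred_def)

section \<open>Quasi-invariant probability measures\<close>

locale quasi_invariant = prob_space L
  for L :: "'g::{topological_group_add, t2_space, second_countable_topology} measure" +
  assumes sets_L: "sets L = sets borel"
    and open_pos: "\<And>U. open U \<Longrightarrow> U \<noteq> {} \<Longrightarrow> emeasure L U > 0"
    and completely_regular: "completely_regular_space (euclidean :: 'g topology)"
    and translate_small: "\<And>g e. 0 < e \<Longrightarrow>
      \<exists>d>0. \<forall>\<^sub>F h in nhds g. \<forall>A\<in>sets borel. prob A < d \<longrightarrow> prob ((\<lambda>x. h + x) -` A) < e"
begin

lemma space_L [simp]: "space L = UNIV"
  using sets_eq_imp_space_eq[OF sets_L] by simp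

lemma measurable_L [simp]: "measurable L M = measurable borel M" "measurable M L = measurable M borel"
  by (rule measurable_cong_sets; simp add: sets_L)+

lemma integrable_bounded_L:
  fixes \<phi> :: "'g \<Rightarrow> real"
  assumes "\<phi> \<in> borel_measurable borel" "\<And>x. \<bar>\<phi> x\<bar> \<le> B"
  shows "integrable L \<phi>"
  by (rule integrable_const_bound[of _ B]) (use assms in auto)

lemma AE_translate:
  assumes "AE x in L. Q x"
  shows "AE x in L. Q (g + x)"
proof -
  from assms obtain N where N: "N \<in> null_sets L" "{x. \<not> Q x} \<subseteq> N"
    by (auto simp: eventually_ae_filter)
  have N_borel [measurable]: "N \<in> sets borel" using N(1) by (auto simp: sets_L null_sets_def)
  have small: "prob ((\<lambda>x. g + x) -` N) < e" if e: "0 < e" for e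
  proof -
    obtain d where d: "0 < d"
      "\<forall>\<^sub>F h in nhds g. \<forall>A\<in>sets borel. prob A < d \<longrightarrow> prob ((\<lambda>x. h + x) -` A) < e"
      using translate_small[OF e] by blast
    have "prob N = 0" using N(1) by (simp add: measure_def null_setsD1)
    with eventually_nhds_x_imp_x[OF d(2)] d(1) N_borel show ?thesis by simp
  qed
  have "prob ((\<lambda>x. g + x) -` N) = 0"
    using small[of "prob ((\<lambda>x. g + x) -` N)"] measure_nonneg[of L "(\<lambda>x. g + x) -` N"] by linarith
  moreover have "(\<lambda>x. g + x) -` N \<in> sets L"
    using measurable_sets_borel[of "\<lambda>x. g + x" borel N] by (simp add: sets_L)
  ultimately have "AE x in L. x \<notin> (\<lambda>x. g + x) -` N"
    by (intro AE_not_in) (auto simp: null_sets_def emeasure_eq_measure)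
  then show ?thesis by eventually_elim (use N(2) in auto)
qed

text \<open>By Fubini, a null set is avoided by \<open>- y + x\<close> for almost all pairs, hence for some \<open>x\<close>
  and almost all \<open>y\<close>; left quasi-invariance then removes \<open>x\<close>.\<close>

lemma AE_uminus:
  assumes "AE x in L. Q x"
  shows "AE x in L. Q (- x)"
proof -
  interpret LL: pair_prob_space L L ..
  from assms obtain N where N: "N \<in> null_sets L" "{x. \<not> Q x} \<subseteq> N"
    by (auto simp: eventually_ae_filter)
  have [measurable]: "N \<in> sets borel" using N(1) by (auto simp: sets_L null_sets_def)
  have "AE y in L. AE x in L. - y + x \<notin> N"
    by (intro AE_I2 AE_translate AE_not_in N)
  moreover have "Measurable.pred (L \<Otimes>\<^sub>M L) (\<lambda>z. - fst z + snd z \<notin> N)"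
    by (simp add: measurable_cong_sets[OF sets_pair_measure_cong[OF sets_L sets_L] refl])
  ultimately have "AE x in L. AE y in L. - y + x \<notin> N"
    using LL.AE_commute[of "\<lambda>y x. - y + x \<notin> N"] by (simp add: pred_def)
  from eventually_happens'[OF ae_filter_bot this] obtain x where "AE y in L. - y + x \<notin> N" by (elim exE)
  from AE_translate[OF this, of x] have "AE y in L. - y \<notin> N"
    by (simp add: minus_add add.assoc)
  then show ?thesis by eventually_elim (use N(2) in auto)
qed

lemma AE_right_translate:
  assumes "AE x in L. Q x"
  shows "AE x in L. Q (x + t)"
proof -
  have "AE x in L. Q (- (- t + - x))"
    using AE_uminus[OF AE_translate[OF AE_uminus[OF assms], of "- t"]] .
  then show ?thesis by (simp add: minus_add)
qed

lemma integral_translate_small: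
  assumes e: "0 < (e::real)"
  shows "\<exists>d>0. \<forall>\<^sub>F h in nhds g. \<forall>\<phi>\<in>borel_measurable borel. (\<forall>x. 0 \<le> \<phi> x \<and> \<phi> x \<le> 1) \<longrightarrow>
    (\<integral>x. \<phi> x \<partial>L) < d \<longrightarrow> (\<integral>x. \<phi> (h + x) \<partial>L) < e"
proof -
  obtain d where d: "0 < d"
    "\<forall>\<^sub>F h in nhds g. \<forall>A\<in>sets borel. prob A < d \<longrightarrow> prob ((\<lambda>x. h + x) -` A) < e / 2"
    using translate_small[of "e / 2" g] e by auto
  have "(\<integral>x. \<phi> (h + x) \<partial>L) < e"
    if small: "\<forall>A\<in>sets borel. prob A < d \<longrightarrow> prob ((\<lambda>x. h + x) -` A) < e / 2"
      and [measurable]: "\<phi> \<in> borel_measurable borel" and bound: "\<forall>x. 0 \<le> \<phi> x \<and> \<phi> x \<le> 1"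
      and less: "(\<integral>x. \<phi> x \<partial>L) < d * (e / 2)" for h and \<phi> :: "'g \<Rightarrow> real"
  proof -
    define A where "A = {x. e / 2 \<le> \<phi> x}"
    have [measurable]: "A \<in> sets borel" unfolding A_def by measurable
    have integrable: "integrable L \<phi>" by (rule integrable_bounded_L[of _ 1]) (use bound in auto)
    have "prob A \<le> (\<integral>x. \<phi> x \<partial>L) / (e / 2)"
      using integral_Markov_inequality_measure[OF integrable sets.empty_sets, of "e / 2"] bound e
      by (simp add: A_def)
    also have "\<dots> < d" using less e by (simp add: pos_divide_less_eq)
    finally have "prob ((\<lambda>x. h + x) -` A) < e / 2" using small by simp
    moreover have "(\<integral>x. \<phi> (h + x) \<partial>L) \<le> (\<integral>x. indicator ((\<lambda>x. h + x) -` A) x + e / 2 \<partial>L)"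
      by (intro integral_mono Bochner_Integration.integrable_add integrable_const integrable_bounded_L[of _ 1])
         (use bound e in \<open>auto simp: A_def indicator_def intro: add_increasing2\<close>)
    ultimately show ?thesis
      using measurable_sets_borel[of "\<lambda>x. h + x" borel A] prob_space
      by (simp add: sets_L integrable_bounded_L[of _ 1])
  qed
  then show ?thesis
    by (intro exI[of _ "d * (e / 2)"] conjI eventually_mono[OF d(2)]) (use d(1) e in auto)
qed

lemma integral_translate_tendsto_0:
  assumes \<gamma>: "\<gamma> \<longlonglongrightarrow> g" and "\<And>k. \<phi> k \<in> borel_measurable borel"
    and bound: "\<And>k x. 0 \<le> \<phi> k x \<and> \<phi> k x \<le> (1::real)" and lim: "(\<lambda>k. \<integral>x. \<phi> k x \<partial>L) \<longlonglongrightarrow> 0"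
  shows "(\<lambda>k. \<integral>x. \<phi> k (\<gamma> k + x) \<partial>L) \<longlonglongrightarrow> 0"
proof (rule tendstoI)
  fix e :: real assume "0 < e"
  then obtain d where d: "0 < d"
    "\<forall>\<^sub>F h in nhds g. \<forall>\<phi>\<in>borel_measurable borel. (\<forall>x. 0 \<le> \<phi> x \<and> \<phi> x \<le> 1) \<longrightarrow>
      (\<integral>x. \<phi> x \<partial>L) < d \<longrightarrow> (\<integral>x. \<phi> (h + x) \<partial>L) < e"
    using integral_translate_small[of e g] by blast
  from filterlim_iff[THEN iffD1, OF \<gamma>, rule_format, OF d(2)] order_tendstoD(2)[OF lim d(1)]
  show "\<forall>\<^sub>F k in sequentially. dist (\<integral>x. \<phi> k (\<gamma> k + x) \<partial>L) 0 < e"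
  proof eventually_elim
    case (elim k)
    then have "(\<integral>x. \<phi> k (\<gamma> k + x) \<partial>L) < e" using assms(2) bound by blast
    moreover have "0 \<le> (\<integral>x. \<phi> k (\<gamma> k + x) \<partial>L)" using bound by (intro integral_nonneg_AE) auto
    ultimately show ?case by simp
  qed
qed

lemma continuous_translation_limit:
  fixes u :: "'g \<Rightarrow> 'b::{metric_space, second_countable_topology}"
  assumes lim: "tendsto_in_measure L U u"
    and cont: "\<And>n. continuous_in_measure L (\<lambda>g x. U n (g + x)) g"
  shows "continuous_in_measure L (\<lambda>g x. u (g + x)) g"
  unfolding continuous_in_measure_def tendsto_in_measure_def
proof (intro allI impI conjI tendstoI)
  note [measurable] = tendsto_in_measureD(1,2)[OF lim, simplified]
  show "(\<lambda>x. u (h + x)) \<in> borel_measurable L" "(\<lambda>x. u (h + x)) \<in> borel_measurable L" for h by simp_all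
  fix X and e :: real assume X: "X \<longlonglongrightarrow> g" and "0 < e"
  then obtain d where d: "0 < d"
    "\<forall>\<^sub>F h in nhds g. \<forall>\<phi>\<in>borel_measurable borel. (\<forall>x. 0 \<le> \<phi> x \<and> \<phi> x \<le> 1) \<longrightarrow>
      (\<integral>x. \<phi> x \<partial>L) < d \<longrightarrow> (\<integral>x. \<phi> (h + x) \<partial>L) < e / 3"
    using integral_translate_small[of "e / 3" g] by auto
  obtain n where n: "meas_dist L (U n) u < d"
    using order_tendstoD(2)[OF tendsto_in_measureD(3)[OF lim] d(1)] eventually_happens by force
  have close: "\<forall>\<^sub>F h in nhds g. meas_dist L (\<lambda>x. U n (h + x)) (\<lambda>x. u (h + x)) < e / 3"
    using d(2)
  proof eventually_elim
    case (elim h)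
    then show ?case
      using bspec[OF elim, of "\<lambda>x. min 1 (dist (U n x) (u x))"] n by (simp add: meas_dist_def)
  qed
  have "(\<lambda>k. meas_dist L (\<lambda>x. U n (X k + x)) (\<lambda>x. U n (g + x))) \<longlonglongrightarrow> 0"
    using tendsto_in_measureD(3)[OF continuous_in_measureD[OF cont X]] .
  then have "\<forall>\<^sub>F k in sequentially. meas_dist L (\<lambda>x. U n (X k + x)) (\<lambda>x. U n (g + x)) < e / 3"
    using \<open>0 < e\<close> by (intro order_tendstoD) auto
  with filterlim_iff[THEN iffD1, OF X, rule_format, OF close]
  show "\<forall>\<^sub>F k in sequentially. dist (meas_dist L (\<lambda>x. u (X k + x)) (\<lambda>x. u (g + x))) 0 < e"
  proof eventually_elim
    case (elim k)
    have "meas_dist L (\<lambda>x. u (X k + x)) (\<lambda>x. u (g + x)) \<le>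
        meas_dist L (\<lambda>x. u (X k + x)) (\<lambda>x. U n (X k + x)) +
        (meas_dist L (\<lambda>x. U n (X k + x)) (\<lambda>x. U n (g + x)) +
         meas_dist L (\<lambda>x. U n (g + x)) (\<lambda>x. u (g + x)))"
      by (intro order_trans[OF meas_dist_triangle add_left_mono[OF meas_dist_triangle]]) auto
    with elim eventually_nhds_x_imp_x[OF close] show ?case
      by (simp add: meas_dist_commute[of L "\<lambda>x. u (X k + x)"])
  qed
qed

lemma open_minus_translate_tendsto_0:
  assumes W: "open W" and X: "X \<longlonglongrightarrow> (g::'g)"
  shows "tendsto_in_measure L (\<lambda>k x. indicator W (g + x) * (1 - indicator W (X k + x)) :: real) (\<lambda>_. 0)"
proof (rule tendsto_in_measure_AE)
  have [measurable]: "W \<in> sets borel" using W by simp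
  show "(\<lambda>x. indicator W (g + x) * (1 - indicator W (X k + x)) :: real) \<in> borel_measurable L" for k
    by simp
  have "(\<lambda>k. indicator W (g + x) * (1 - indicator W (X k + x)) :: real) \<longlonglongrightarrow> 0" for x
  proof (cases "g + x \<in> W")
    case True
    have "(\<lambda>k. X k + x) \<longlonglongrightarrow> g + x" by (intro tendsto_intros X)
    then have "\<forall>\<^sub>F k in sequentially. X k + x \<in> W" using W True by (rule topological_tendstoD)
    then have "\<forall>\<^sub>F k in sequentially. indicator W (g + x) * (1 - indicator W (X k + x)) = (0 :: real)"
      by eventually_elim simp
    then show ?thesis by (rule tendsto_eventually)
  qed simp
  then show "AE x in L. (\<lambda>k. indicator W (g + x) * (1 - indicator W (X k + x)) :: real) \<longlonglongrightarrow> 0"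
    by simp
qed simp

lemma continuous_translation_open:
  assumes W: "open W"
  shows "continuous_in_measure L (\<lambda>g x. indicator W (g + x) :: real) g"
  unfolding continuous_in_measure_def
proof (intro allI impI)
  fix X assume X: "X \<longlonglongrightarrow> g"
  have [measurable]: "W \<in> sets borel" using W by simp
  define out where "out k x = (indicator W (g + x) * (1 - indicator W (X k + x)) :: real)" for k x
  define into where "into k x = (indicator W x * (1 - indicator W (g - X k + x)) :: real)" for k x
  have "(\<lambda>k. g - X k) \<longlonglongrightarrow> g - g" by (intro tendsto_intros X)
  then have "tendsto_in_measure L into (\<lambda>_. 0)"
    using open_minus_translate_tendsto_0[OF W, of "\<lambda>k. g - X k" 0] by (simp add: into_def[abs_def])
  then have "(\<lambda>k. \<integral>x. min 1 (dist (into k x) 0) \<partial>L) \<longlonglongrightarrow> 0"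
    by (auto simp: tendsto_in_measure_def meas_dist_def)
  from integral_translate_tendsto_0[OF X _ _ this]
  have "(\<lambda>k. meas_dist L (\<lambda>x. into k (X k + x)) (\<lambda>_. 0)) \<longlonglongrightarrow> 0"
    by (simp add: meas_dist_def into_def)
  then have into: "tendsto_in_measure L (\<lambda>k x. into k (X k + x)) (\<lambda>_. 0)"
    by (simp add: tendsto_in_measure_def into_def)
  have out: "tendsto_in_measure L out (\<lambda>_. 0)"
    unfolding out_def by (rule open_minus_translate_tendsto_0[OF W X])
  show "tendsto_in_measure L (\<lambda>k x. indicator W (X k + x) :: real) (\<lambda>x. indicator W (g + x))"
  proof (rule tendsto_in_measure_map2[OF into out])
    fix r :: "nat \<Rightarrow> nat" and x assume "(\<lambda>k. into (r k) (X (r k) + x)) \<longlonglongrightarrow> 0" "(\<lambda>k. out (r k) x) \<longlonglongrightarrow> 0"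
    from tendsto_add[OF tendsto_const[of "indicator W (g + x)"] tendsto_diff[OF this]]
    have "(\<lambda>k. indicator W (g + x) + (into (r k) (X (r k) + x) - out (r k) x)) \<longlonglongrightarrow> indicator W (g + x)"
      by simp
    moreover have "indicator W (g + x) + (into k (X k + x) - out k x) = indicator W (X k + x)" for k
    proof -
      have "g - X k + (X k + x) = g + x" by (metis add.assoc diff_add_cancel)
      then show ?thesis by (auto simp: into_def out_def indicator_def)
    qed
    ultimately show "(\<lambda>k. indicator W (X (r k) + x) :: real) \<longlonglongrightarrow> indicator W (g + x)" by simp
  qed auto
qed

lemma continuous_translation_compl:
  assumes [measurable]: "A \<in> sets borel"
    and A: "continuous_in_measure L (\<lambda>g x. indicator A (g + x) :: real) g"
  shows "continuous_in_measure L (\<lambda>g x. indicator (UNIV - A) (g + x) :: real) g"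
  unfolding continuous_in_measure_def
proof (intro allI impI)
  fix X assume "X \<longlonglongrightarrow> g"
  note lim = continuous_in_measureD[OF A this]
  show "tendsto_in_measure L (\<lambda>k x. indicator (UNIV - A) (X k + x) :: real) (\<lambda>x. indicator (UNIV - A) (g + x))"
    by (rule tendsto_in_measure_map[OF lim])
       (auto simp: indicator_compl Compl_eq_Diff_UNIV[symmetric] intro: tendsto_diff)
qed

lemma continuous_translation_borel:
  assumes "A \<in> sets borel"
  shows "continuous_in_measure L (\<lambda>g x. indicator A (g + x) :: real) g"
proof -
  let ?G = "{S :: 'g set. open S}"
  have "Int_stable ?G" by (auto simp: Int_stable_def)
  moreover have "?G \<subseteq> Pow UNIV" by simp
  moreover have "A \<in> sigma_sets UNIV ?G" using assms by (simp add: borel_def)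
  ultimately show ?thesis
  proof (induction arbitrary: g rule: sigma_sets_induct_disjoint)
    case (basic A)
    then show ?case using continuous_translation_open by auto
  next
    case empty
    then show ?case by (simp add: continuous_in_measure_def tendsto_in_measure_const)
  next
    case (compl A)
    then show ?case by (intro continuous_translation_compl) (simp_all add: borel_def)
  next
    case (union A)
    have [measurable]: "A i \<in> sets borel" for i using union(2) by (auto simp: borel_def)
    show ?case
    proof (rule continuous_translation_limit)
      show "tendsto_in_measure L (\<lambda>n. indicator (\<Union>i<n. A i) :: _ \<Rightarrow> real) (indicator (\<Union>i. A i))"
        by (rule tendsto_in_measure_AE) (auto intro: LIMSEQ_indicator_UN)
      fix n
      have "indicator (\<Union>i<n. A i) x = (\<Sum>i<n. indicator (A i) x :: real)" for x
        using union(1) by (intro indicator_UN_disjoint) (auto simp: disjoint_family_on_def)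
      then show "continuous_in_measure L (\<lambda>g x. indicator (\<Union>i<n. A i) (g + x) :: real) g"
        using union(3) by (auto simp: continuous_in_measure_def intro!: tendsto_in_measure_sum)
    qed
  qed
qed

lemma continuous_translation_simple_function:
  fixes u :: "'g \<Rightarrow> 'b::{metric_space, second_countable_topology}"
  assumes u: "simple_function L u"
  shows "continuous_in_measure L (\<lambda>g x. u (g + x)) g"
  unfolding continuous_in_measure_def
proof (intro allI impI)
  fix X assume X: "X \<longlonglongrightarrow> g"
  have finite: "finite (range u)" using simple_functionD(1)[OF u] by simp
  have [measurable]: "u -` {y} \<in> sets borel" for y
    using simple_functionD(2)[OF u, of "{y}"] by (simp add: sets_L)
  have u_meas [measurable]: "u \<in> borel_measurable borel"
    using borel_measurable_simple_function[OF u] by simp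
  define \<Delta> where "\<Delta> y k x = \<bar>indicator (u -` {y}) (X k + x) - indicator (u -` {y}) (g + x) :: real\<bar>" for y k x
  have \<Delta>: "tendsto_in_measure L (\<Delta> y) (\<lambda>_. 0)" for y
  proof (rule tendsto_in_measure_map[OF continuous_in_measureD[OF continuous_translation_borel X]])
    fix r :: "nat \<Rightarrow> nat" and x
    assume "(\<lambda>k. indicator (u -` {y}) (X (r k) + x) :: real) \<longlonglongrightarrow> indicator (u -` {y}) (g + x)"
    from tendsto_rabs_zero[OF LIM_zero[OF this]] show "(\<lambda>k. \<Delta> y (r k) x) \<longlonglongrightarrow> 0" by (simp add: \<Delta>_def)
  qed (auto simp: \<Delta>_def[abs_def])
  have "tendsto_in_measure L (\<lambda>k x. \<Sum>y\<in>range u. \<Delta> y k x) (\<lambda>_. \<Sum>y\<in>range u. 0)"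
    by (intro tendsto_in_measure_sum finite \<Delta>)
  then show "tendsto_in_measure L (\<lambda>k x. u (X k + x)) (\<lambda>x. u (g + x))"
  proof (rule tendsto_in_measure_map)
    fix r :: "nat \<Rightarrow> nat" and x assume "(\<lambda>k. \<Sum>y\<in>range u. \<Delta> y (r k) x) \<longlonglongrightarrow> (\<Sum>y\<in>range u. 0)"
    then have "\<forall>\<^sub>F k in sequentially. (\<Sum>y\<in>range u. \<Delta> y (r k) x) < 1"
      by (rule order_tendstoD) simp
    then have "\<forall>\<^sub>F k in sequentially. u (X (r k) + x) = u (g + x)"
    proof eventually_elim
      case (elim k)
      have "\<Delta> (u (g + x)) (r k) x \<le> (\<Sum>y\<in>range u. \<Delta> y (r k) x)"
        using finite by (intro member_le_sum) (auto simp: \<Delta>_def)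
      with elim have "\<Delta> (u (g + x)) (r k) x < 1" by simp
      then show ?case by (auto simp: \<Delta>_def indicator_def split: if_splits)
    qed
    then show "(\<lambda>k. u (X (r k) + x)) \<longlonglongrightarrow> u (g + x)" by (rule tendsto_eventually)
  qed auto
qed

lemma continuous_translation:
  fixes u :: "'g \<Rightarrow> 'b::{metric_space, second_countable_topology}"
  assumes "u \<in> borel_measurable borel"
  shows "continuous_in_measure L (\<lambda>g x. u (g + x)) g"
proof -
  obtain U where U: "\<And>i. simple_function L (U i)" "\<And>x. (\<lambda>i. U i x) \<longlonglongrightarrow> u x"
    using borel_measurable_implies_sequence_metric[of u L undefined] assms by auto
  show ?thesis
  proof (rule continuous_translation_limit)
    show "tendsto_in_measure L U u"
      by (rule tendsto_in_measure_AE) (use assms U borel_measurable_simple_function[OF U(1)] in auto)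
  qed (rule continuous_translation_simple_function[OF U(1)])
qed

end

section \<open>Haar measure\<close>

lemma lcsc_sigma_compact:
  assumes "locally_compact_space (euclidean :: 'g::second_countable_topology topology)"
  obtains C :: "nat \<Rightarrow> 'g::second_countable_topology set" where "\<And>i. compact (C i)" "(\<Union>i. C i) = UNIV"
proof -
  have "\<exists>U K. open U \<and> compact K \<and> x \<in> U \<and> U \<subseteq> K" for x :: 'g
    using assms by (simp add: locally_compact_space_def)
  then obtain U K where UK: "\<And>x::'g. open (U x)" "\<And>x. compact (K x)" "\<And>x. x \<in> U x" "\<And>x. U x \<subseteq> K x"
    by metis
  obtain F where F: "F \<subseteq> range U" "countable F" "\<Union>F = \<Union>(range U)"
    using Lindelof[of "range U"] UK(1) by blast
  obtain D where D: "countable D" "F = U ` D"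
    using countable_subset_image F(1,2) by metis
  have cover: "(\<Union>x\<in>D. U x) = UNIV" using F(3) D(2) UK(3) by blast
  then have "D \<noteq> {}" by auto
  show ?thesis
  proof (rule that)
    show "compact (K (from_nat_into D i))" for i by (rule UK(2))
    have "(\<Union>x\<in>D. K x) = UNIV" using cover UK(4) by blast
    then show "(\<Union>i. K (from_nat_into D i)) = UNIV"
      using range_from_nat_into[OF \<open>D \<noteq> {}\<close> D(1)] by (metis image_image)
  qed
qed

lemma tight_if_sigma_compact:
  fixes M :: "'x::t2_space measure" and C :: "nat \<Rightarrow> 'x set"
  assumes M: "finite_measure M" "sets M = sets borel"
    and C: "\<And>i. compact (C i)" "(\<Union>i. C i) = UNIV" and "0 < e"
  obtains K where "compact K" "measure M (- K) < e"
proof -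
  interpret finite_measure M by (rule M(1))
  have space: "space M = UNIV" using sets_eq_imp_space_eq[OF M(2)] by simp
  define A where "A n = (\<Union>i<n. C i)" for n
  have A: "compact (A n)" for n unfolding A_def using C(1) by (intro compact_UN) auto
  then have A_sets: "A n \<in> sets M" for n by (simp add: M(2) compact_imp_closed)
  have "(\<lambda>n. measure M (A n)) \<longlonglongrightarrow> measure M (\<Union>n. A n)"
  proof (rule finite_Lim_measure_incseq)
    show "incseq A" unfolding A_def by (intro monoI UN_mono) auto
  qed (use A_sets in auto)
  moreover have "(\<Union>n. A n) = space M" using C(2) by (auto simp: A_def space)
  ultimately have "(\<lambda>n. measure M (A n)) \<longlonglongrightarrow> measure M (space M)" by simp
  then have "\<forall>\<^sub>F n in sequentially. measure M (space M) - e < measure M (A n)"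
    by (rule order_tendstoD) (use \<open>0 < e\<close> in simp)
  then obtain n where "measure M (space M) - e < measure M (A n)" by (auto simp: eventually_sequentially)
  then have "measure M (- A n) < e"
    using finite_measure_compl[OF A_sets[of n]] by (simp add: space Compl_eq_Diff_UNIV)
  with A show ?thesis by (rule that)
qed

lemma small_sublevel_set:
  fixes w :: "'x \<Rightarrow> real"
  assumes [measurable]: "w \<in> borel_measurable M" and pos: "\<And>x. 0 < w x"
    and K [measurable]: "K \<in> sets M" and finite: "emeasure M K < \<infinity>" and "0 < e"
  obtains c :: real where "0 < c" "emeasure M {x \<in> K. w x < 1 / c} < ennreal e"
proof -
  define B where "B n = {x \<in> K. w x < 1 / real (Suc n)}" for n
  have B [measurable]: "B n \<in> sets M" for n
    unfolding B_def using sets.sets_into_space[OF K] by (auto intro!: measurable_If)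
  have "\<exists>n. \<not> w x < 1 / real (Suc n)" for x
    using nat_approx_posE[OF pos[of x]] by (metis not_less_iff_gr_or_eq)
  then have "(\<Inter>n. B n) = {}" by (auto simp: B_def)
  moreover have "(\<lambda>n. emeasure M (B n)) \<longlonglongrightarrow> emeasure M (\<Inter>n. B n)"
  proof (rule Lim_emeasure_decseq)
    show "decseq B"
      unfolding B_def by (intro decseq_SucI) (auto intro: less_le_trans simp: frac_le)
    show "emeasure M (B n) \<noteq> \<infinity>" for n
      using emeasure_mono[of "B n" K M] finite K by (auto simp: B_def top_unique)
  qed auto
  ultimately have "(\<lambda>n. emeasure M (B n)) \<longlonglongrightarrow> 0" by simp
  then have "\<forall>\<^sub>F n in sequentially. emeasure M (B n) < ennreal e"
    by (rule order_tendstoD) (use \<open>0 < e\<close> in simp)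
  then obtain n where "emeasure M (B n) < ennreal e" by (auto simp: eventually_sequentially)
  then show ?thesis by (intro that[of "real (Suc n)"]) (simp_all add: B_def)
qed

lemma absolutely_continuous_density:
  fixes w :: "'x \<Rightarrow> real"
  assumes [measurable]: "w \<in> borel_measurable M" and pos: "\<And>x. 0 < w x"
    and K [measurable]: "K \<in> sets M" and finite: "emeasure M K < \<infinity>" and "0 < e"
  obtains d :: real where "0 < d"
    "\<And>A. A \<in> sets M \<Longrightarrow> emeasure (density M w) A < ennreal d \<Longrightarrow> emeasure M (K \<inter> A) < ennreal e"
proof -
  obtain c where c: "0 < c" "emeasure M {x \<in> K. w x < 1 / c} < ennreal (e / 2)"
    by (rule small_sublevel_set[OF assms(1) pos K finite, of "e / 2"]) (use \<open>0 < e\<close> in auto)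
  show ?thesis
  proof (rule that)
    show "0 < e / 2 / c" using \<open>0 < e\<close> c(1) by simp
    fix A assume A [measurable]: "A \<in> sets M" and less: "emeasure (density M w) A < ennreal (e / 2 / c)"
    define B where "B = {x \<in> K. w x < 1 / c}"
    define H where "H = {x \<in> A. 1 \<le> ennreal c * ennreal (w x)}"
    have [measurable]: "B \<in> sets M" "H \<in> sets M"
      unfolding B_def H_def using sets.sets_into_space[OF A] sets.sets_into_space[OF K] by auto
    have "emeasure M H \<le> ennreal c * (\<integral>\<^sup>+x. ennreal (w x) * indicator A x \<partial>M)"
      unfolding H_def by (rule nn_integral_Markov_inequality) auto
    also have "\<dots> = ennreal c * emeasure (density M w) A" by (simp add: emeasure_density)
    also have "\<dots> < ennreal c * ennreal (e / 2 / c)"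
      using less c(1) by (intro ennreal_mult_strict_left_mono) auto
    also have "\<dots> = ennreal (e / 2)"
      using \<open>0 < e\<close> c(1) by (subst ennreal_mult[symmetric]) auto
    finally have H: "emeasure M H < ennreal (e / 2)" .
    have "K \<inter> A \<subseteq> B \<union> H"
    proof
      fix x assume "x \<in> K \<inter> A"
      moreover have "1 \<le> ennreal c * ennreal (w x)" if "1 / c \<le> w x"
        using that c(1) by (simp add: ennreal_mult'[symmetric] pos_divide_le_eq mult.commute)
      ultimately show "x \<in> B \<union> H" by (cases "w x < 1 / c") (auto simp: B_def H_def)
    qed
    then have "emeasure M (K \<inter> A) \<le> emeasure M (B \<union> H)" by (intro emeasure_mono) auto
    also have "\<dots> \<le> emeasure M B + emeasure M H" by (rule emeasure_subadditive) auto
    also have "\<dots> < ennreal e" using add_mono_ennreal[OF c(2) H] by (simp add: B_def)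
    finally show "emeasure M (K \<inter> A) < ennreal e" .
  qed
qed

lemma (in sigma_finite_measure) equivalent_probability_density:
  assumes "emeasure M (space M) \<noteq> 0"
  obtains w :: "'a \<Rightarrow> real" and c :: real where "w \<in> borel_measurable M"
    "\<And>x. 0 < w x" "\<And>x. w x \<le> c" "prob_space (density M w)"
proof -
  obtain f :: "'a \<Rightarrow> real" where f: "f \<in> borel_measurable M" "\<And>x. 0 < f x" "\<And>x. f x \<le> 1" "integrable M f"
    by (rule obtain_positive_integrable_function) blast
  note f(1)[measurable]
  define c where "c = (\<integral>x. f x \<partial>M)"
  have "c \<noteq> 0"
  proof
    assume "c = 0"
    then have "AE x in M. f x = 0"
      unfolding c_def using f by (subst (asm) integral_nonneg_eq_0_iff_AE) (auto intro: less_imp_le)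
    then have "AE x in M. False" by eventually_elim (metis f(2) less_irrefl)
    with assms show False using AE_iff_measurable[of "space M" M "\<lambda>_. False"] by simp
  qed
  moreover have "0 \<le> c" unfolding c_def using f(2) by (intro integral_nonneg_AE) (auto intro: less_imp_le)
  ultimately have "0 < c" by simp
  show ?thesis
  proof (rule that)
    show "(\<lambda>x. f x / c) \<in> borel_measurable M" by measurable
    show "0 < f x / c" "f x / c \<le> 1 / c" for x using f(2,3) \<open>0 < c\<close> by (auto simp: divide_right_mono)
    have "(\<integral>\<^sup>+x. ennreal (f x / c) \<partial>M) = ennreal (\<integral>x. f x / c \<partial>M)"
      using f(2,4) \<open>0 < c\<close> by (intro nn_integral_eq_integral) (auto intro!: AE_I2 divide_nonneg_pos less_imp_le)
    also have "(\<integral>x. f x / c \<partial>M) = 1" using \<open>0 < c\<close> by (simp add: c_def)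
    finally show "prob_space (density M (\<lambda>x. ennreal (f x / c)))"
      by (intro prob_spaceI) (simp add: emeasure_density)
  qed
qed

locale haar =
  fixes \<mu> :: "'g::{topological_group_add, t2_space, second_countable_topology} measure"
  assumes locally_compact: "locally_compact_space (euclidean :: 'g topology)"
    and haar_measure: "haar_measure \<mu>"
begin

lemma sets_haar: "sets \<mu> = sets borel"
  and haar_compact: "compact K \<Longrightarrow> emeasure \<mu> K < \<infinity>"
  and haar_open: "open U \<Longrightarrow> U \<noteq> {} \<Longrightarrow> emeasure \<mu> U > 0"
  and haar_image: "A \<in> sets borel \<Longrightarrow> emeasure \<mu> ((\<lambda>x. g + x) ` A) = emeasure \<mu> A"
  using haar_measure by (auto simp: haar_measure_def)

lemma space_haar [simp]: "space \<mu> = UNIV"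
  using sets_eq_imp_space_eq[OF sets_haar] by simp

lemma measurable_haar [simp]:
  "measurable \<mu> M = measurable borel M" "measurable M \<mu> = measurable M borel"
  by (rule measurable_cong_sets; simp add: sets_haar)+

sublocale sigma_finite_measure \<mu>
proof
  obtain C :: "nat \<Rightarrow> 'g set" where C: "\<And>i. compact (C i)" "(\<Union>i. C i) = UNIV"
    using lcsc_sigma_compact[OF locally_compact] by blast
  show "\<exists>A. countable A \<and> A \<subseteq> sets \<mu> \<and> \<Union>A = space \<mu> \<and> (\<forall>a\<in>A. emeasure \<mu> a \<noteq> \<infinity>)"
  proof (intro exI[of _ "range C"] conjI ballI)
    show "range C \<subseteq> sets \<mu>" using C(1) by (auto simp: sets_haar compact_imp_closed)
    show "emeasure \<mu> a \<noteq> \<infinity>" if "a \<in> range C" for a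
      using that haar_compact C(1) by (auto simp: less_top)
  qed (use C(2) in auto)
qed

lemma haar_vimage:
  assumes "A \<in> sets borel"
  shows "emeasure \<mu> ((\<lambda>x. g + x) -` A) = emeasure \<mu> A"
proof -
  have "(\<lambda>x. g + x) -` A = (\<lambda>x. - g + x) ` A"
  proof (intro equalityI subsetI)
    fix x assume "x \<in> (\<lambda>x. g + x) -` A"
    then show "x \<in> (\<lambda>x. - g + x) ` A" by (intro image_eqI[of _ _ "g + x"]) (auto simp: add.assoc[symmetric])
  qed (auto simp: add.assoc[symmetric])
  then show ?thesis using haar_image[OF assms, of "- g"] by simp
qed

lemma emeasure_density_translate_le:
  fixes w :: "'g \<Rightarrow> real"
  assumes [measurable]: "w \<in> borel_measurable borel" and w: "\<And>x. w x \<le> c"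
    and [measurable]: "K \<in> sets borel" "K' \<in> sets borel" "A \<in> sets borel"
    and K': "\<And>x. x \<in> K \<Longrightarrow> h + x \<in> K'"
  shows "emeasure (density \<mu> w) (K \<inter> (\<lambda>x. h + x) -` A) \<le> ennreal c * emeasure \<mu> (K' \<inter> A)"
proof -
  have [measurable]: "(\<lambda>x. h + x) -` B \<in> sets borel" if "B \<in> sets borel" for B
    using measurable_sets_borel[of "\<lambda>x. h + x" borel B] that by simp
  have "emeasure (density \<mu> w) (K \<inter> (\<lambda>x. h + x) -` A) =
      (\<integral>\<^sup>+x. ennreal (w x) * indicator (K \<inter> (\<lambda>x. h + x) -` A) x \<partial>\<mu>)"
    by (rule emeasure_density) (auto simp: sets_haar)
  also have "\<dots> \<le> (\<integral>\<^sup>+x. ennreal c * indicator ((\<lambda>x. h + x) -` (K' \<inter> A)) x \<partial>\<mu>)"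
    using w K' by (intro nn_integral_mono) (auto simp: indicator_def ennreal_leI)
  also have "\<dots> = ennreal c * emeasure \<mu> (K' \<inter> A)"
    using haar_vimage[of "K' \<inter> A" h]
    by (subst nn_integral_cmult_indicator) (auto simp: sets_haar simp del: vimage_Int)
  finally show ?thesis .
qed

lemma compact_translates:
  fixes g :: 'g
  assumes "compact K"
  obtains V K' where "open V" "g \<in> V" "compact K'" "\<And>h x. h \<in> V \<Longrightarrow> x \<in> K \<Longrightarrow> h + x \<in> K'"
proof -
  have "\<exists>V C. open V \<and> compact C \<and> g \<in> V \<and> V \<subseteq> C"
    using locally_compact by (simp add: locally_compact_space_def)
  then obtain V C where V: "open V" "compact C" "g \<in> V" "V \<subseteq> C" by (elim exE conjE)
  have "compact ((\<lambda>(a, b). a + b) ` (C \<times> K))"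
    using V(2) assms
    by (intro compact_continuous_image compact_Times) (auto simp: case_prod_unfold intro!: continuous_intros)
  with V show ?thesis by (intro that[of V "(\<lambda>(a, b). a + b) ` (C \<times> K)"]) auto
qed

lemma density_translate_small:
  fixes w :: "'g \<Rightarrow> real"
  assumes w_meas: "w \<in> borel_measurable borel" and w: "\<And>x. 0 < w x" "\<And>x. w x \<le> c"
    and L: "prob_space L" "L = density \<mu> w" and e: "0 < e"
  shows "\<exists>d>0. \<forall>\<^sub>F h in nhds g. \<forall>A\<in>sets borel. measure L A < d \<longrightarrow> measure L ((\<lambda>x. h + x) -` A) < e"
proof -
  interpret L: prob_space L by (rule L(1))
  have sets_L [simp]: "sets L = sets borel" by (simp add: L(2) sets_haar)
  have "0 < c" using w[of 0] by linarith
  obtain C :: "nat \<Rightarrow> 'g set" where C: "\<And>i. compact (C i)" "(\<Union>i. C i) = UNIV"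
    using lcsc_sigma_compact[OF locally_compact] by blast
  obtain K where K: "compact K" "measure L (- K) < e / 2"
    by (rule tight_if_sigma_compact[OF L.finite_measure_axioms sets_L C, of "e / 2"]) (use e in auto)
  obtain V K' where V: "open V" "g \<in> V" and "compact K'" and K': "\<And>h x. h \<in> V \<Longrightarrow> x \<in> K \<Longrightarrow> h + x \<in> K'"
    by (rule compact_translates[OF K(1), of g]) blast
  have borel: "K' \<in> sets borel" "K \<in> sets borel"
    using K(1) \<open>compact K'\<close> by (simp_all add: compact_imp_closed)
  obtain d where d: "0 < d"
    "\<And>A. A \<in> sets borel \<Longrightarrow> emeasure L A < ennreal d \<Longrightarrow> emeasure \<mu> (K' \<inter> A) < ennreal (e / 2 / c)"
    using absolutely_continuous_density[of w \<mu> K' "e / 2 / c"] w_meas w(1)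
      haar_compact[OF \<open>compact K'\<close>] borel e \<open>0 < c\<close>
    by (auto simp: sets_haar L(2))
  have "measure L ((\<lambda>x. h + x) -` A) < e"
    if h: "h \<in> V" and A: "A \<in> sets borel" and less: "measure L A < d" for h A
  proof -
    let ?hA = "(\<lambda>x. h + x) -` A"
    have hA: "?hA \<in> sets borel" using measurable_sets_borel[of "\<lambda>x. h + x" borel A] A by simp
    have "emeasure L (K \<inter> ?hA) \<le> ennreal c * emeasure \<mu> (K' \<inter> A)"
      unfolding L(2) using h by (intro emeasure_density_translate_le w_meas w borel A K')
    also have "\<dots> < ennreal c * ennreal (e / 2 / c)"
      using d(2)[of A] A less d(1) \<open>0 < c\<close>
      by (intro ennreal_mult_strict_left_mono) (simp_all add: L.emeasure_eq_measure ennreal_lessI)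
    also have "\<dots> = ennreal (e / 2)" using e \<open>0 < c\<close> by (subst ennreal_mult[symmetric]) auto
    finally have "measure L (K \<inter> ?hA) < e / 2"
      by (simp add: L.emeasure_eq_measure ennreal_less_iff)
    moreover have "measure L ?hA \<le> measure L (- K \<union> (K \<inter> ?hA))"
      using borel hA by (intro L.finite_measure_mono) auto
    moreover have "\<dots> \<le> measure L (- K) + measure L (K \<inter> ?hA)"
      using borel hA by (intro measure_Un_le) auto
    ultimately show ?thesis using K(2) by linarith
  qed
  then show ?thesis
    using d(1) V by (intro exI[of _ d]) (auto intro: eventually_nhds_in_open[THEN eventually_mono])
qed

lemma quasi_invariant_density:
  fixes w :: "'g \<Rightarrow> real"
  assumes w_meas [measurable]: "w \<in> borel_measurable borel" and w: "\<And>x. 0 < w x" "\<And>x. w x \<le> c"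
    and L: "prob_space (density \<mu> w)"
  shows "quasi_invariant (density \<mu> w)"
proof (intro quasi_invariant.intro quasi_invariant_axioms.intro L)
  show "sets (density \<mu> w) = sets borel" by (simp add: sets_haar)
  show "emeasure (density \<mu> w) U > 0" if U: "open U" "U \<noteq> {}" for U
  proof (rule ccontr)
    assume "\<not> ?thesis"
    then have "AE x in density \<mu> w. x \<notin> U"
      using U by (intro AE_not_in) (auto simp: null_sets_def sets_haar)
    then have "AE x in \<mu>. x \<notin> U" by (subst (asm) AE_density) (use w in auto)
    then have "emeasure \<mu> U = 0"
      using U by (subst (asm) AE_iff_null_sets[symmetric]) (auto simp: sets_haar)
    with haar_open[OF U] show False by simp
  qed
  have "Hausdorff_space (euclidean :: 'g topology)"
    unfolding Hausdorff_space_def using hausdorff[where 'a = 'g] by (simp add: disjnt_def)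
  then show "completely_regular_space (euclidean :: 'g topology)"
    using locally_compact_regular_imp_completely_regular_space[OF locally_compact] by blast
qed (rule density_translate_small[OF w_meas w L refl])

lemma equivalent_quasi_invariant:
  obtains w :: "'g \<Rightarrow> real" where "w \<in> borel_measurable borel" "\<And>x. 0 < w x" "quasi_invariant (density \<mu> w)"
proof -
  have "emeasure \<mu> (space \<mu>) \<noteq> 0" using haar_open[of UNIV] by simp
  then obtain w :: "'g \<Rightarrow> real" and c where w: "w \<in> borel_measurable \<mu>" "\<And>x. 0 < w x" "\<And>x. w x \<le> c"
    "prob_space (density \<mu> w)"
    by (rule equivalent_probability_density) blast
  show ?thesis
    by (rule that[OF _ w(2) quasi_invariant_density[OF _ w(2,3,4)]]) (use w(1) in simp_all)
qed

end

section \<open>Sequences in the group\<close>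

lemma tendsto_fun_iff:
  fixes X :: "'k \<Rightarrow> 'i \<Rightarrow> 'b::topological_space"
  shows "(X \<longlongrightarrow> x) F \<longleftrightarrow> (\<forall>i. ((\<lambda>k. X k i) \<longlongrightarrow> x i) F)"
proof -
  have "(X \<longlongrightarrow> x) F \<longleftrightarrow> limitin (product_topology (\<lambda>i. euclidean) UNIV) X x F"
    by (simp add: euclidean_product_topology)
  also have "\<dots> \<longleftrightarrow> (\<forall>i. ((\<lambda>k. X k i) \<longlongrightarrow> x i) F)"
    unfolding limitin_componentwise by simp
  finally show ?thesis .
qed

lemma borel_singleton_fun:
  fixes x :: "nat \<Rightarrow> 'b::{second_countable_topology, t1_space}"
  shows "{x} \<in> sets borel"
proof -
  have "{x} = (\<Inter>i. (\<lambda>y. y i) -` {x i})" by (auto simp: fun_eq_iff)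
  also have "\<dots> \<in> sets borel"
  proof (intro sets.countable_INT image_subsetI)
    show "(\<lambda>y. y i) -` {x i} \<in> sets borel" for i
      using measurable_sets_borel[of "\<lambda>y :: nat \<Rightarrow> 'b. y i" borel "{x i}"] by simp
  qed simp
  finally show ?thesis .
qed

definition translate :: "'g::group_add \<Rightarrow> (nat \<Rightarrow> 'g) \<Rightarrow> (nat \<Rightarrow> 'g)" where
  "translate g x = (\<lambda>i. g + x i)"

definition translate_upto :: "nat \<Rightarrow> 'g::group_add \<Rightarrow> (nat \<Rightarrow> 'g) \<Rightarrow> (nat \<Rightarrow> 'g)" where
  "translate_upto n g x = (\<lambda>i. if i < n then g + x i else x i)"

definition face :: "nat \<Rightarrow> (nat \<Rightarrow> 'g) \<Rightarrow> (nat \<Rightarrow> 'g)" where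
  "face i x = (\<lambda>j. if j < i then x j else x (Suc j))"

definition depends_upto :: "nat \<Rightarrow> ((nat \<Rightarrow> 'g) \<Rightarrow> 'b) \<Rightarrow> bool" where
  "depends_upto n F \<longleftrightarrow> (\<forall>x y. (\<forall>i<n. x i = y i) \<longrightarrow> F x = F y)"

lemma depends_uptoI: "(\<And>x y. (\<And>i. i < n \<Longrightarrow> x i = y i) \<Longrightarrow> F x = F y) \<Longrightarrow> depends_upto n F"
  unfolding depends_upto_def by blast

lemma depends_uptoD: "depends_upto n F \<Longrightarrow> (\<And>i. i < n \<Longrightarrow> x i = y i) \<Longrightarrow> F x = F y"
  by (auto simp: depends_upto_def)

lemma depends_upto_const: "depends_upto n (\<lambda>x. c)"
  by (simp add: depends_upto_def)

lemma depends_upto_compose: "depends_upto n F \<Longrightarrow> depends_upto n (\<lambda>x. f (F x))"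
  unfolding depends_upto_def by metis

lemma depends_upto_compose2:
  "depends_upto n F \<Longrightarrow> depends_upto n H \<Longrightarrow> depends_upto n (\<lambda>x. f (F x) (H x))"
  unfolding depends_upto_def by metis

lemma depends_upto_sum:
  "(\<And>i. i \<in> I \<Longrightarrow> depends_upto n (F i)) \<Longrightarrow> depends_upto n (\<lambda>x. \<Sum>i\<in>I. F i x)"
  unfolding depends_upto_def by (metis (no_types, lifting) sum.cong)

lemma depends_upto_lim:
  assumes "\<And>k. depends_upto n (F k)"
  shows "depends_upto n (\<lambda>x. lim (\<lambda>k. F k x))"
proof (rule depends_uptoI)
  fix x y :: "nat \<Rightarrow> 'a" assume eq: "\<And>i. i < n \<Longrightarrow> x i = y i"
  have "F k x = F k y" for k using eq by (rule depends_uptoD[OF assms])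
  then show "lim (\<lambda>k. F k x) = lim (\<lambda>k. F k y)" by simp
qed

lemma depends_upto_face: "depends_upto n F \<Longrightarrow> depends_upto (Suc n) (\<lambda>x. F (face i x))"
  by (auto simp: depends_upto_def face_def)

lemma depends_upto_comb_seq: "depends_upto n F \<Longrightarrow> depends_upto (n - m) (\<lambda>h. F (comb_seq m x h))"
  by (auto simp: depends_upto_def comb_seq_def)

lemma depends_upto_translate: "depends_upto n F \<Longrightarrow> F (translate g x) = F (translate_upto n g x)"
  by (rule depends_uptoD) (auto simp: translate_def translate_upto_def)

lemma translate_upto_0 [simp]: "translate_upto 0 g x = x"
  by (simp add: translate_upto_def)

lemma translate_upto_Suc: "translate_upto (Suc n) g x = translate_upto n g (x(n := g + x n))"
  by (auto simp: translate_upto_def fun_eq_iff less_Suc_eq)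

lemma translate_0 [simp]: "translate 0 x = x"
  by (simp add: translate_def)

lemma translate_translate: "translate g (translate h x) = translate (g + h) x"
  by (simp add: translate_def add.assoc)

lemma translate_face: "translate g (face i x) = face i (translate g x)"
  by (auto simp: translate_def face_def)

lemma translate_comb_seq: "translate g (comb_seq m x h) = comb_seq m (translate g x) (translate g h)"
  by (auto simp: translate_def comb_seq_def)

lemma face_face: "l \<le> i \<Longrightarrow> face l (face (Suc i) x) = face i (face l x)"
  by (auto simp: face_def fun_eq_iff)

lemma face_comb_seq_head: "i \<le> m \<Longrightarrow> face i (comb_seq (Suc m) g h) = comb_seq m (face i g) h"
  by (auto simp: face_def comb_seq_def fun_eq_iff)

lemma face_comb_seq_tail: "face (m + i) (comb_seq m g h) = comb_seq m g (face i h)"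
  by (auto simp: face_def comb_seq_def fun_eq_iff Suc_diff_le)

lemma tendsto_face: "(X \<longlongrightarrow> x) F \<Longrightarrow> ((\<lambda>k. face i (X k)) \<longlongrightarrow> face i x) F"
  by (simp add: tendsto_fun_iff face_def)

lemma measurable_fun_upd [measurable (raw)]:
  fixes f :: "'x \<Rightarrow> nat \<Rightarrow> 'b::second_countable_topology"
  assumes "f \<in> borel_measurable M" "h \<in> borel_measurable M"
  shows "(\<lambda>x. (f x)(i := h x)) \<in> borel_measurable M"
proof (rule measurable_coordinatewise_then_product)
  show "(\<lambda>x. ((f x)(i := h x)) j) \<in> borel_measurable M" for j
    using assms(2) measurable_product_then_coordinatewise[OF assms(1), of j] by (cases "j = i") simp_all
qed

lemma measurable_translate [measurable (raw)]:
  fixes f :: "'x \<Rightarrow> nat \<Rightarrow> 'b::{second_countable_topology, topological_group_add}"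
  assumes "f \<in> borel_measurable M" "h \<in> borel_measurable M"
  shows "(\<lambda>x. translate (h x) (f x)) \<in> borel_measurable M"
proof (rule measurable_coordinatewise_then_product)
  show "(\<lambda>x. translate (h x) (f x) j) \<in> borel_measurable M" for j
    using assms(2) measurable_product_then_coordinatewise[OF assms(1), of j] by (simp add: translate_def)
qed

lemma measurable_face [measurable (raw)]:
  fixes f :: "'x \<Rightarrow> nat \<Rightarrow> 'b::second_countable_topology"
  assumes "f \<in> borel_measurable M"
  shows "(\<lambda>x. face i (f x)) \<in> borel_measurable M"
proof (rule measurable_coordinatewise_then_product)
  show "(\<lambda>x. face i (f x) j) \<in> borel_measurable M" for j
    using measurable_product_then_coordinatewise[OF assms] by (simp add: face_def)
qed

lemma measurable_comb_seq_borel [measurable (raw)]: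
  fixes f :: "'x \<Rightarrow> nat \<Rightarrow> 'b::second_countable_topology"
  assumes "f \<in> borel_measurable M" "h \<in> borel_measurable M"
  shows "(\<lambda>x. comb_seq i (f x) (h x)) \<in> borel_measurable M"
proof (rule measurable_coordinatewise_then_product)
  show "(\<lambda>x. comb_seq i (f x) (h x) j) \<in> borel_measurable M" for j
    using assms[THEN measurable_product_then_coordinatewise] by (simp add: comb_seq_def)
qed

context quasi_invariant
begin

sublocale seq: sequence_space L ..

abbreviation P :: "(nat \<Rightarrow> 'g) measure" where "P \<equiv> PiM UNIV (\<lambda>_. L)"

lemma sets_P: "sets P = sets borel"
proof -
  have "sets P = sets (PiM UNIV (\<lambda>_::nat. borel :: 'g measure))"
    by (rule sets_PiM_cong) (simp_all add: sets_L)
  then show ?thesis by (simp add: sets_PiM_equal_borel)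
qed

lemma space_P [simp]: "space P = UNIV"
  using sets_eq_imp_space_eq[OF sets_P] by simp

lemma measurable_P [simp]: "measurable P M = measurable borel M" "measurable M P = measurable M borel"
  by (rule measurable_cong_sets; simp add: sets_P)+

lemma measurable_pair_L [simp]:
  "measurable (L \<Otimes>\<^sub>M P) M = measurable (borel \<Otimes>\<^sub>M borel) M"
  "measurable (P \<Otimes>\<^sub>M P) M = measurable (borel \<Otimes>\<^sub>M borel) M"
  "measurable (P \<Otimes>\<^sub>M L) M = measurable (borel \<Otimes>\<^sub>M borel) M"
  by (rule measurable_cong_sets; simp add: sets_P sets_L cong: sets_pair_measure_cong)+

sublocale LP: pair_prob_space L P ..

sublocale PP: pair_prob_space P P ..

lemma tendsto_in_measure_P_borelD:
  assumes "tendsto_in_measure P U u"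
  shows "U k \<in> borel_measurable borel" "u \<in> borel_measurable borel"
  using tendsto_in_measureD(1,2)[OF assms] by simp_all

lemma distr_fun_upd: "distr (L \<Otimes>\<^sub>M P) P (\<lambda>(t, x). x(i := t)) = P"
proof (rule seq.PiM_eq)
  let ?f = "\<lambda>(t, x). (x :: nat \<Rightarrow> 'g)(i := t)"
  have [measurable]: "?f \<in> measurable (L \<Otimes>\<^sub>M P) P"
    by simp
  fix J and E :: "nat \<Rightarrow> 'g set"
  assume J: "finite J" "J \<subseteq> UNIV" "\<And>j. j \<in> J \<Longrightarrow> E j \<in> sets L"
  let ?X = "prod_emb UNIV (\<lambda>_. L) J (\<Pi>\<^sub>E j\<in>J. E j)"
  let ?E = "if i \<in> J then E i else UNIV" and ?F = "prod_emb UNIV (\<lambda>_. L) (J - {i}) (\<Pi>\<^sub>E j\<in>J - {i}. E j)"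
  have F: "?F \<in> sets P" by (rule sets_PiM_I) (use J in auto)
  have X: "?X \<in> sets P" by (rule sets_PiM_I) (use J in auto)
  have E: "?E \<in> sets L" using J by (auto simp: sets_L)
  have "?f -` ?X \<inter> space (L \<Otimes>\<^sub>M P) = ?E \<times> ?F"
    by (auto simp: space_pair_measure prod_emb_def PiE_iff split: if_splits)
  then have "emeasure (distr (L \<Otimes>\<^sub>M P) P ?f) ?X = emeasure (L \<Otimes>\<^sub>M P) (?E \<times> ?F)"
    by (subst emeasure_distr) (use X in auto)
  also have "\<dots> = emeasure L ?E * emeasure P ?F"
    using E F by (rule seq.P.emeasure_pair_measure_Times)
  also have "emeasure P ?F = (\<Prod>j\<in>J - {i}. emeasure L (E j))"
    using J by (intro seq.emeasure_PiM_emb) auto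
  also have "emeasure L ?E * \<dots> = (\<Prod>j\<in>J. emeasure L (E j))"
    using J(1) emeasure_space_1 by (cases "i \<in> J") (auto simp: prod.remove)
  finally show "emeasure (distr (L \<Otimes>\<^sub>M P) P ?f) ?X = (\<Prod>j\<in>J. emeasure L (E j))" .
qed simp

lemma AE_fun_upd:
  assumes "AE x in P. Q x"
  shows "AE t in L. AE x in P. Q (x(i := t))"
proof -
  have "AE x in distr (L \<Otimes>\<^sub>M P) P (\<lambda>(t, x). x(i := t)). Q x"
    using assms by (simp only: distr_fun_upd)
  then have "AE z in L \<Otimes>\<^sub>M P. Q (case z of (t, x) \<Rightarrow> x(i := t))"
    by (rule AE_distrD[rotated]) simp
  from LP.AE_pair[OF this] show ?thesis by simp
qed

lemma integrable_bounded_P: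
  fixes \<phi> :: "(nat \<Rightarrow> 'g) \<Rightarrow> real"
  assumes "\<phi> \<in> borel_measurable borel" "\<And>x. \<bar>\<phi> x\<bar> \<le> B"
  shows "integrable P \<phi>"
  by (rule seq.P.integrable_const_bound[of _ B]) (use assms in auto)

lemma integral_fun_upd:
  fixes \<phi> :: "(nat \<Rightarrow> 'g) \<Rightarrow> real"
  assumes [measurable]: "\<phi> \<in> borel_measurable borel" and "\<And>x. \<bar>\<phi> x\<bar> \<le> B"
  shows "(\<integral>x. \<phi> x \<partial>P) = (\<integral>t. \<integral>x. \<phi> (x(i := t)) \<partial>P \<partial>L)"
    and "(\<integral>x. \<phi> x \<partial>P) = (\<integral>x. \<integral>t. \<phi> (x(i := t)) \<partial>L \<partial>P)"
proof -
  have integrable: "integrable (L \<Otimes>\<^sub>M P) (\<lambda>(t, x). \<phi> (x(i := t)))"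
    by (rule LP.P.integrable_const_bound[of _ B]) (use assms in auto)
  have "(\<integral>x. \<phi> x \<partial>P) = (\<integral>x. \<phi> x \<partial>distr (L \<Otimes>\<^sub>M P) P (\<lambda>(t, x). x(i := t)))"
    by (simp only: distr_fun_upd)
  also have "\<dots> = (\<integral>z. (case z of (t, x) \<Rightarrow> \<phi> (x(i := t))) \<partial>(L \<Otimes>\<^sub>M P))"
    by (subst integral_distr) (auto simp: case_prod_unfold)
  finally have pair: "(\<integral>x. \<phi> x \<partial>P) = (\<integral>z. (case z of (t, x) \<Rightarrow> \<phi> (x(i := t))) \<partial>(L \<Otimes>\<^sub>M P))" .
  show "(\<integral>x. \<phi> x \<partial>P) = (\<integral>t. \<integral>x. \<phi> (x(i := t)) \<partial>P \<partial>L)"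
    unfolding pair using LP.integral_fst'[OF integrable] by simp
  show "(\<integral>x. \<phi> x \<partial>P) = (\<integral>x. \<integral>t. \<phi> (x(i := t)) \<partial>L \<partial>P)"
    unfolding pair using LP.integral_snd[OF integrable] by simp
qed

lemma integral_translate_coord_tendsto_0:
  fixes \<phi> :: "nat \<Rightarrow> (nat \<Rightarrow> 'g) \<Rightarrow> real"
  assumes \<gamma>: "\<gamma> \<longlonglongrightarrow> g" and [measurable]: "\<And>k. \<phi> k \<in> borel_measurable borel"
    and bound: "\<And>k x. 0 \<le> \<phi> k x \<and> \<phi> k x \<le> 1" and lim: "(\<lambda>k. \<integral>x. \<phi> k x \<partial>P) \<longlonglongrightarrow> 0"
  shows "(\<lambda>k. \<integral>x. \<phi> k (x(i := \<gamma> k + x i)) \<partial>P) \<longlonglongrightarrow> 0"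
proof -
  define \<psi> where "\<psi> k t = (\<integral>x. \<phi> k (x(i := t)) \<partial>P)" for k t
  have abs: "\<bar>\<phi> k x\<bar> \<le> 1" for k x using bound[of k x] by auto
  have [measurable]: "\<psi> k \<in> borel_measurable borel" for k
  proof -
    have "(\<lambda>t. \<integral>x. \<phi> k (x(i := t)) \<partial>P) \<in> borel_measurable borel"
      by (rule seq.P.borel_measurable_lebesgue_integral)
         (simp add: measurable_cong_sets[OF sets_pair_measure_cong[OF refl sets_P] refl])
    then show ?thesis by (simp add: \<psi>_def[abs_def])
  qed
  have \<psi>_bound: "0 \<le> \<psi> k t \<and> \<psi> k t \<le> 1" for k t
  proof -
    have "\<psi> k t \<le> (\<integral>x. 1 \<partial>P)"
      unfolding \<psi>_def by (rule integral_mono) (use bound abs in \<open>auto intro!: integrable_bounded_P[of _ 1]\<close>)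
    moreover have "0 \<le> \<psi> k t" unfolding \<psi>_def by (rule integral_nonneg_AE) (use bound in auto)
    ultimately show ?thesis using seq.P.prob_space by simp
  qed
  have "(\<integral>x. \<phi> k x \<partial>P) = (\<integral>t. \<psi> k t \<partial>L)" for k
    unfolding \<psi>_def by (rule integral_fun_upd(1)[of _ 1]) (use abs in auto)
  then have "(\<lambda>k. \<integral>t. \<psi> k t \<partial>L) \<longlonglongrightarrow> 0" using lim by simp
  from integral_translate_tendsto_0[OF \<gamma> _ \<psi>_bound this] have "(\<lambda>k. \<integral>t. \<psi> k (\<gamma> k + t) \<partial>L) \<longlonglongrightarrow> 0" by simp
  moreover have "(\<integral>x. \<phi> k (x(i := \<gamma> k + x i)) \<partial>P) = (\<integral>t. \<psi> k (\<gamma> k + t) \<partial>L)" for k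
    unfolding \<psi>_def by (subst integral_fun_upd(1)[of _ 1 i]) (use abs in auto)
  ultimately show ?thesis by simp
qed

lemma continuous_coord_translation:
  fixes u :: "(nat \<Rightarrow> 'g) \<Rightarrow> 'b::{metric_space, second_countable_topology}"
  assumes [measurable]: "u \<in> borel_measurable borel"
  shows "continuous_in_measure P (\<lambda>g x. u (x(i := g + x i))) g"
  unfolding continuous_in_measure_def
proof (intro allI impI)
  fix \<gamma> assume \<gamma>: "\<gamma> \<longlonglongrightarrow> g"
  let ?d = "\<lambda>k x. meas_dist L (\<lambda>t. u (x(i := \<gamma> k + t))) (\<lambda>t. u (x(i := g + t)))"
  have "(\<lambda>k. \<integral>x. ?d k x \<partial>P) \<longlonglongrightarrow> (\<integral>x. 0 \<partial>P)"
  proof (rule integral_dominated_convergence[where w = "\<lambda>_. 1"])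
    show "AE x in P. (\<lambda>k. ?d k x) \<longlonglongrightarrow> 0"
      using tendsto_in_measureD(3)[OF continuous_in_measureD[OF continuous_translation[of "\<lambda>t. u (_(i := t))"] \<gamma>]]
      by (intro AE_I2) simp
    show "?d k \<in> borel_measurable P" for k
      unfolding meas_dist_def by (rule borel_measurable_lebesgue_integral) simp
  qed (auto simp: meas_dist_le_1)
  moreover have "meas_dist P (\<lambda>x. u (x(i := \<gamma> k + x i))) (\<lambda>x. u (x(i := g + x i))) = (\<integral>x. ?d k x \<partial>P)" for k
    unfolding meas_dist_def by (subst integral_fun_upd(2)[of _ 1 i]) auto
  ultimately show "tendsto_in_measure P (\<lambda>k x. u (x(i := \<gamma> k + x i))) (\<lambda>x. u (x(i := g + x i)))"
    by (simp add: tendsto_in_measure_def)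
qed

lemma tendsto_in_measure_translate_coord:
  fixes u :: "(nat \<Rightarrow> 'g) \<Rightarrow> 'b::{metric_space, second_countable_topology}"
  assumes U: "tendsto_in_measure P U u" and \<gamma>: "\<gamma> \<longlonglongrightarrow> g"
  shows "tendsto_in_measure P (\<lambda>k x. U k (x(i := \<gamma> k + x i))) (\<lambda>x. u (x(i := g + x i)))"
proof -
  note [measurable] = tendsto_in_measure_P_borelD[OF U]
  have moving: "(\<lambda>k. meas_dist P (\<lambda>x. U k (x(i := \<gamma> k + x i))) (\<lambda>x. u (x(i := \<gamma> k + x i)))) \<longlonglongrightarrow> 0"
    using integral_translate_coord_tendsto_0[OF \<gamma>, of "\<lambda>k x. min 1 (dist (U k x) (u x))" i]
      tendsto_in_measureD(3)[OF U]
    by (simp add: meas_dist_def)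
  have fixed: "(\<lambda>k. meas_dist P (\<lambda>x. u (x(i := \<gamma> k + x i))) (\<lambda>x. u (x(i := g + x i)))) \<longlonglongrightarrow> 0"
    using tendsto_in_measureD(3)[OF continuous_in_measureD[OF continuous_coord_translation[of u] \<gamma>]] by simp
  show ?thesis
    by (rule tendsto_in_measureI_le[OF _ _ seq.P.meas_dist_triangle tendsto_add_zero[OF moving fixed]]) auto
qed

lemma tendsto_in_measure_translate_upto:
  fixes u :: "(nat \<Rightarrow> 'g) \<Rightarrow> 'b::{metric_space, second_countable_topology}"
  assumes "tendsto_in_measure P U u" and \<gamma>: "\<gamma> \<longlonglongrightarrow> g"
  shows "tendsto_in_measure P (\<lambda>k x. U k (translate_upto n (\<gamma> k) x)) (\<lambda>x. u (translate_upto n g x))"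
proof (induction n)
  case (Suc n)
  show ?case unfolding translate_upto_Suc by (rule tendsto_in_measure_translate_coord[OF Suc \<gamma>])
qed (simp add: assms)

lemma AE_translate_coord:
  assumes "AE x in P. Q x"
  shows "AE x in P. Q (x(i := g + x i))"
proof -
  from assms obtain N where N: "N \<in> null_sets P" "{x. \<not> Q x} \<subseteq> N"
    by (auto simp: eventually_ae_filter)
  have [measurable]: "N \<in> sets borel" using N(1) by (auto simp: sets_P null_sets_def)
  have "(\<lambda>k::nat. \<integral>x. indicator N (x(i := g + x i)) \<partial>P) \<longlonglongrightarrow> (0::real)"
  proof (rule integral_translate_coord_tendsto_0[where \<gamma> = "\<lambda>_. g" and \<phi> = "\<lambda>_. indicator N"])
    have "(\<integral>x. indicator N x \<partial>P) = (0::real)"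
      using N(1) by (simp add: measure_def null_sets_def)
    then show "(\<lambda>k::nat. \<integral>x. indicator N x \<partial>P) \<longlonglongrightarrow> (0::real)" by simp
  qed auto
  then have "(\<integral>x. indicator N (x(i := g + x i)) \<partial>P) = (0::real)"
    by (simp add: LIMSEQ_const_iff)
  then have "AE x in P. indicator N (x(i := g + x i)) = (0::real)"
    by (subst (asm) integral_nonneg_eq_0_iff_AE) (auto intro!: integrable_bounded_P[of _ 1])
  then show ?thesis
    by eventually_elim (use N(2) in \<open>auto simp: indicator_def split: if_splits\<close>)
qed

lemma AE_translate_upto:
  assumes "AE x in P. Q x"
  shows "AE x in P. Q (translate_upto n g x)"
proof (induction n)
  case (Suc n)
  show ?case unfolding translate_upto_Suc by (rule AE_translate_coord[OF Suc])
qed (simp add: assms)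

lemma distr_face: "distr P P (face i) = P"
proof -
  let ?f = "\<lambda>j. if j < i then j else Suc j"
  have "inj ?f" by (auto simp: inj_def split: if_splits)
  moreover have "face i = (\<lambda>\<omega>::nat \<Rightarrow> 'g. \<lambda>n\<in>UNIV. \<omega> (?f n))"
    by (auto simp: face_def fun_eq_iff)
  ultimately show ?thesis
    using distr_PiM_reindex[of UNIV "\<lambda>_. L" ?f UNIV] prob_space_axioms by simp
qed

lemma AE_face:
  assumes "AE x in P. Q x"
  shows "AE x in P. Q (face i x)"
proof -
  have "AE x in distr P P (face i). Q x" using assms by (simp only: distr_face)
  then show ?thesis by (rule AE_distrD[rotated]) simp
qed

lemma tendsto_in_measure_face:
  fixes u :: "(nat \<Rightarrow> 'g) \<Rightarrow> 'b::{metric_space, second_countable_topology}"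
  assumes U: "tendsto_in_measure P U u"
  shows "tendsto_in_measure P (\<lambda>k x. U k (face i x)) (\<lambda>x. u (face i x))"
proof -
  note [measurable] = tendsto_in_measure_P_borelD[OF U]
  have "meas_dist P (\<lambda>x. U k (face i x)) (\<lambda>x. u (face i x)) = meas_dist P (U k) u" for k
  proof -
    have "meas_dist P (U k) u = (\<integral>x. min 1 (dist (U k x) (u x)) \<partial>distr P P (face i))"
      unfolding meas_dist_def by (simp only: distr_face)
    also have "\<dots> = meas_dist P (\<lambda>x. U k (face i x)) (\<lambda>x. u (face i x))"
      unfolding meas_dist_def by (rule integral_distr) auto
    finally show ?thesis by simp
  qed
  then show ?thesis using U by (simp add: tendsto_in_measure_def)
qed

lemma AE_comb_seqD:
  assumes "AE x in P. Q x"
  shows "AE g in P. AE h in P. Q (comb_seq m g h)"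
proof -
  have "AE x in distr (P \<Otimes>\<^sub>M P) P (\<lambda>(g, h). comb_seq m g h). Q x"
    using assms by (simp only: seq.PiM_comb_seq)
  then have "AE z in P \<Otimes>\<^sub>M P. Q (case z of (g, h) \<Rightarrow> comb_seq m g h)"
    by (rule AE_distrD[rotated]) simp
  from PP.AE_pair[OF this] show ?thesis by simp
qed

lemma AE_comb_seqI:
  assumes Q: "Measurable.pred borel Q" and "AE g in P. AE h in P. Q (comb_seq m g h)"
  shows "AE x in P. Q x"
proof -
  note [measurable] = Q
  have "AE z in P \<Otimes>\<^sub>M P. Q (case z of (g, h) \<Rightarrow> comb_seq m g h)"
  proof (rule PP.AE_pair_measure)
    have "Measurable.pred (P \<Otimes>\<^sub>M P) (\<lambda>z. Q (case z of (g, h) \<Rightarrow> comb_seq m g h))" by simp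
    then show "{z \<in> space (P \<Otimes>\<^sub>M P). Q (case z of (g, h) \<Rightarrow> comb_seq m g h)} \<in> sets (P \<Otimes>\<^sub>M P)"
      by (rule predE)
  qed (use assms in simp)
  then have "AE x in distr (P \<Otimes>\<^sub>M P) P (\<lambda>(g, h). comb_seq m g h). Q x"
    by (subst AE_distr_iff) (use Q in \<open>auto simp: sets_P pred_def\<close>)
  then show ?thesis by (simp only: seq.PiM_comb_seq)
qed

lemma open_pos_P:
  assumes "open U" "x \<in> U"
  shows "emeasure P U > 0"
proof -
  have "openin (product_topology (\<lambda>i::nat. euclidean :: 'g topology) UNIV) U"
    using assms by (simp add: euclidean_product_topology)
  from product_topology_open_contains_basis[OF this assms(2)] obtain X where
    X: "x \<in> Pi\<^sub>E UNIV X" "\<And>i. open (X i)" "finite {i. X i \<noteq> UNIV}" "Pi\<^sub>E UNIV X \<subseteq> U" by auto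
  let ?J = "{i. X i \<noteq> UNIV}"
  have "Pi\<^sub>E UNIV X = prod_emb UNIV (\<lambda>_. L) ?J (Pi\<^sub>E ?J X)"
    by (auto simp: prod_emb_def PiE_iff) (metis UNIV_I)
  then have "emeasure P (Pi\<^sub>E UNIV X) = (\<Prod>i\<in>?J. emeasure L (X i))"
    using seq.emeasure_PiM_emb[of ?J X] X by (simp add: sets_L)
  moreover have "emeasure L (X i) \<noteq> 0" for i
    using open_pos[OF X(2), of i] X(1) by (force simp: PiE_iff)
  ultimately have "0 < emeasure P (Pi\<^sub>E UNIV X)"
    using X(3) by (simp add: zero_less_iff_neq_zero prod_zero_iff)
  also have "\<dots> \<le> emeasure P U" by (rule emeasure_mono) (use X assms in \<open>auto simp: sets_P\<close>)
  finally show ?thesis .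
qed

lemma AE_P_dense:
  assumes "AE x in P. Q x" "open U" "x \<in> U"
  shows "\<exists>y\<in>U. Q y"
proof (rule ccontr)
  assume "\<not> ?thesis"
  then have "Q y \<longrightarrow> y \<notin> U" for y by blast
  with assms(1) have "AE y in P. y \<notin> U" by (rule AE_mp[OF _ AE_I2])
  then have "emeasure P U = 0"
    using assms by (subst (asm) AE_iff_null_sets[symmetric]) (auto simp: sets_P)
  with open_pos_P[OF assms(2,3)] show False by simp
qed

lemma AE_P_approximating_sequence:
  assumes "AE x in P. Q x"
  obtains X where "X \<longlonglongrightarrow> x" "\<And>k::nat. Q (X k)"
proof -
  obtain A :: "nat \<Rightarrow> (nat \<Rightarrow> 'g) set" where A: "\<And>i. open (A i)" "\<And>i. x \<in> A i"
    "\<And>S. open S \<Longrightarrow> x \<in> S \<Longrightarrow> \<forall>\<^sub>F i in sequentially. A i \<subseteq> S"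
    by (rule countable_basis_at_decseq) blast
  have "\<exists>y. y \<in> A k \<and> Q y" for k using AE_P_dense[OF assms A(1,2)] by blast
  then obtain X where X: "\<And>k. X k \<in> A k" "\<And>k. Q (X k)" by metis
  have "X \<longlonglongrightarrow> x"
  proof (rule topological_tendstoI)
    fix S assume "open S" "x \<in> S"
    from A(3)[OF this] show "\<forall>\<^sub>F k in sequentially. X k \<in> S"
      by eventually_elim (use X(1) in auto)
  qed
  then show ?thesis using X(2) by (rule that)
qed

lemma completely_regular_sequences: "completely_regular_space (euclidean :: (nat \<Rightarrow> 'g) topology)"
  unfolding euclidean_product_topology[symmetric] completely_regular_space_product_topology
  using completely_regular by simp

end

section \<open>Almost continuous selections\<close>

lemma (in finite_measure) null_level_set:
  fixes f :: "'a \<Rightarrow> real"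
  assumes [measurable]: "f \<in> borel_measurable M" and "a < b"
  obtains t where "a < t" "t < b" "f -` {t} \<inter> space M \<in> null_sets M"
proof -
  interpret D: finite_measure "distr M borel f" by (rule finite_measure_distr) simp
  have "uncountable {a<..<b}" using \<open>a < b\<close> by (simp add: uncountable_open_interval)
  moreover have "countable {t. measure (distr M borel f) {t} \<noteq> 0}" by (rule D.countable_support)
  ultimately have "\<not> {a<..<b} \<subseteq> {t. measure (distr M borel f) {t} \<noteq> 0}"
    using countable_subset by blast
  then obtain t where t: "a < t" "t < b" "measure (distr M borel f) {t} = 0" by auto
  from t(3) have "f -` {t} \<inter> space M \<in> null_sets M"
    using D.emeasure_eq_measure[of "{t}"] by (simp add: null_sets_def emeasure_distr)
  with t(1,2) show ?thesis by (rule that)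
qed

lemma null_frontier_nhd:
  fixes \<nu> :: "'x::topological_space measure"
  assumes \<nu>: "finite_measure \<nu>" "sets \<nu> = sets borel"
    and regular: "completely_regular_space (euclidean :: 'x topology)"
    and U: "open U" "x \<in> U"
  obtains V where "open V" "x \<in> V" "V \<subseteq> U" "frontier V \<in> null_sets \<nu>"
proof -
  interpret finite_measure \<nu> by (rule \<nu>(1))
  have space: "space \<nu> = UNIV" using sets_eq_imp_space_eq[OF \<nu>(2)] by simp
  have "closedin euclidean (- U)" "x \<in> topspace euclidean - (- U)" using U by auto
  then obtain f :: "'x \<Rightarrow> real" where
    f: "continuous_map euclidean (top_of_set {0..1}) f" "f x = 0" "f ` (- U) \<subseteq> {1}"
    using regular unfolding completely_regular_space_def by metis
  have cont: "continuous_on UNIV f"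
    using f(1) by (simp add: continuous_map_in_subtopology)
  then have f_meas [measurable]: "f \<in> borel_measurable \<nu>"
    by (simp add: borel_measurable_continuous_onI measurable_cong_sets[OF \<nu>(2) refl])
  obtain t where t: "0 < t" "t < 1" "f -` {t} \<inter> space \<nu> \<in> null_sets \<nu>"
    using null_level_set[OF f_meas zero_less_one] .
  define V where "V = f -` {..<t}"
  have "open V" unfolding V_def using cont by (simp add: open_vimage)
  have "closed (f -` {..t})" using cont by (simp add: closed_vimage)
  then have "closure V \<subseteq> f -` {..t}" by (intro closure_minimal) (auto simp: V_def)
  then have "frontier V \<subseteq> f -` {t}"
    unfolding frontier_def interior_open[OF \<open>open V\<close>] by (auto simp: V_def)
  moreover have "f -` {t} \<in> null_sets \<nu>" using t(3) by (simp add: space)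
  ultimately have "frontier V \<in> null_sets \<nu>"
    by (rule null_sets_subset[rotated -1]) (simp add: \<nu>(2))
  then show ?thesis using \<open>open V\<close> f(2,3) t by (intro that[of V]) (auto simp: V_def)
qed

lemma disjoint_open_refinement:
  fixes W :: "'i \<Rightarrow> 'x::topological_space set"
  assumes D: "countable D" and W: "\<And>d. d \<in> D \<Longrightarrow> open (W d)"
  obtains U where "disjoint_family_on U D" "\<And>d. d \<in> D \<Longrightarrow> open (U d)" "\<And>d. U d \<subseteq> W d"
    "(\<Union>d\<in>D. W d) - (\<Union>d\<in>D. frontier (W d)) \<subseteq> (\<Union>d\<in>D. U d)"
proof -
  let ?i = "to_nat_on D"
  define U where "U d = W d - (\<Union>c\<in>{c\<in>D. ?i c < ?i d}. closure (W c))" for d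
  show ?thesis
  proof (rule that)
    show "disjoint_family_on U D"
    proof (unfold disjoint_family_on_def, intro ballI impI)
      fix c d assume cd: "c \<in> D" "d \<in> D" "c \<noteq> d"
      then have "?i c < ?i d \<or> ?i d < ?i c"
        using inj_on_to_nat_on[OF D] unfolding inj_on_def by (metis linorder_neqE_nat)
      then show "U c \<inter> U d = {}"
        using cd(1,2) closure_subset[of "W c"] closure_subset[of "W d"] by (auto simp: U_def)
    qed
    show "open (U d)" if "d \<in> D" for d
    proof -
      have "finite {c \<in> D. ?i c < ?i d}"
        by (rule finite_imageD[of ?i, OF finite_subset[of _ "{..<?i d}"]])
           (auto intro: inj_on_subset[OF inj_on_to_nat_on[OF D]])
      then show ?thesis unfolding U_def using W that by (intro open_Diff closed_UN) auto
    qed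
    show "U d \<subseteq> W d" for d by (auto simp: U_def)
    show "(\<Union>d\<in>D. W d) - (\<Union>d\<in>D. frontier (W d)) \<subseteq> (\<Union>d\<in>D. U d)"
    proof
      fix x assume x: "x \<in> (\<Union>d\<in>D. W d) - (\<Union>d\<in>D. frontier (W d))"
      then obtain c where "c \<in> D" "x \<in> W c" by blast
      then obtain d where d: "d \<in> D" "x \<in> W d" "\<And>c. c \<in> D \<Longrightarrow> x \<in> W c \<Longrightarrow> ?i d \<le> ?i c"
        using ex_has_least_nat[of "\<lambda>d. d \<in> D \<and> x \<in> W d" c ?i] by blast
      then have "x \<notin> closure (W c)" if "c \<in> D" "?i c < ?i d" for c
        using that x closure_Un_frontier[of "W c"] by fastforce
      with d show "x \<in> (\<Union>d\<in>D. U d)" by (auto simp: U_def)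
    qed
  qed
qed

lemma null_frontier_partition:
  fixes \<nu> :: "'x::second_countable_topology measure"
  assumes \<nu>: "finite_measure \<nu>" "sets \<nu> = sets borel"
    and regular: "completely_regular_space (euclidean :: 'x topology)"
    and V: "\<And>x. x \<in> A \<Longrightarrow> open (V x)" "\<And>x. x \<in> A \<Longrightarrow> x \<in> V x"
  obtains D U where "countable D" "D \<subseteq> A" "disjoint_family_on U D"
    "\<And>d. d \<in> D \<Longrightarrow> open (U d)" "\<And>d. d \<in> D \<Longrightarrow> U d \<subseteq> V d"
    "AE x in \<nu>. x \<in> A \<longrightarrow> x \<in> (\<Union>d\<in>D. U d)"
proof -
  have "\<exists>W. open W \<and> x \<in> W \<and> W \<subseteq> V x \<and> frontier W \<in> null_sets \<nu>" if "x \<in> A" for x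
    using null_frontier_nhd[OF \<nu> regular V[OF that]] by metis
  then obtain W where W: "\<And>x. x \<in> A \<Longrightarrow> open (W x)" "\<And>x. x \<in> A \<Longrightarrow> x \<in> W x"
    "\<And>x. x \<in> A \<Longrightarrow> W x \<subseteq> V x" "\<And>x. x \<in> A \<Longrightarrow> frontier (W x) \<in> null_sets \<nu>"
    by metis
  obtain F where F: "F \<subseteq> W ` A" "countable F" "\<Union>F = \<Union>(W ` A)"
    using Lindelof[of "W ` A"] W(1) by blast
  obtain D where D: "countable D" "D \<subseteq> A" "F = W ` D"
    using countable_subset_image F(1,2) by metis
  obtain U where U: "disjoint_family_on U D" "\<And>d. d \<in> D \<Longrightarrow> open (U d)" "\<And>d. U d \<subseteq> W d"
    "(\<Union>d\<in>D. W d) - (\<Union>d\<in>D. frontier (W d)) \<subseteq> (\<Union>d\<in>D. U d)"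
    by (rule disjoint_open_refinement[of D W]) (use D(1,2) W(1) in blast)+
  show ?thesis
  proof (rule that[OF D(1,2) U(1,2)])
    show "U d \<subseteq> V d" if "d \<in> D" for d using U(3)[of d] W(3) D(2) that by blast
    have "A \<subseteq> \<Union>(W ` A)" using W(2) by blast
    then have cover: "A \<subseteq> (\<Union>d\<in>D. W d)" using F(3) D(3) by simp
    have "AE x in \<nu>. \<forall>d\<in>D. x \<notin> frontier (W d)"
      using W(4) D(2) by (subst AE_ball_countable[OF D(1)]) (auto intro: AE_not_in)
    then show "AE x in \<nu>. x \<in> A \<longrightarrow> x \<in> (\<Union>d\<in>D. U d)"
      by eventually_elim (use cover U(4) in auto)
  qed
qed

lemma finite_measure_add_point_mass:
  assumes M: "finite_measure M" and x: "x \<in> space M" "{x} \<in> sets M"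
  obtains \<nu> where "finite_measure \<nu>" "sets \<nu> = sets M"
    "\<And>Q. (AE y in \<nu>. Q y) \<longleftrightarrow> (AE y in M. Q y) \<and> Q x"
proof -
  interpret finite_measure M by (rule M)
  define \<nu> where "\<nu> = measure_of (space M) (sets M) (\<lambda>A. emeasure M A + indicator A x)"
  have sets: "sets \<nu> = sets M" and space: "space \<nu> = space M" by (simp_all add: \<nu>_def)
  have "countably_additive (sets M) (\<lambda>A. emeasure M A + indicator A x)"
    unfolding countably_additive_def by (auto simp: suminf_add[symmetric] suminf_emeasure suminf_indicator)
  then have emeasure: "emeasure \<nu> A = emeasure M A + indicator A x" if "A \<in> sets M" for A
    using that sets.sigma_algebra_axioms unfolding \<nu>_def
    by (intro emeasure_measure_of_sigma) (auto simp: positive_def)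
  have null: "N \<in> null_sets \<nu> \<longleftrightarrow> N \<in> null_sets M \<and> x \<notin> N" for N
    by (auto simp: null_sets_def sets emeasure indicator_def)
  show ?thesis
  proof (rule that[OF _ sets])
    show "finite_measure \<nu>"
      using emeasure[OF sets.top] by (intro finite_measureI) (simp add: space x(1))
    fix Q
    show "(AE y in \<nu>. Q y) \<longleftrightarrow> (AE y in M. Q y) \<and> Q x"
    proof safe
      assume "AE y in \<nu>. Q y"
      then obtain N where "N \<in> null_sets \<nu>" "{y \<in> space M. \<not> Q y} \<subseteq> N"
        by (auto simp: eventually_ae_filter space)
      with x(1) show "AE y in M. Q y" "Q x" unfolding null by (auto intro: AE_I')
    next
      assume "AE y in M. Q y" "Q x"
      then obtain N where N: "N \<in> null_sets M" "{y \<in> space M. \<not> Q y} \<subseteq> N"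
        by (auto simp: eventually_ae_filter)
      have "N - {x} \<in> null_sets \<nu>" unfolding null using N(1) x(2) by (auto intro: null_sets_subset)
      then show "AE y in \<nu>. Q y" by (rule AE_I') (use N(2) \<open>Q x\<close> in \<open>auto simp: space\<close>)
    qed
  qed
qed

definition glue :: "'x set \<Rightarrow> ('x \<Rightarrow> 'y set) \<Rightarrow> ('x \<Rightarrow> 'z) \<Rightarrow> ('y \<Rightarrow> 'z) \<Rightarrow> 'y \<Rightarrow> 'z" where
  "glue D U e b y = (if \<exists>d\<in>D. y \<in> U d then e (THE d. d \<in> D \<and> y \<in> U d) else b y)"

lemma glue_inside:
  assumes "disjoint_family_on U D" "d \<in> D" "y \<in> U d"
  shows "glue D U e b y = e d"
proof -
  have "(THE d. d \<in> D \<and> y \<in> U d) = d"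
    using assms by (intro the_equality) (auto simp: disjoint_family_on_def)
  then show ?thesis using assms(2,3) by (auto simp: glue_def)
qed

lemma glue_outside: "y \<notin> (\<Union>d\<in>D. U d) \<Longrightarrow> glue D U e b y = b y"
  by (auto simp: glue_def)

lemma measurable_glue:
  assumes D: "countable D" "disjoint_family_on U D" and U: "\<And>d. d \<in> D \<Longrightarrow> U d \<in> sets N"
    and e: "\<And>d. d \<in> D \<Longrightarrow> e d \<in> measurable M K" and b: "(\<lambda>(y, h). b y h) \<in> measurable (N \<Otimes>\<^sub>M M) K"
  shows "(\<lambda>(y, h). glue D U e b y h) \<in> measurable (N \<Otimes>\<^sub>M M) K"
proof (rule measurable_piecewise_restrict)
  let ?R = "space N - (\<Union>d\<in>D. U d)"
  let ?C = "insert (?R \<times> space M) ((\<lambda>d. U d \<times> space M) ` D)"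
  show "countable ?C" using D(1) by simp
  show "space (N \<Otimes>\<^sub>M M) \<subseteq> \<Union>?C" by (auto simp: space_pair_measure)
  have "\<Omega> \<in> sets (N \<Otimes>\<^sub>M M)" if "\<Omega> \<in> ?C" for \<Omega>
    using that U D(1) by (auto intro!: pair_measureI sets.Diff sets.countable_UN')
  then show "\<Omega> \<inter> space (N \<Otimes>\<^sub>M M) \<in> sets (N \<Otimes>\<^sub>M M)" if "\<Omega> \<in> ?C" for \<Omega> using that by blast
  fix \<Omega> assume "\<Omega> \<in> ?C"
  then consider "\<Omega> = ?R \<times> space M" | d where "d \<in> D" "\<Omega> = U d \<times> space M" by blast
  then show "(\<lambda>(y, h). glue D U e b y h) \<in> measurable (restrict_space (N \<Otimes>\<^sub>M M) \<Omega>) K"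
  proof cases
    case 1
    show ?thesis
      by (rule measurable_cong[THEN iffD2, OF _ measurable_restrict_space1[OF b]])
         (auto simp: 1 space_restrict_space glue_outside)
  next
    case 2
    have e_snd: "(\<lambda>z. e d (snd z)) \<in> measurable (N \<Otimes>\<^sub>M M) K"
      by (rule measurable_compose[OF measurable_snd e[OF 2(1)]])
    show ?thesis
      by (rule measurable_cong[THEN iffD2, OF _ measurable_restrict_space1[OF e_snd]])
         (auto simp: 2 space_restrict_space glue_inside[OF D(2) 2(1)])
  qed
qed

text \<open>The good set \<open>S\<close> need not be measurable, hence a random point \<open>N\<close> instead of its law.\<close>

locale lift_family = prob_space M + \<Omega>: finite_measure \<Omega>
  for M :: "'h measure" and \<Omega> :: "'w measure" +
  fixes N :: "'w \<Rightarrow> 'x::second_countable_topology" and S :: "'x set"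
    and \<F> :: "('h \<Rightarrow> 'b::polish_space) set" and \<Phi> :: "'x \<Rightarrow> ('h \<Rightarrow> 'b) set"
  assumes measurable_N: "N \<in> borel_measurable \<Omega>"
    and completely_regular: "completely_regular_space (euclidean :: 'x topology)"
    and AE_S: "AE \<omega> in \<Omega>. N \<omega> \<in> S"
    and class_nonempty: "\<F> \<noteq> {}"
    and class_measurable: "\<F> \<subseteq> borel_measurable M"
    and class_lim: "(\<And>n. f n \<in> \<F>) \<Longrightarrow> (\<lambda>h. lim (\<lambda>n. f n h)) \<in> \<F>"
    and lifts_in_class: "\<Phi> x \<subseteq> \<F>"
    and lifts_nonempty: "x \<in> S \<Longrightarrow> \<Phi> x \<noteq> {}"
    and lifts_lower_semicontinuous: "x \<in> S \<Longrightarrow> e \<in> \<Phi> x \<Longrightarrow> 0 < \<epsilon> \<Longrightarrow>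
      \<forall>\<^sub>F y in nhds x. y \<in> S \<longrightarrow> (\<exists>e'\<in>\<Phi> y. meas_dist M e e' < \<epsilon>)"
    and lifts_closed: "x \<in> S \<Longrightarrow> (\<And>k. E k \<in> \<Phi> x) \<Longrightarrow> e \<in> \<F> \<Longrightarrow> tendsto_in_measure M E e \<Longrightarrow> e \<in> \<Phi> x"
begin

definition approx_selection :: "real \<Rightarrow> ('x \<Rightarrow> 'h \<Rightarrow> 'b) \<Rightarrow> bool" where
  "approx_selection r b \<longleftrightarrow> (\<lambda>(x, h). b x h) \<in> borel_measurable (borel \<Otimes>\<^sub>M M) \<and> (\<forall>x. b x \<in> \<F>) \<and>
    (AE \<omega> in \<Omega>. (\<forall>\<^sub>F y in nhds (N \<omega>). b y = b (N \<omega>)) \<and> (\<exists>e\<in>\<Phi> (N \<omega>). meas_dist M (b (N \<omega>)) e < r))"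

lemma approx_selectionD:
  assumes "approx_selection r b"
  shows "(\<lambda>(x, h). b x h) \<in> borel_measurable (borel \<Otimes>\<^sub>M M)" "b x \<in> \<F>"
    "AE \<omega> in \<Omega>. (\<forall>\<^sub>F y in nhds (N \<omega>). b y = b (N \<omega>)) \<and> (\<exists>e\<in>\<Phi> (N \<omega>). meas_dist M (b (N \<omega>)) e < r)"
  using assms by (auto simp: approx_selection_def)

lemma approx_selection_const:
  assumes "e \<in> \<F>"
  shows "approx_selection 2 (\<lambda>_. e)"
proof -
  have [measurable]: "e \<in> borel_measurable M" using assms class_measurable by blast
  have "\<exists>e'\<in>\<Phi> x. meas_dist M e e' < 2" if "x \<in> S" for x
  proof -
    obtain e' where e': "e' \<in> \<Phi> x" using lifts_nonempty[OF \<open>x \<in> S\<close>] by blast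
    then have "e' \<in> borel_measurable M" using lifts_in_class class_measurable by blast
    then have "meas_dist M e e' \<le> 1" by (intro meas_dist_le_1) simp_all
    with e' show ?thesis by force
  qed
  then have "AE \<omega> in \<Omega>. \<exists>e'\<in>\<Phi> (N \<omega>). meas_dist M e e' < 2" using AE_S by (auto elim: eventually_mono)
  with assms show ?thesis by (simp add: approx_selection_def)
qed

lemma lift_near:
  assumes x: "x \<in> S" "\<forall>\<^sub>F y in nhds x. b y = b x" "\<exists>e\<in>\<Phi> x. meas_dist M (b x) e < r" and r': "0 < r'"
  shows "\<exists>V e. open V \<and> x \<in> V \<and> e \<in> \<Phi> x \<and>
    (\<forall>y\<in>V. meas_dist M (b y) e < r \<and> (y \<in> S \<longrightarrow> (\<exists>e'\<in>\<Phi> y. meas_dist M e e' < r')))"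
proof -
  obtain e where e: "e \<in> \<Phi> x" "meas_dist M (b x) e < r" using x(3) by blast
  have "\<forall>\<^sub>F y in nhds x. meas_dist M (b y) e < r" using x(2) by eventually_elim (simp add: e(2))
  then have "\<forall>\<^sub>F y in nhds x. meas_dist M (b y) e < r \<and> (y \<in> S \<longrightarrow> (\<exists>e'\<in>\<Phi> y. meas_dist M e e' < r'))"
    using lifts_lower_semicontinuous[OF x(1) e(1) r'] by (rule eventually_conj)
  with e(1) show ?thesis unfolding eventually_nhds by blast
qed

lemma lift_partition:
  assumes near: "AE \<omega> in \<Omega>. (\<forall>\<^sub>F y in nhds (N \<omega>). b y = b (N \<omega>)) \<and> (\<exists>e\<in>\<Phi> (N \<omega>). meas_dist M (b (N \<omega>)) e < r)"
    and r': "0 < r'"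
  obtains D :: "'x set" and U e where "countable D" "disjoint_family_on U D"
    "\<And>d. d \<in> D \<Longrightarrow> open (U d)" "\<And>d. d \<in> D \<Longrightarrow> e d \<in> \<F>"
    "\<And>d y. d \<in> D \<Longrightarrow> y \<in> U d \<Longrightarrow> meas_dist M (b y) (e d) < r"
    "\<And>d y. d \<in> D \<Longrightarrow> y \<in> U d \<Longrightarrow> y \<in> S \<Longrightarrow> \<exists>e'\<in>\<Phi> y. meas_dist M (e d) e' < r'"
    "AE \<omega> in \<Omega>. N \<omega> \<in> (\<Union>d\<in>D. U d)"
proof -
  define A where "A = {x \<in> S. (\<forall>\<^sub>F y in nhds x. b y = b x) \<and> (\<exists>e\<in>\<Phi> x. meas_dist M (b x) e < r)}"
  have "\<exists>V e. open V \<and> x \<in> V \<and> e \<in> \<Phi> x \<and>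
      (\<forall>y\<in>V. meas_dist M (b y) e < r \<and> (y \<in> S \<longrightarrow> (\<exists>e'\<in>\<Phi> y. meas_dist M e e' < r')))" if "x \<in> A" for x
    using lift_near[of x b r r'] that r' by (simp add: A_def)
  then obtain V e where "\<And>x. x \<in> A \<Longrightarrow> open (V x) \<and> x \<in> V x \<and> e x \<in> \<Phi> x \<and>
      (\<forall>y\<in>V x. meas_dist M (b y) (e x) < r \<and> (y \<in> S \<longrightarrow> (\<exists>e'\<in>\<Phi> y. meas_dist M (e x) e' < r')))"
    by metis
  then have V: "\<And>x. x \<in> A \<Longrightarrow> open (V x)" "\<And>x. x \<in> A \<Longrightarrow> x \<in> V x"
    and e: "\<And>x. x \<in> A \<Longrightarrow> e x \<in> \<Phi> x"
    and V_near: "\<And>x y. x \<in> A \<Longrightarrow> y \<in> V x \<Longrightarrow> meas_dist M (b y) (e x) < r"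
      "\<And>x y. x \<in> A \<Longrightarrow> y \<in> V x \<Longrightarrow> y \<in> S \<Longrightarrow> \<exists>e'\<in>\<Phi> y. meas_dist M (e x) e' < r'"
    by blast+
  have law: "finite_measure (distr \<Omega> borel N)" by (rule \<Omega>.finite_measure_distr[OF measurable_N])
  obtain D U where D: "countable D" "D \<subseteq> A" "disjoint_family_on U D"
    and U: "\<And>d. d \<in> D \<Longrightarrow> open (U d)" "\<And>d. d \<in> D \<Longrightarrow> U d \<subseteq> V d"
    and law_cover: "AE x in distr \<Omega> borel N. x \<in> A \<longrightarrow> x \<in> (\<Union>d\<in>D. U d)"
    by (rule null_frontier_partition[where A = A and V = V, OF law sets_distr completely_regular V])
      (assumption | rule that)+
  show ?thesis
  proof (rule that[OF D(1,3) U(1)])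
    show "e d \<in> \<F>" if "d \<in> D" for d using e D(2) lifts_in_class that by blast
    show "meas_dist M (b y) (e d) < r" if "d \<in> D" "y \<in> U d" for d y
      using V_near(1) D(2) U(2) that by blast
    show "\<exists>e'\<in>\<Phi> y. meas_dist M (e d) e' < r'" if "d \<in> D" "y \<in> U d" "y \<in> S" for d y
      using V_near(2)[of d y] D(2) U(2)[OF that(1)] that by blast
    show "AE \<omega> in \<Omega>. N \<omega> \<in> (\<Union>d\<in>D. U d)"
      using AE_S near AE_distrD[OF measurable_N law_cover] by eventually_elim (simp add: A_def)
  qed
qed

lemma approx_selection_refine:
  assumes b: "approx_selection r b" and r: "0 < r" "0 < r'"
  obtains b' where "approx_selection r' b'" "\<And>y. meas_dist M (b y) (b' y) \<le> r"
proof -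
  obtain D :: "'x set" and U e where D: "countable D" "disjoint_family_on U D"
    and U: "\<And>d. d \<in> D \<Longrightarrow> open (U d)" and e: "\<And>d. d \<in> D \<Longrightarrow> e d \<in> \<F>"
    and near: "\<And>d y. d \<in> D \<Longrightarrow> y \<in> U d \<Longrightarrow> meas_dist M (b y) (e d) < r"
      "\<And>d y. d \<in> D \<Longrightarrow> y \<in> U d \<Longrightarrow> y \<in> S \<Longrightarrow> \<exists>e'\<in>\<Phi> y. meas_dist M (e d) e' < r'"
    and cover: "AE \<omega> in \<Omega>. N \<omega> \<in> (\<Union>d\<in>D. U d)"
    by (rule lift_partition[OF approx_selectionD(3)[OF b] r(2)])
      (assumption | rule that)+
  define b' where "b' = glue D U e b"
  have b'_inside: "b' y = e d" if "d \<in> D" "y \<in> U d" for d y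
    unfolding b'_def by (rule glue_inside[OF D(2) that])
  have b'_outside: "b' y = b y" if "y \<notin> (\<Union>d\<in>D. U d)" for y
    unfolding b'_def by (rule glue_outside[OF that])
  show ?thesis
  proof (rule that)
    from AE_S cover have "AE \<omega> in \<Omega>. (\<forall>\<^sub>F y in nhds (N \<omega>). b' y = b' (N \<omega>)) \<and>
        (\<exists>e'\<in>\<Phi> (N \<omega>). meas_dist M (b' (N \<omega>)) e' < r')"
    proof eventually_elim
      case (elim \<omega>)
      then obtain d where d: "d \<in> D" "N \<omega> \<in> U d" by blast
      then have "\<forall>\<^sub>F y in nhds (N \<omega>). y \<in> U d" using U by (intro eventually_nhds_in_open)
      then have "\<forall>\<^sub>F y in nhds (N \<omega>). b' y = b' (N \<omega>)"
        by eventually_elim (simp add: b'_inside[OF d(1)] d(2))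
      with near(2)[OF d elim(1)] show ?case by (simp add: b'_inside[OF d])
    qed
    moreover have "(\<lambda>(y, h). b' y h) \<in> borel_measurable (borel \<Otimes>\<^sub>M M)"
      unfolding b'_def using approx_selectionD(1)[OF b] D U e class_measurable
      by (intro measurable_glue) auto
    moreover have "b' y \<in> \<F>" for y
      using b'_inside e b'_outside[of y] approx_selectionD(2)[OF b] by (cases "y \<in> (\<Union>d\<in>D. U d)") auto
    ultimately show "approx_selection r' b'" by (simp add: approx_selection_def)
    show "meas_dist M (b y) (b' y) \<le> r" for y
      using near(1)[of _ y] b'_inside[of _ y] b'_outside[of y] r(1)
      by (cases "y \<in> (\<Union>d\<in>D. U d)") (auto intro: less_imp_le)
  qed
qed

lemma approx_selection_sequence:
  obtains B where "\<And>n::nat. approx_selection (2 / 2 ^ n) (B n)"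
    "\<And>n y. meas_dist M (B n y) (B (Suc n) y) \<le> 2 / 2 ^ n"
proof -
  obtain e where "e \<in> \<F>" using class_nonempty by blast
  have "\<exists>B. \<forall>n. approx_selection (2 / 2 ^ n) (B n) \<and> (\<forall>y. meas_dist M (B n y) (B (Suc n) y) \<le> 2 / 2 ^ n)"
  proof (rule dependent_nat_choice)
    show "\<exists>b. approx_selection (2 / 2 ^ 0) b" using approx_selection_const[OF \<open>e \<in> \<F>\<close>] by auto
    fix b and n :: nat assume "approx_selection (2 / 2 ^ n) b"
    then obtain b' where "approx_selection (2 / 2 ^ Suc n) b'" "\<And>y. meas_dist M (b y) (b' y) \<le> 2 / 2 ^ n"
      by (rule approx_selection_refine[where r' = "2 / 2 ^ Suc n"]) auto
    then show "\<exists>b'. approx_selection (2 / 2 ^ Suc n) b' \<and> (\<forall>y. meas_dist M (b y) (b' y) \<le> 2 / 2 ^ n)"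
      by blast
  qed
  then show ?thesis using that by blast
qed

lemma lifts_closed_approx:
  assumes x: "x \<in> S" and B: "tendsto_in_measure M B b" "b \<in> \<F>"
    and near: "\<And>n. \<exists>e\<in>\<Phi> x. meas_dist M (B n) e < a n" and a: "a \<longlonglongrightarrow> 0"
  shows "b \<in> \<Phi> x"
proof -
  obtain E where E: "\<And>n. E n \<in> \<Phi> x" "\<And>n. meas_dist M (B n) (E n) < a n" using near by metis
  then have E_meas: "E n \<in> borel_measurable M" for n using lifts_in_class class_measurable by blast
  note B_lim = tendsto_in_measureD[OF B(1)]
  have "tendsto_in_measure M E b"
  proof (rule tendsto_in_measureI_le[OF E_meas B_lim(2) _ tendsto_add_zero[OF a B_lim(3)]])
    fix n
    have "meas_dist M (E n) b \<le> meas_dist M (E n) (B n) + meas_dist M (B n) b"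
      by (intro meas_dist_triangle E_meas B_lim)
    then show "meas_dist M (E n) b \<le> a n + meas_dist M (B n) b"
      using E(2)[of n] by (simp add: meas_dist_commute[of M "E n"])
  qed
  then show ?thesis by (rule lifts_closed[OF x E(1) B(2)])
qed

lemma almost_continuous_selection:
  obtains b where "(\<lambda>(x, h). b x h) \<in> borel_measurable (borel \<Otimes>\<^sub>M M)" "\<And>x. b x \<in> \<F>"
    "AE \<omega> in \<Omega>. b (N \<omega>) \<in> \<Phi> (N \<omega>)" "AE \<omega> in \<Omega>. continuous_in_measure M b (N \<omega>)"
proof -
  obtain B where approx: "\<And>n::nat. approx_selection (2 / 2 ^ n) (B n)"
    and step: "\<And>n y. meas_dist M (B n y) (B (Suc n) y) \<le> 2 / 2 ^ n"
    by (rule approx_selection_sequence) blast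
  note B_class = approx_selectionD(2)[OF approx]
  have B_meas: "B n x \<in> borel_measurable M" for n x using B_class class_measurable by blast
  define b where "b x h = lim (\<lambda>n. B n x h)" for x h
  have b_class: "b x \<in> \<F>" for x
    unfolding b_def[abs_def] by (intro class_lim B_class)
  then have b_meas: "b x \<in> borel_measurable M" for x using class_measurable by blast
  have close: "meas_dist M (B n x) (b x) \<le> 4 / 2 ^ n" for n x
    using meas_dist_lim_le[of "\<lambda>n. B n x" 2 n] B_meas step by (simp add: b_def[abs_def])
  have radius: "(\<lambda>n. c / 2 ^ n) \<longlonglongrightarrow> (0::real)" for c by (rule LIMSEQ_divide_realpow_zero) simp
  have lim: "tendsto_in_measure M (\<lambda>n. B n x) (b x)" for x
    by (rule tendsto_in_measureI_le[OF B_meas b_meas close radius])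
  have AE_B: "AE \<omega> in \<Omega>. N \<omega> \<in> S \<and> (\<forall>n. (\<forall>\<^sub>F y in nhds (N \<omega>). B n y = B n (N \<omega>)) \<and>
      (\<exists>e\<in>\<Phi> (N \<omega>). meas_dist M (B n (N \<omega>)) e < 2 / 2 ^ n))"
    using AE_S approx_selectionD(3)[OF approx] by (simp add: AE_all_countable)
  show ?thesis
  proof (rule that[OF _ b_class])
    show "(\<lambda>(x, h). b x h) \<in> borel_measurable (borel \<Otimes>\<^sub>M M)"
      unfolding b_def case_prod_unfold
      by (rule borel_measurable_lim_complete)
        (use approx_selectionD(1)[OF approx] in \<open>simp add: case_prod_unfold\<close>)
    show "AE \<omega> in \<Omega>. continuous_in_measure M b (N \<omega>)"
      using AE_B
      by eventually_elim
        (auto intro: continuous_in_measure_if_locally_constant_approx[OF B_meas b_meas close radius])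
    show "AE \<omega> in \<Omega>. b (N \<omega>) \<in> \<Phi> (N \<omega>)"
      using AE_B
    proof eventually_elim
      case (elim \<omega>)
      then show ?case by (intro lifts_closed_approx[OF _ lim b_class _ radius[of 2]]) simp_all
    qed
  qed
qed

end

section \<open>Partial coboundaries\<close>

definition alt :: "nat \<Rightarrow> 'a::ab_group_add \<Rightarrow> 'a" where
  "alt i a = (if even i then a else - a)"

lemma alt_alt [simp]: "alt i (alt i a) = a"
  and alt_0 [simp]: "alt i 0 = 0"
  and alt_Suc: "alt (Suc i) a = - alt i a"
  and alt_add_index: "alt (i + k) a = alt i (alt k a)"
  and alt_add: "alt i (a + b) = alt i a + alt i b"
  and alt_minus: "alt i (- a) = - alt i a"
  and alt_commute: "alt i (alt k a) = alt k (alt i a)"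
  by (simp_all add: alt_def)

lemma alt_eq_0_iff [simp]: "alt i a = 0 \<longleftrightarrow> a = 0"
  by (simp add: alt_def)

lemma alt_eq_iff: "alt i a = b \<longleftrightarrow> a = alt i b"
  by (auto simp: alt_def)

lemma alt_sum: "alt i (\<Sum>x\<in>A. f x) = (\<Sum>x\<in>A. alt i (f x))"
  by (simp add: alt_def sum_negf)

lemma tendsto_alt:
  fixes f :: "'x \<Rightarrow> 'a::topological_ab_group_add"
  shows "(f \<longlongrightarrow> l) F \<Longrightarrow> ((\<lambda>x. alt i (f x)) \<longlongrightarrow> alt i l) F"
  by (auto simp: alt_def intro: tendsto_minus)

lemma measurable_alt [measurable (raw)]:
  fixes f :: "'x \<Rightarrow> 'a::{topological_ab_group_add, second_countable_topology}"
  shows "f \<in> borel_measurable M \<Longrightarrow> (\<lambda>x. alt i (f x)) \<in> borel_measurable M"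
  by (cases "even i") (simp_all add: alt_def borel_measurable_uminus_group)

text \<open>Splitting the variables into a head and a tail turns the coboundary into a double complex.\<close>

definition pcobd :: "nat \<Rightarrow> nat \<Rightarrow> ((nat \<Rightarrow> 'g) \<Rightarrow> 'a::ab_group_add) \<Rightarrow> (nat \<Rightarrow> 'g) \<Rightarrow> 'a" where
  "pcobd a b F x = (\<Sum>i=a..<b. alt i (F (face i x)))"

lemma pcobd_empty [simp]: "b \<le> a \<Longrightarrow> pcobd a b F x = 0"
  by (simp add: pcobd_def)

lemma pcobd_zero [simp]: "pcobd a b (\<lambda>x. 0) x = 0"
  by (simp add: pcobd_def)

lemma pcobd_Suc: "a \<le> b \<Longrightarrow> pcobd a (Suc b) F x = pcobd a b F x + alt b (F (face b x))"
  by (simp add: pcobd_def)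

lemma pcobd_add: "pcobd a b (\<lambda>x. F x + H x) x = pcobd a b F x + pcobd a b H x"
  by (simp add: pcobd_def alt_add sum.distrib)

lemma pcobd_minus: "pcobd a b (\<lambda>x. - F x) x = - pcobd a b F x"
  by (simp add: pcobd_def alt_minus sum_negf)

lemma pcobd_diff: "pcobd a b (\<lambda>x. F x - H x) x = pcobd a b F x - pcobd a b H x"
  using pcobd_add[of a b F "\<lambda>x. - H x"] pcobd_minus[of a b H] by simp

lemma pcobd_alt: "pcobd a b (\<lambda>x. alt k (F x)) x = alt k (pcobd a b F x)"
  by (simp add: pcobd_def alt_sum alt_commute)

lemma pcobd_split: "a \<le> c \<Longrightarrow> c \<le> b \<Longrightarrow> pcobd a b F x = pcobd a c F x + pcobd c b F x"
  by (simp add: pcobd_def sum.atLeastLessThan_concat)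

lemma pcobd_commute:
  assumes "b \<le> Suc c"
  shows "pcobd (Suc c) (Suc d) (pcobd a b u) x = - pcobd a b (pcobd c d u) x"
proof -
  have "pcobd (Suc c) (Suc d) (pcobd a b u) x =
    (\<Sum>i=c..<d. \<Sum>l=a..<b. alt (Suc i) (alt l (u (face l (face (Suc i) x)))))"
    unfolding pcobd_def sum.shift_bounds_Suc_ivl alt_sum by (rule refl)
  also have "\<dots> = (\<Sum>i=c..<d. \<Sum>l=a..<b. - alt l (alt i (u (face i (face l x)))))"
    using assms by (intro sum.cong refl) (simp add: face_face alt_Suc alt_minus alt_commute)
  also have "\<dots> = - (\<Sum>l=a..<b. \<Sum>i=c..<d. alt l (alt i (u (face i (face l x)))))"
    by (subst sum.swap) (simp add: sum_negf)
  finally show ?thesis by (simp add: pcobd_def alt_sum)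
qed

lemma pcobd_pcobd: "pcobd a (Suc b) (pcobd a b u) x = 0"
proof (cases "a \<le> b")
  case True
  then show ?thesis
  proof (induction b rule: dec_induct)
    case base
    have "pcobd a a u = (\<lambda>x. 0)" by (simp add: fun_eq_iff)
    then show ?case by simp
  next
    case (step b)
    have split: "pcobd a (Suc b) u = (\<lambda>x. pcobd a b u x + pcobd b (Suc b) u x)"
      using step(1) by (auto simp: fun_eq_iff intro: pcobd_split)
    have "pcobd a (Suc (Suc b)) (pcobd a (Suc b) u) x =
      pcobd a (Suc b) (pcobd a (Suc b) u) x + pcobd (Suc b) (Suc (Suc b)) (pcobd a (Suc b) u) x"
      using step(1) by (intro pcobd_split) auto
    also have "pcobd (Suc b) (Suc (Suc b)) (pcobd a (Suc b) u) x = - pcobd a (Suc b) (pcobd b (Suc b) u) x"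
      by (rule pcobd_commute) simp
    also have "pcobd a (Suc b) (pcobd a (Suc b) u) x = pcobd a (Suc b) (pcobd b (Suc b) u) x"
      unfolding split by (simp add: pcobd_add step.IH)
    finally show ?case by simp
  qed
qed simp

lemma pcobd_tail_eq_minus_head:
  assumes "pcobd 0 (Suc n) \<sigma> x = 0" and "m \<le> n"
  shows "pcobd (Suc m) (Suc n) (\<lambda>x. \<sigma> x + pcobd 0 (Suc m) v x) x =
    - pcobd 0 (Suc m) (\<lambda>x. \<sigma> x + pcobd 0 m u x + pcobd m n v x) x"
proof -
  have "pcobd 0 (Suc n) \<sigma> x = pcobd 0 (Suc m) \<sigma> x + pcobd (Suc m) (Suc n) \<sigma> x"
    by (rule pcobd_split) (use \<open>m \<le> n\<close> in auto)
  with assms(1) have "pcobd (Suc m) (Suc n) \<sigma> x = - pcobd 0 (Suc m) \<sigma> x"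
    by (simp add: eq_neg_iff_add_eq_0 add.commute)
  moreover have "pcobd (Suc m) (Suc n) (pcobd 0 (Suc m) v) x = - pcobd 0 (Suc m) (pcobd m n v) x"
    by (rule pcobd_commute) simp
  ultimately show ?thesis by (simp add: pcobd_add pcobd_pcobd)
qed

lemma pcobd_comb_seq: "pcobd m (m + q) F (comb_seq m g h) = alt m (pcobd 0 q (\<lambda>h. F (comb_seq m g h)) h)"
proof -
  have "pcobd m (m + q) F (comb_seq m g h) = (\<Sum>i=0..<q. alt (m + i) (F (face (m + i) (comb_seq m g h))))"
    unfolding pcobd_def using sum.shift_bounds_nat_ivl[of _ 0 m q] by (simp add: add.commute)
  then show ?thesis by (simp add: pcobd_def alt_sum alt_add_index face_comb_seq_tail)
qed

lemma depends_upto_pcobd: "depends_upto n F \<Longrightarrow> depends_upto (Suc n) (pcobd a b F)"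
  unfolding pcobd_def[abs_def]
  by (intro depends_upto_sum depends_upto_compose[where f = "alt _"] depends_upto_face)

lemma measurable_pcobd [measurable]:
  fixes F :: "(nat \<Rightarrow> 'g::second_countable_topology) \<Rightarrow>
    'a::{topological_ab_group_add, second_countable_topology}"
  assumes [measurable]: "F \<in> borel_measurable borel"
  shows "pcobd a b F \<in> borel_measurable borel"
  unfolding pcobd_def[abs_def] by measurable

definition freeze_last ::
  "nat \<Rightarrow> ((nat \<Rightarrow> 'g) \<Rightarrow> 'g) \<Rightarrow> ((nat \<Rightarrow> 'g) \<Rightarrow> 'a::ab_group_add) \<Rightarrow> (nat \<Rightarrow> 'g) \<Rightarrow> 'a" where
  "freeze_last n c F x = alt (Suc n) (F (x(n - 1 := c x)))"

lemma pcobd_freeze_last: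
  assumes F: "depends_upto n F" and "m \<le> n"
    and c: "\<And>i. m \<le> i \<Longrightarrow> i < n \<Longrightarrow> c (face i x) = c x"
    and zero: "pcobd m (Suc n) F (x(n := c x)) = 0"
  shows "pcobd m n (freeze_last n c F) x = F x"
proof -
  let ?y = "x(n := c x)"
  have "F (face i ?y) = F ((face i x)(n - 1 := c x))" if "m \<le> i" "i < n" for i
    by (rule depends_uptoD[OF F]) (use that in \<open>auto simp: face_def\<close>)
  then have "pcobd m n (freeze_last n c F) x = alt (Suc n) (pcobd m n F ?y)"
    unfolding pcobd_def alt_sum by (intro sum.cong refl) (simp add: freeze_last_def c alt_commute)
  moreover have "F (face n ?y) = F x"
    by (rule depends_uptoD[OF F]) (auto simp: face_def)
  then have "pcobd m n F ?y + alt n (F x) = 0"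
    using zero pcobd_Suc[OF \<open>m \<le> n\<close>, of F ?y] by simp
  then have "pcobd m n F ?y = alt (Suc n) (F x)" by (simp add: alt_Suc eq_neg_iff_add_eq_0)
  ultimately show ?thesis by simp
qed

lemma measurable_freeze_last:
  fixes F :: "(nat \<Rightarrow> 'g::second_countable_topology) \<Rightarrow>
    'a::{topological_ab_group_add, second_countable_topology}"
  assumes [measurable]: "F \<in> borel_measurable borel" "c \<in> borel_measurable borel"
  shows "freeze_last n c F \<in> borel_measurable borel"
  unfolding freeze_last_def[abs_def] by measurable

lemma depends_upto_freeze_last:
  assumes F: "depends_upto n F" and c: "depends_upto (n - 1) c"
  shows "depends_upto (n - 1) (freeze_last n c F)"
proof (rule depends_uptoI)
  fix x y :: "nat \<Rightarrow> 'a" assume eq: "\<And>i. i < n - 1 \<Longrightarrow> x i = y i"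
  have "c x = c y" using eq by (rule depends_uptoD[OF c])
  then have "F (x(n - 1 := c x)) = F (y(n - 1 := c y))"
    by (intro depends_uptoD[OF F]) (use eq in auto)
  then show "freeze_last n c F x = freeze_last n c F y" by (simp add: freeze_last_def)
qed

section \<open>Measurable cocycles and their primitives\<close>

context quasi_invariant
begin

lemma AE_pcobd_cong:
  assumes "AE x in P. F x = H x"
  shows "AE x in P. pcobd a b F x = pcobd a b H x"
proof -
  have "AE x in P. \<forall>i. F (face i x) = H (face i x)"
    unfolding AE_all_countable using AE_face[OF assms] by blast
  then show ?thesis by eventually_elim (simp add: pcobd_def)
qed

lemma tendsto_in_measure_pcobd:
  fixes u :: "(nat \<Rightarrow> 'g) \<Rightarrow> 'a::{topological_ab_group_add, polish_space}"
  assumes U: "tendsto_in_measure P U u"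
  shows "tendsto_in_measure P (\<lambda>k. pcobd a b (U k)) (pcobd a b u)"
proof -
  note [measurable] = tendsto_in_measure_P_borelD[OF U]
  have "tendsto_in_measure P (\<lambda>k x. alt i (U k (face i x))) (\<lambda>x. alt i (u (face i x)))" for i
    by (rule seq.P.tendsto_in_measure_map[OF tendsto_in_measure_face[OF U]]) (auto intro: tendsto_alt)
  then show ?thesis
    unfolding pcobd_def[abs_def] by (intro seq.P.tendsto_in_measure_sum) auto
qed

definition ae_cocycle :: "nat \<Rightarrow> ((nat \<Rightarrow> 'g) \<Rightarrow> 'a::{topological_ab_group_add, polish_space}) \<Rightarrow> bool" where
  "ae_cocycle n w \<longleftrightarrow> w \<in> borel_measurable borel \<and> depends_upto n w \<and> (AE x in P. pcobd 0 (Suc n) w x = 0)"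

definition primitives ::
  "nat \<Rightarrow> ((nat \<Rightarrow> 'g) \<Rightarrow> 'a::{topological_ab_group_add, polish_space}) \<Rightarrow> ((nat \<Rightarrow> 'g) \<Rightarrow> 'a) set" where
  "primitives n w =
    {e \<in> borel_measurable borel. depends_upto n e \<and> (AE x in P. pcobd 0 (Suc n) e x = w x)}"

lemma ae_cocycle_diff:
  assumes "ae_cocycle n w" "ae_cocycle n w'"
  shows "ae_cocycle n (\<lambda>x. w x - w' x)"
proof -
  have [measurable]: "w \<in> borel_measurable borel" "w' \<in> borel_measurable borel"
    using assms by (simp_all add: ae_cocycle_def)
  have "depends_upto n (\<lambda>x. w x - w' x)"
    using assms by (auto simp: ae_cocycle_def intro: depends_upto_compose2[where f = "(-)"])
  moreover have "AE x in P. pcobd 0 (Suc n) w x = 0" "AE x in P. pcobd 0 (Suc n) w' x = 0"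
    using assms by (simp_all add: ae_cocycle_def)
  then have "AE x in P. pcobd 0 (Suc n) (\<lambda>x. w x - w' x) x = 0"
    by eventually_elim (simp add: pcobd_diff)
  ultimately show ?thesis by (simp add: ae_cocycle_def)
qed

lemma ae_cocycle_limit:
  assumes W: "tendsto_in_measure P W w" and cocycle: "\<And>k. ae_cocycle n (W k)" and dep: "depends_upto n w"
  shows "ae_cocycle n w"
proof -
  note [measurable] = tendsto_in_measure_P_borelD[OF W]
  have "AE x in P. \<forall>k. pcobd 0 (Suc n) (W k) x = 0"
    using cocycle by (simp add: AE_all_countable ae_cocycle_def)
  then have "tendsto_in_measure P (\<lambda>k. pcobd 0 (Suc n) (W k)) (\<lambda>_. 0)"
    by (intro seq.P.tendsto_in_measure_AE) auto
  from seq.P.tendsto_in_measure_unique[OF tendsto_in_measure_pcobd[OF W] this] dep show ?thesis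
    by (simp add: ae_cocycle_def)
qed

lemma primitives_limit:
  assumes E: "\<And>k. E k \<in> primitives n w" and lim: "tendsto_in_measure P E e"
    and dep: "depends_upto n e" and w: "w \<in> borel_measurable borel"
  shows "e \<in> primitives n w"
proof -
  note [measurable] = tendsto_in_measure_P_borelD[OF lim] w
  have "AE x in P. \<forall>k. pcobd 0 (Suc n) (E k) x = w x"
    using E by (simp add: AE_all_countable primitives_def)
  then have "tendsto_in_measure P (\<lambda>k. pcobd 0 (Suc n) (E k)) w"
    by (intro seq.P.tendsto_in_measure_AE) auto
  from seq.P.tendsto_in_measure_unique[OF tendsto_in_measure_pcobd[OF lim] this] dep show ?thesis
    by (simp add: primitives_def)
qed

lemma AE_pcobd_freeze_last_const:
  assumes "ae_cocycle n w"
  shows "AE t in L. AE x in P. pcobd 0 n (freeze_last n (\<lambda>_. t) w) x = w x"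
proof -
  have "AE t in L. AE x in P. pcobd 0 (Suc n) w (x(n := t)) = 0"
    using assms by (intro AE_fun_upd) (simp add: ae_cocycle_def)
  then show ?thesis
  proof eventually_elim
    case (elim t)
    then show ?case
      by eventually_elim (use assms in \<open>auto simp: ae_cocycle_def intro!: pcobd_freeze_last\<close>)
  qed
qed

lemma freeze_last_const_in_primitives:
  assumes "ae_cocycle (Suc n) w" "AE x in P. pcobd 0 (Suc n) (freeze_last (Suc n) (\<lambda>_. t) w) x = w x"
  shows "freeze_last (Suc n) (\<lambda>_. t) w \<in> primitives n w"
  using assms depends_upto_freeze_last[of "Suc n" w "\<lambda>_. t"]
  by (simp add: primitives_def ae_cocycle_def measurable_freeze_last depends_upto_const)

lemma primitives_nonempty:
  assumes "ae_cocycle (Suc n) w"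
  shows "primitives n w \<noteq> {}"
proof -
  obtain t where "AE x in P. pcobd 0 (Suc n) (freeze_last (Suc n) (\<lambda>_. t) w) x = w x"
    using eventually_happens'[OF ae_filter_bot AE_pcobd_freeze_last_const[OF assms]] by blast
  from freeze_last_const_in_primitives[OF assms this] show ?thesis by blast
qed

text \<open>The coboundary is an open map onto the cocycles: cocycles tending to zero are the coboundaries
  of their restrictions to one generic value of the last variable, which tend to zero as well.\<close>

lemma primitives_null_sequence:
  assumes w: "\<And>k. ae_cocycle (Suc n) (w k)" and lim: "AE x in P. (\<lambda>k. w k x) \<longlonglongrightarrow> 0"
  obtains v where "\<And>k. v k \<in> primitives n (w k)" "AE x in P. (\<lambda>k. v k x) \<longlonglongrightarrow> 0"
proof -
  have "AE t in L. \<forall>k. AE x in P. pcobd 0 (Suc n) (freeze_last (Suc n) (\<lambda>_. t) (w k)) x = w k x"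
    unfolding AE_all_countable using AE_pcobd_freeze_last_const[OF w] by blast
  moreover have "AE t in L. AE x in P. (\<lambda>k. w k (x(n := t))) \<longlonglongrightarrow> 0"
    using lim by (rule AE_fun_upd)
  ultimately have "AE t in L. (\<forall>k. AE x in P. pcobd 0 (Suc n) (freeze_last (Suc n) (\<lambda>_. t) (w k)) x = w k x) \<and>
      (AE x in P. (\<lambda>k. w k (x(n := t))) \<longlonglongrightarrow> 0)"
    by (rule eventually_conj)
  from eventually_happens'[OF ae_filter_bot this] obtain t where
    t: "\<And>k. AE x in P. pcobd 0 (Suc n) (freeze_last (Suc n) (\<lambda>_. t) (w k)) x = w k x"
    "AE x in P. (\<lambda>k. w k (x(n := t))) \<longlonglongrightarrow> 0" by blast
  show ?thesis
  proof (rule that)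
    show "freeze_last (Suc n) (\<lambda>_. t) (w k) \<in> primitives n (w k)" for k
      by (rule freeze_last_const_in_primitives[OF w t(1)])
    show "AE x in P. (\<lambda>k. freeze_last (Suc n) (\<lambda>_. t) (w k) x) \<longlonglongrightarrow> 0"
      using t(2)
    proof eventually_elim
      case (elim x)
      from tendsto_alt[OF elim, of "Suc (Suc n)"] show ?case by (simp add: freeze_last_def)
    qed
  qed
qed

lemma primitives_add:
  assumes "e \<in> primitives n w" "v \<in> primitives n w'"
  shows "(\<lambda>x. e x + v x) \<in> primitives n (\<lambda>x. w x + w' x)"
proof -
  have "depends_upto n (\<lambda>x. e x + v x)"
    using assms by (auto simp: primitives_def intro: depends_upto_compose2[where f = "(+)"])
  moreover have "AE x in P. pcobd 0 (Suc n) e x = w x" "AE x in P. pcobd 0 (Suc n) v x = w' x"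
    using assms by (simp_all add: primitives_def)
  then have "AE x in P. pcobd 0 (Suc n) (\<lambda>x. e x + v x) x = w x + w' x"
    by eventually_elim (simp add: pcobd_add)
  ultimately show ?thesis using assms by (auto simp: primitives_def intro: borel_measurable_add)
qed

lemma primitives_near:
  assumes W: "tendsto_in_measure P W w" and cocycle: "\<And>k. ae_cocycle (Suc n) (W k)" "ae_cocycle (Suc n) w"
    and e: "e \<in> primitives n w" and "0 < \<epsilon>"
  shows "\<exists>k. \<exists>e'\<in>primitives n (W k). meas_dist P e e' < \<epsilon>"
proof -
  obtain r :: "nat \<Rightarrow> nat" where r: "strict_mono r" "AE x in P. (\<lambda>k. W (r k) x) \<longlonglongrightarrow> w x"
    by (rule seq.P.tendsto_in_measure_AE_subseq[OF W])
  have diff: "AE x in P. (\<lambda>k. W (r k) x - w x) \<longlonglongrightarrow> 0"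
    using r(2)
  proof eventually_elim
    case (elim x)
    from tendsto_diff[OF elim tendsto_const[of "w x"]] show ?case by simp
  qed
  obtain v where v: "\<And>k. v k \<in> primitives n (\<lambda>x. W (r k) x - w x)" "AE x in P. (\<lambda>k. v k x) \<longlonglongrightarrow> 0"
    by (rule primitives_null_sequence[OF ae_cocycle_diff[OF cocycle] diff]) blast
  have ev: "(\<lambda>x. e x + v k x) \<in> primitives n (W (r k))" for k
    using primitives_add[OF e v(1)[of k]] by simp
  have [measurable]: "e \<in> borel_measurable borel" "v k \<in> borel_measurable borel" for k
    using e v(1)[of k] by (simp_all add: primitives_def)
  have "AE x in P. (\<lambda>k. e x + v k x) \<longlonglongrightarrow> e x"
    using v(2)
  proof eventually_elim
    case (elim x)
    from tendsto_add[OF tendsto_const[of "e x"] elim] show ?case by simp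
  qed
  then have "tendsto_in_measure P (\<lambda>k x. e x + v k x) e" by (intro seq.P.tendsto_in_measure_AE) auto
  then have "\<forall>\<^sub>F k in sequentially. meas_dist P (\<lambda>x. e x + v k x) e < \<epsilon>"
    using \<open>0 < \<epsilon>\<close> by (intro order_tendstoD(2)[OF tendsto_in_measureD(3)])
  then obtain k where "meas_dist P (\<lambda>x. e x + v k x) e < \<epsilon>" by (auto simp: eventually_sequentially)
  then have "meas_dist P e (\<lambda>x. e x + v k x) < \<epsilon>" by (simp only: meas_dist_commute[of P e])
  with ev show ?thesis by blast
qed

end

section \<open>Equivariant cochains\<close>

locale polish_module = quasi_invariant L
  for L :: "'g::{topological_group_add, t2_space, second_countable_topology} measure" +
  fixes \<alpha> :: "'g \<Rightarrow> 'a::{topological_ab_group_add, polish_space} \<Rightarrow> 'a"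
  assumes action: "G_module_action \<alpha>"
begin

lemma act_zero [simp]: "\<alpha> 0 a = a"
  and act_act: "\<alpha> g (\<alpha> h a) = \<alpha> (g + h) a"
  and act_add: "\<alpha> g (a + b) = \<alpha> g a + \<alpha> g b"
  and act_continuous: "continuous_on UNIV (\<lambda>(g, a). \<alpha> g a)"
  using action by (auto simp: G_module_action_def)

lemma act_0_right [simp]: "\<alpha> g 0 = 0"
  using act_add[of g 0 0] by simp

lemma act_minus: "\<alpha> g (- a) = - \<alpha> g a"
  using act_add[of g a "- a"] by (simp add: eq_neg_iff_add_eq_0 add.commute)

lemma act_alt: "\<alpha> g (alt i a) = alt i (\<alpha> g a)"
  by (simp add: alt_def act_minus)

lemma act_sum: "\<alpha> g (\<Sum>i\<in>I. f i) = (\<Sum>i\<in>I. \<alpha> g (f i))"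
  by (induction I rule: infinite_finite_induct) (simp_all add: act_add)

lemma tendsto_act: "(\<gamma> \<longlongrightarrow> g) F \<Longrightarrow> (f \<longlongrightarrow> a) F \<Longrightarrow> ((\<lambda>x. \<alpha> (\<gamma> x) (f x)) \<longlongrightarrow> \<alpha> g a) F"
  using continuous_on_tendsto_compose[OF act_continuous tendsto_Pair, of \<gamma> g F f a] by simp

lemma measurable_act [measurable (raw)]:
  assumes "f \<in> borel_measurable M" "h \<in> borel_measurable M"
  shows "(\<lambda>x. \<alpha> (f x) (h x)) \<in> borel_measurable M"
  by (rule borel_measurable_continuous_Pair[OF assms])
     (use act_continuous in \<open>simp add: case_prod_unfold\<close>)

lemma pcobd_act_translate:
  "pcobd a b (\<lambda>x. \<alpha> g (F (translate h x))) x = \<alpha> g (pcobd a b F (translate h x))"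
  by (simp add: pcobd_def act_sum act_alt translate_face)

lemma tendsto_in_measure_act_translate:
  assumes U: "tendsto_in_measure P U u" and dep: "\<And>k. depends_upto n (U k)" "depends_upto n u"
    and \<gamma>: "\<gamma> \<longlonglongrightarrow> g"
  shows "tendsto_in_measure P (\<lambda>k h. \<alpha> (\<gamma> k) (U k (translate (- \<gamma> k) h))) (\<lambda>h. \<alpha> g (u (translate (- g) h)))"
proof -
  note [measurable] = tendsto_in_measure_P_borelD[OF U]
  have "tendsto_in_measure P (\<lambda>k h. U k (translate (- \<gamma> k) h)) (\<lambda>h. u (translate (- g) h))"
    using tendsto_in_measure_translate_upto[OF U tendsto_minus[OF \<gamma>], of n]
    by (simp add: depends_upto_translate[OF dep(1)] depends_upto_translate[OF dep(2)])
  then show ?thesis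
    by (rule seq.P.tendsto_in_measure_map) (auto intro: tendsto_act LIMSEQ_compose_subseq[OF \<gamma>])
qed

definition cochain :: "nat \<Rightarrow> ((nat \<Rightarrow> 'g) \<Rightarrow> 'a) \<Rightarrow> bool" where
  "cochain n F \<longleftrightarrow> F \<in> borel_measurable borel \<and> depends_upto n F \<and> (\<forall>g x. F (translate g x) = \<alpha> g (F x))"

lemma cochain_measurable: "cochain n F \<Longrightarrow> F \<in> borel_measurable borel"
  and cochain_depends: "cochain n F \<Longrightarrow> depends_upto n F"
  and cochain_equivariant: "cochain n F \<Longrightarrow> F (translate g x) = \<alpha> g (F x)"
  by (auto simp: cochain_def)

lemma cochain_0: "cochain n (\<lambda>x. 0)"
  by (simp add: cochain_def depends_upto_const)

lemma cochain_add: "cochain n F \<Longrightarrow> cochain n H \<Longrightarrow> cochain n (\<lambda>x. F x + H x)"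
  unfolding cochain_def using depends_upto_compose2[of n F H "(+)"] by (auto simp: act_add)

lemma cochain_minus: "cochain n F \<Longrightarrow> cochain n (\<lambda>x. - F x)"
  unfolding cochain_def
  using depends_upto_compose[of n F uminus] by (simp add: act_minus borel_measurable_uminus_group)

lemma cochain_diff: "cochain n F \<Longrightarrow> cochain n H \<Longrightarrow> cochain n (\<lambda>x. F x - H x)"
  using cochain_add[of n F "\<lambda>x. - H x"] cochain_minus by simp

lemma cochain_alt: "cochain n F \<Longrightarrow> cochain n (\<lambda>x. alt i (F x))"
  using cochain_minus[of n F] by (cases "even i") (simp_all add: alt_def)

lemma cochain_pcobd:
  assumes "cochain n F"
  shows "cochain (Suc n) (pcobd a b F)"
  unfolding cochain_def
proof (intro conjI allI)
  show "pcobd a b F \<in> borel_measurable borel" using assms by (intro measurable_pcobd cochain_measurable)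
  show "depends_upto (Suc n) (pcobd a b F)" using assms by (intro depends_upto_pcobd cochain_depends)
  show "pcobd a b F (translate g x) = \<alpha> g (pcobd a b F x)" for g x
    by (simp add: pcobd_def act_sum act_alt translate_face[symmetric] cochain_equivariant[OF assms])
qed

lemma cochain_freeze_last:
  assumes D: "cochain n D" and "2 \<le> n"
  shows "cochain (n - 1) (freeze_last n (\<lambda>x. x 0 + t) D)"
  unfolding cochain_def
proof (intro conjI allI)
  show "freeze_last n (\<lambda>x. x 0 + t) D \<in> borel_measurable borel"
    by (intro measurable_freeze_last cochain_measurable[OF D]) measurable
  show "depends_upto (n - 1) (freeze_last n (\<lambda>x. x 0 + t) D)"
    by (intro depends_upto_freeze_last cochain_depends[OF D] depends_uptoI) (use \<open>2 \<le> n\<close> in auto)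
  fix g x
  have "(translate g x)(n - 1 := translate g x 0 + t) = translate g (x(n - 1 := x 0 + t))"
    by (auto simp: translate_def fun_eq_iff add.assoc)
  then show "freeze_last n (\<lambda>x. x 0 + t) D (translate g x) = \<alpha> g (freeze_last n (\<lambda>x. x 0 + t) D x)"
    by (simp add: freeze_last_def act_alt cochain_equivariant[OF D])
qed

lemma AE_shear_coord:
  assumes Q: "AE x in P. Q x" "Measurable.pred borel Q" and "0 < n"
  shows "AE x in P. Q (x(n := x 0 + x n))"
proof (rule AE_comb_seqI[where m = 1])
  note [measurable] = Q(2)
  show "Measurable.pred borel (\<lambda>x. Q (x(n := x 0 + x n)))" by measurable
  show "AE g in P. AE h in P. Q ((comb_seq 1 g h)(n := comb_seq 1 g h 0 + comb_seq 1 g h n))"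
    using AE_comb_seqD[OF Q(1), of 1]
  proof eventually_elim
    case (elim g)
    from AE_translate_coord[OF elim, of "n - 1" "g 0"] show ?case
    proof eventually_elim
      case (elim h)
      moreover have "comb_seq 1 g (h(n - 1 := g 0 + h (n - 1))) =
          (comb_seq 1 g h)(n := comb_seq 1 g h 0 + comb_seq 1 g h n)"
        using \<open>0 < n\<close> by (auto simp: fun_eq_iff split: nat.split)
      ultimately show ?case by simp
    qed
  qed
qed

lemma pcobd_exact:
  assumes m: "1 \<le> m" "m \<le> n" and n: "2 \<le> n" and D: "cochain n D" "AE x in P. pcobd m (Suc n) D x = 0"
  obtains u where "cochain (n - 1) u" "AE x in P. pcobd m n u x = D x"
proof -
  note [measurable] = cochain_measurable[OF D(1)]
  have "AE x in P. pcobd m (Suc n) D (x(n := x 0 + x n)) = 0"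
    by (rule AE_shear_coord[OF D(2)]) (use n in auto)
  from AE_fun_upd[OF this, of n] have "AE t in L. AE x in P. pcobd m (Suc n) D (x(n := x 0 + t)) = 0"
    using n by simp
  from eventually_happens'[OF ae_filter_bot this]
  obtain t where t: "AE x in P. pcobd m (Suc n) D (x(n := x 0 + t)) = 0" by blast
  have "AE x in P. pcobd m n (freeze_last n (\<lambda>x. x 0 + t) D) x = D x"
    using t
  proof eventually_elim
    case (elim x)
    then show ?case
      by (intro pcobd_freeze_last cochain_depends[OF D(1)] m(2)) (use m in \<open>auto simp: face_def\<close>)
  qed
  with cochain_freeze_last[OF D(1) n] show ?thesis by (rule that)
qed

section \<open>Continuity in the first variables\<close>

definition tail :: "nat \<Rightarrow> ((nat \<Rightarrow> 'g) \<Rightarrow> 'a) \<Rightarrow> (nat \<Rightarrow> 'g) \<Rightarrow> (nat \<Rightarrow> 'g) \<Rightarrow> 'a" where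
  "tail m F x h = F (comb_seq m x h)"

definition continuous_head :: "nat \<Rightarrow> ((nat \<Rightarrow> 'g) \<Rightarrow> 'a) \<Rightarrow> (nat \<Rightarrow> 'g) \<Rightarrow> bool" where
  "continuous_head m F x \<longleftrightarrow> continuous_in_measure P (tail m F) x"

definition almost_continuous_head :: "nat \<Rightarrow> ((nat \<Rightarrow> 'g) \<Rightarrow> 'a) \<Rightarrow> bool" where
  "almost_continuous_head m F \<longleftrightarrow> (AE x in P. continuous_head m F x) \<and> continuous_head m F (\<lambda>_. 0)"

lemma almost_continuous_headD:
  assumes "almost_continuous_head m F"
  shows "AE x in P. continuous_head m F x" "continuous_head m F (\<lambda>_. 0)"
  using assms by (simp_all add: almost_continuous_head_def)

lemma measurable_tail [measurable]:
  assumes [measurable]: "F \<in> borel_measurable borel"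
  shows "tail m F x \<in> borel_measurable borel"
  unfolding tail_def[abs_def] by measurable

lemma depends_upto_tail: "depends_upto (m + j) F \<Longrightarrow> depends_upto j (tail m F x)"
  unfolding tail_def[abs_def] using depends_upto_comb_seq[of "m + j" F m x] by simp

lemma tail_cong: "(\<And>i. i < m \<Longrightarrow> x i = y i) \<Longrightarrow> tail m F x = tail m F y"
  by (auto simp: tail_def fun_eq_iff comb_seq_def intro!: arg_cong[where f = F])

lemma tail_translate: "cochain n F \<Longrightarrow> tail m F (translate g x) h = \<alpha> g (tail m F x (translate (- g) h))"
  by (simp add: tail_def cochain_equivariant[symmetric] translate_comb_seq translate_translate)

lemma continuous_head_cong:
  assumes "continuous_head m F x" and eq: "\<And>i. i < m \<Longrightarrow> x i = y i"
  shows "continuous_head m F y"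
  unfolding continuous_head_def continuous_in_measure_def
proof (intro allI impI)
  fix X assume X: "X \<longlonglongrightarrow> y"
  let ?X = "\<lambda>k i. if i < m then X k i else x i"
  have "(\<lambda>k. ?X k i) \<longlonglongrightarrow> x i" for i
    using X eq by (cases "i < m") (auto simp: tendsto_fun_iff)
  then have "?X \<longlonglongrightarrow> x" by (simp add: tendsto_fun_iff)
  with assms(1) have "tendsto_in_measure P (\<lambda>k. tail m F (?X k)) (tail m F x)"
    unfolding continuous_head_def by (rule continuous_in_measureD)
  moreover have "tail m F (?X k) = tail m F (X k)" for k by (rule tail_cong) simp
  moreover have "tail m F x = tail m F y" using eq by (rule tail_cong)
  ultimately show "tendsto_in_measure P (\<lambda>k. tail m F (X k)) (tail m F y)" by simp
qed

lemma continuous_head_translate: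
  assumes F: "cochain (m + j) F" and x: "continuous_head m F x"
  shows "continuous_head m F (translate g x)"
  unfolding continuous_head_def continuous_in_measure_def
proof (intro allI impI)
  fix X assume X: "X \<longlonglongrightarrow> translate g x"
  have "(\<lambda>k. - g + X k i) \<longlonglongrightarrow> - g + (g + x i)" for i
    using X by (intro tendsto_intros) (auto simp: tendsto_fun_iff translate_def)
  then have "(\<lambda>k. translate (- g) (X k)) \<longlonglongrightarrow> x"
    by (simp add: tendsto_fun_iff translate_def add.assoc[symmetric])
  then have "tendsto_in_measure P (\<lambda>k. tail m F (translate (- g) (X k))) (tail m F x)"
    using x unfolding continuous_head_def by (rule continuous_in_measureD[rotated])
  from tendsto_in_measure_act_translate[OF this _ _ tendsto_const[of g]]
  have "tendsto_in_measure P (\<lambda>k h. \<alpha> g (tail m F (translate (- g) (X k)) (translate (- g) h)))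
      (\<lambda>h. \<alpha> g (tail m F x (translate (- g) h)))"
    using depends_upto_tail cochain_depends[OF F] by blast
  moreover have "tail m F (translate g x) = (\<lambda>h. \<alpha> g (tail m F x (translate (- g) h)))"
    using tail_translate[OF F] by (rule ext)
  moreover have "tail m F (X k) = (\<lambda>h. \<alpha> g (tail m F (translate (- g) (X k)) (translate (- g) h)))" for k
    using tail_translate[OF F, of m g "translate (- g) (X k)"] by (auto simp: translate_translate)
  ultimately show "tendsto_in_measure P (\<lambda>k. tail m F (X k)) (tail m F (translate g x))"
    by (simp only:)
qed

lemma continuous_head_1:
  assumes F: "cochain (Suc j) F"
  shows "continuous_head 1 F x"
  unfolding continuous_head_def continuous_in_measure_def
proof (intro allI impI)
  note [measurable] = cochain_measurable[OF F]
  fix X :: "nat \<Rightarrow> nat \<Rightarrow> 'g" assume X: "X \<longlonglongrightarrow> x"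
  define f where "f = tail 1 F (\<lambda>_. 0)"
  have [measurable]: "f \<in> borel_measurable borel" unfolding f_def by measurable
  have dep: "depends_upto j f"
    unfolding f_def using cochain_depends[OF F] by (intro depends_upto_tail) simp
  have "tail 1 F y = (\<lambda>h. \<alpha> (y 0) (f (translate (- y 0) h)))" for y
  proof -
    have "tail 1 F y = tail 1 F (translate (y 0) (\<lambda>_. 0))" by (rule tail_cong) (simp add: translate_def)
    then show ?thesis by (simp add: tail_translate[OF F] f_def fun_eq_iff)
  qed
  moreover have "(\<lambda>k. X k 0) \<longlonglongrightarrow> x 0" using X by (simp add: tendsto_fun_iff)
  from tendsto_in_measure_act_translate[OF tendsto_in_measure_const dep dep this]
  have "tendsto_in_measure P (\<lambda>k h. \<alpha> (X k 0) (f (translate (- X k 0) h)))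
      (\<lambda>h. \<alpha> (x 0) (f (translate (- x 0) h)))"
    by simp
  ultimately show "tendsto_in_measure P (\<lambda>k. tail 1 F (X k)) (tail 1 F x)" by simp
qed

lemma continuous_head_pcobd:
  assumes F: "F \<in> borel_measurable borel" and c: "\<And>i. continuous_head m F (face i x)"
  shows "continuous_head (Suc m) (\<lambda>x. alt l (pcobd 0 (Suc m) F x)) x"
  unfolding continuous_head_def continuous_in_measure_def
proof (intro allI impI)
  note [measurable] = F
  fix X assume X: "X \<longlonglongrightarrow> x"
  have "tendsto_in_measure P (\<lambda>k. tail m F (face i (X k))) (tail m F (face i x))" for i
    using c[of i] tendsto_face[OF X, of i] unfolding continuous_head_def by (rule continuous_in_measureD)
  then have "tendsto_in_measure P (\<lambda>k h. alt l (alt i (tail m F (face i (X k)) h)))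
      (\<lambda>h. alt l (alt i (tail m F (face i x) h)))" for i
    by (rule seq.P.tendsto_in_measure_map) (auto intro!: tendsto_alt)
  then have "tendsto_in_measure P (\<lambda>k h. \<Sum>i=0..<Suc m. alt l (alt i (tail m F (face i (X k)) h)))
      (\<lambda>h. \<Sum>i=0..<Suc m. alt l (alt i (tail m F (face i x) h)))"
    by (intro seq.P.tendsto_in_measure_sum) auto
  moreover have "tail (Suc m) (\<lambda>x. alt l (pcobd 0 (Suc m) F x)) y =
      (\<lambda>h. \<Sum>i=0..<Suc m. alt l (alt i (tail m F (face i y) h)))" for y
    unfolding tail_def pcobd_def alt_sum by (intro ext sum.cong) (auto simp: face_comb_seq_head)
  ultimately show "tendsto_in_measure P (\<lambda>k. tail (Suc m) (\<lambda>x. alt l (pcobd 0 (Suc m) F x)) (X k))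
      (tail (Suc m) (\<lambda>x. alt l (pcobd 0 (Suc m) F x)) x)"
    by simp
qed

lemma almost_continuous_head_pcobd:
  assumes F: "F \<in> borel_measurable borel" and c: "almost_continuous_head m F"
  shows "almost_continuous_head (Suc m) (\<lambda>x. alt l (pcobd 0 (Suc m) F x))"
proof -
  have "AE x in P. \<forall>i. continuous_head m F (face i x)"
    unfolding AE_all_countable using AE_face[OF almost_continuous_headD(1)[OF c]] by blast
  then have "AE x in P. continuous_head (Suc m) (\<lambda>x. alt l (pcobd 0 (Suc m) F x)) x"
    by eventually_elim (auto intro: continuous_head_pcobd[OF F])
  moreover have "continuous_head (Suc m) (\<lambda>x. alt l (pcobd 0 (Suc m) F x)) (\<lambda>_. 0)"
    by (intro continuous_head_pcobd[OF F]) (simp add: face_def almost_continuous_headD(2)[OF c])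
  ultimately show ?thesis by (simp add: almost_continuous_head_def)
qed

definition normalize_head :: "nat \<Rightarrow> (nat \<Rightarrow> 'g) \<Rightarrow> (nat \<Rightarrow> 'g)" where
  "normalize_head m x i = (if i < m then - x 0 + x i else 0)"

lemma measurable_normalize_head [measurable]: "normalize_head m \<in> borel_measurable borel"
  by (rule measurable_coordinatewise_then_product) (simp add: normalize_head_def)

lemma tendsto_normalize_head: "X \<longlonglongrightarrow> x \<Longrightarrow> (\<lambda>k. normalize_head m (X k)) \<longlonglongrightarrow> normalize_head m x"
  unfolding tendsto_fun_iff normalize_head_def by (auto intro!: tendsto_intros)

lemma normalize_head_0: "normalize_head m (\<lambda>_. 0) = (\<lambda>_. 0)"
  by (auto simp: normalize_head_def)

lemma minus_translate_cancel: "- (g + y) + (g + z) = - y + (z::'g)"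
  by (simp only: minus_add add.assoc minus_add_cancel)

lemma normalize_head_translate: "normalize_head m (translate g x) = normalize_head m x"
  by (auto simp: normalize_head_def translate_def fun_eq_iff minus_translate_cancel)

lemma normalize_head_cong: "1 \<le> m \<Longrightarrow> (\<And>i. i < m \<Longrightarrow> x i = y i) \<Longrightarrow> normalize_head m x = normalize_head m y"
  by (auto simp: normalize_head_def fun_eq_iff)

lemma tail_normalize_head:
  assumes "cochain n F"
  shows "tail m F (normalize_head m x) h = \<alpha> (- x 0) (tail m F x (translate (x 0) h))"
proof -
  have "tail m F (normalize_head m x) = tail m F (translate (- x 0) x)"
    by (rule tail_cong) (simp add: normalize_head_def translate_def)
  then show ?thesis by (simp add: tail_translate[OF assms])
qed

definition equivariant_extension ::
  "nat \<Rightarrow> ((nat \<Rightarrow> 'g) \<Rightarrow> (nat \<Rightarrow> 'g) \<Rightarrow> 'a) \<Rightarrow> (nat \<Rightarrow> 'g) \<Rightarrow> 'a" where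
  "equivariant_extension m b x = \<alpha> (x 0) (b (normalize_head m x) (translate (- x 0) (\<lambda>i. x (m + i))))"

lemma tail_equivariant_extension:
  assumes "1 \<le> m"
  shows "tail m (equivariant_extension m b) x = (\<lambda>h. \<alpha> (x 0) (b (normalize_head m x) (translate (- x 0) h)))"
proof
  fix h
  have "normalize_head m (comb_seq m x h) = normalize_head m x"
    using assms by (intro normalize_head_cong) (auto simp: comb_seq_def)
  then show "tail m (equivariant_extension m b) x h = \<alpha> (x 0) (b (normalize_head m x) (translate (- x 0) h))"
    using assms by (simp add: tail_def equivariant_extension_def comb_seq_def)
qed

lemma cochain_equivariant_extension:
  assumes "1 \<le> m" and b: "(\<lambda>(x, h). b x h) \<in> borel_measurable (borel \<Otimes>\<^sub>M borel)" "\<And>x. depends_upto j (b x)"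
  shows "cochain (m + j) (equivariant_extension m b)"
  unfolding cochain_def
proof (intro conjI allI)
  have [measurable]: "(\<lambda>x i. x (m + i)) \<in> borel_measurable (borel :: (nat \<Rightarrow> 'g) measure)"
    by (rule measurable_coordinatewise_then_product) simp
  have "(\<lambda>x. (case (normalize_head m x, translate (- x 0) (\<lambda>i. x (m + i))) of (x, h) \<Rightarrow> b x h))
      \<in> borel_measurable borel"
    by (rule measurable_compose[OF _ b(1)]) measurable
  then show "equivariant_extension m b \<in> borel_measurable borel"
    unfolding equivariant_extension_def[abs_def] by simp
  show "depends_upto (m + j) (equivariant_extension m b)"
  proof (rule depends_uptoI)
    fix x y :: "nat \<Rightarrow> 'g" assume eq: "\<And>i. i < m + j \<Longrightarrow> x i = y i"
    have "normalize_head m x = normalize_head m y" "x 0 = y 0"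
      using assms(1) eq by (auto intro: normalize_head_cong)
    moreover have "b (normalize_head m y) (translate (- y 0) (\<lambda>i. x (m + i))) =
        b (normalize_head m y) (translate (- y 0) (\<lambda>i. y (m + i)))"
      by (rule depends_uptoD[OF b(2)]) (use eq in \<open>auto simp: translate_def\<close>)
    ultimately show "equivariant_extension m b x = equivariant_extension m b y"
      by (simp add: equivariant_extension_def)
  qed
  fix g :: 'g and x :: "nat \<Rightarrow> 'g"
  have "translate (- translate g x 0) (\<lambda>i. translate g x (m + i)) = translate (- x 0) (\<lambda>i. x (m + i))"
    by (auto simp: translate_def fun_eq_iff minus_translate_cancel)
  then show "equivariant_extension m b (translate g x) = \<alpha> g (equivariant_extension m b x)"
    by (simp only: equivariant_extension_def normalize_head_translate act_act) (simp add: translate_def)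
qed

lemma continuous_head_equivariant_extension:
  assumes "1 \<le> m" and dep: "\<And>x. depends_upto j (b x)"
    and b: "continuous_in_measure P b (normalize_head m x)"
  shows "continuous_head m (equivariant_extension m b) x"
  unfolding continuous_head_def continuous_in_measure_def
proof (intro allI impI)
  fix X assume X: "X \<longlonglongrightarrow> x"
  have "(\<lambda>k. X k 0) \<longlonglongrightarrow> x 0" using X by (simp add: tendsto_fun_iff)
  from tendsto_in_measure_act_translate[OF continuous_in_measureD[OF b tendsto_normalize_head[OF X]] dep dep this]
  show "tendsto_in_measure P (\<lambda>k. tail m (equivariant_extension m b) (X k))
      (tail m (equivariant_extension m b) x)"
    by (simp add: tail_equivariant_extension[OF assms(1)])
qed

lemma AE_pcobd_equivariant_extension:
  assumes m: "1 \<le> m" and c: "cochain (m + Suc j) c"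
    and b: "b (normalize_head m x) \<in> primitives j (tail m c (normalize_head m x))"
  shows "AE h in P. pcobd m (m + Suc j) (equivariant_extension m b) (comb_seq m x h) = alt m (c (comb_seq m x h))"
proof -
  let ?N = "normalize_head m x"
  have dep: "depends_upto (Suc j) (pcobd 0 (Suc j) (b ?N))" "depends_upto (Suc j) (tail m c ?N)"
    using b depends_upto_tail[OF cochain_depends[OF c]] by (simp_all add: primitives_def depends_upto_pcobd)
  have "AE h in P. pcobd 0 (Suc j) (b ?N) (translate_upto (Suc j) (- x 0) h) =
      tail m c ?N (translate_upto (Suc j) (- x 0) h)"
    using b by (intro AE_translate_upto) (simp add: primitives_def)
  then show ?thesis
  proof eventually_elim
    case (elim h)
    then have "pcobd 0 (Suc j) (b ?N) (translate (- x 0) h) = tail m c ?N (translate (- x 0) h)"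
      by (simp add: depends_upto_translate[OF dep(1)] depends_upto_translate[OF dep(2)])
    then have "pcobd 0 (Suc j) (tail m (equivariant_extension m b) x) h = tail m c x h"
      unfolding tail_equivariant_extension[OF m] pcobd_act_translate tail_normalize_head[OF c]
      by (simp add: act_act translate_translate)
    then show ?case unfolding pcobd_comb_seq by (simp add: tail_def[abs_def])
  qed
qed

end

section \<open>Lifting through the tail coboundary\<close>

locale continuous_tail_cocycle = polish_module L \<alpha>
  for L :: "'g::{topological_group_add, t2_space, second_countable_topology} measure"
    and \<alpha> :: "'g \<Rightarrow> 'a::{topological_ab_group_add, polish_space} \<Rightarrow> 'a" +
  fixes m j :: nat and c :: "(nat \<Rightarrow> 'g) \<Rightarrow> 'a"
  assumes head_nonempty: "1 \<le> m"
    and cochain_c: "cochain (m + Suc j) c"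
    and continuous_c: "almost_continuous_head m c"
    and cocycle_c: "AE x in P. pcobd m (m + Suc (Suc j)) c x = 0"
begin

definition good_heads :: "(nat \<Rightarrow> 'g) set" where
  "good_heads = {x. continuous_head m c x \<and> ae_cocycle (Suc j) (tail m c x)}"

lemma measurable_c [measurable]: "c \<in> borel_measurable borel"
  using cochain_c by (rule cochain_measurable)

lemma depends_upto_tail_c: "depends_upto (Suc j) (tail m c x)"
  using cochain_depends[OF cochain_c] by (rule depends_upto_tail)

lemma AE_tail_cocycle: "AE x in P. ae_cocycle (Suc j) (tail m c x)"
  using AE_comb_seqD[OF cocycle_c, of m]
proof eventually_elim
  case (elim x)
  then have "AE h in P. pcobd 0 (Suc (Suc j)) (tail m c x) h = 0"
    unfolding pcobd_comb_seq alt_eq_iff tail_def[abs_def] by simp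
  then show ?case by (simp add: ae_cocycle_def depends_upto_tail_c measurable_tail)
qed

lemma AE_normalize_head_good: "AE x in P. normalize_head m x \<in> good_heads"
  using AE_tail_cocycle almost_continuous_headD(1)[OF continuous_c]
proof eventually_elim
  case (elim x)
  let ?N = "normalize_head m x"
  have "continuous_head m c ?N"
    by (rule continuous_head_cong[OF continuous_head_translate[OF cochain_c elim(2), of "- x 0"]])
       (simp add: normalize_head_def translate_def)
  moreover have "AE h in P. pcobd 0 (Suc (Suc j)) (tail m c x) (translate_upto (Suc (Suc j)) (x 0) h) = 0"
    using elim(1) by (intro AE_translate_upto) (simp add: ae_cocycle_def)
  then have "AE h in P. pcobd 0 (Suc (Suc j)) (tail m c ?N) h = 0"
  proof eventually_elim
    case (elim h)
    have "tail m c ?N = (\<lambda>h. \<alpha> (- x 0) (tail m c x (translate (x 0) h)))"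
      using tail_normalize_head[OF cochain_c] by (rule ext)
    then show ?case
      using elim
      by (simp add: pcobd_act_translate depends_upto_translate[OF depends_upto_pcobd[OF depends_upto_tail_c]])
  qed
  ultimately show ?case by (simp add: good_heads_def ae_cocycle_def depends_upto_tail_c measurable_tail)
qed

lemma zero_good: "(\<lambda>_. 0) \<in> good_heads"
proof -
  obtain X where X: "X \<longlonglongrightarrow> (\<lambda>_. 0)" "\<And>k::nat. ae_cocycle (Suc j) (tail m c (X k))"
    by (rule AE_P_approximating_sequence[OF AE_tail_cocycle]) blast
  note cont = almost_continuous_headD(2)[OF continuous_c]
  then have "tendsto_in_measure P (\<lambda>k. tail m c (X k)) (tail m c (\<lambda>_. 0))"
    using X(1) unfolding continuous_head_def by (rule continuous_in_measureD)
  from ae_cocycle_limit[OF this X(2) depends_upto_tail_c] cont show ?thesis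
    by (simp add: good_heads_def)
qed

lemma primitives_tail_lower_semicontinuous:
  assumes x: "x \<in> good_heads" and e: "e \<in> primitives j (tail m c x)" and "0 < \<epsilon>"
  shows "\<forall>\<^sub>F y in nhds x. y \<in> good_heads \<longrightarrow> (\<exists>e'\<in>primitives j (tail m c y). meas_dist P e e' < \<epsilon>)"
proof -
  let ?bad = "{y \<in> good_heads. \<not> (\<exists>e'\<in>primitives j (tail m c y). meas_dist P e e' < \<epsilon>)}"
  have "False" if Y: "\<And>k. Y k \<in> ?bad" "Y \<longlonglongrightarrow> x" for Y
  proof -
    have "tendsto_in_measure P (\<lambda>k. tail m c (Y k)) (tail m c x)"
      using x Y(2) continuous_in_measureD[of P "tail m c"] by (simp add: good_heads_def continuous_head_def)
    moreover have "ae_cocycle (Suc j) (tail m c (Y k))" "ae_cocycle (Suc j) (tail m c x)" for k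
      using x Y(1)[of k] by (simp_all add: good_heads_def)
    ultimately obtain k where "\<exists>e'\<in>primitives j (tail m c (Y k)). meas_dist P e e' < \<epsilon>"
      using primitives_near e \<open>0 < \<epsilon>\<close> by blast
    with Y(1)[of k] show False by blast
  qed
  then have "\<forall>\<^sub>F y in inf (nhds x) (principal ?bad). False"
    by (intro sequentially_imp_eventually_nhds_within) blast
  then show ?thesis by (auto simp: eventually_inf_principal elim: eventually_mono)
qed

lemma lift_family_primitives:
  assumes \<nu>: "finite_measure \<nu>" "sets \<nu> = sets P" and good: "AE x in \<nu>. normalize_head m x \<in> good_heads"
  shows "lift_family P \<nu> (normalize_head m) good_heads {e \<in> borel_measurable borel. depends_upto j e}
    (\<lambda>x. primitives j (tail m c x))"
proof (intro lift_family.intro lift_family_axioms.intro seq.P.prob_space_axioms \<nu>(1) good)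
  let ?\<F> = "{e \<in> borel_measurable borel. depends_upto j (e :: (nat \<Rightarrow> 'g) \<Rightarrow> 'a)}"
  show "normalize_head m \<in> borel_measurable \<nu>"
    using measurable_normalize_head by (simp add: measurable_cong_sets[OF \<nu>(2) refl])
  show "completely_regular_space (euclidean :: (nat \<Rightarrow> 'g) topology)"
    by (rule completely_regular_sequences)
  have "(\<lambda>_. 0) \<in> ?\<F>" by (simp add: depends_upto_const)
  then show "?\<F> \<noteq> {}" by blast
  show "?\<F> \<subseteq> borel_measurable P" by auto
  show "(\<lambda>h. lim (\<lambda>n. f n h)) \<in> ?\<F>" if "\<And>n. f n \<in> ?\<F>" for f
    using that borel_measurable_lim_complete[of f borel] depends_upto_lim[of j f] by simp
  show "primitives j (tail m c x) \<subseteq> ?\<F>" for x by (auto simp: primitives_def)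
  show "primitives j (tail m c x) \<noteq> {}" if "x \<in> good_heads" for x
    using that by (intro primitives_nonempty) (simp add: good_heads_def)
  show "e \<in> primitives j (tail m c x)"
    if "\<And>k. E k \<in> primitives j (tail m c x)" "e \<in> ?\<F>" "tendsto_in_measure P E e" for x E e
    using that(2) by (intro primitives_limit[OF that(1,3)] measurable_tail measurable_c) simp
qed (rule primitives_tail_lower_semicontinuous)

text \<open>The point mass at the identity makes the identity a continuity point of the selection.\<close>

lemma almost_continuous_primitives:
  obtains b where "(\<lambda>(x, h). b x h) \<in> borel_measurable (borel \<Otimes>\<^sub>M borel)" "\<And>x. depends_upto j (b x)"
    "AE x in P. b (normalize_head m x) \<in> primitives j (tail m c (normalize_head m x)) \<and>
       continuous_in_measure P b (normalize_head m x)"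
    "continuous_in_measure P b (\<lambda>_. 0)"
proof -
  obtain \<nu> where \<nu>: "finite_measure \<nu>" "sets \<nu> = sets P"
    and AE_\<nu>: "\<And>Q. (AE x in \<nu>. Q x) \<longleftrightarrow> (AE x in P. Q x) \<and> Q (\<lambda>_. 0)"
    by (rule finite_measure_add_point_mass[OF seq.P.finite_measure_axioms, of "\<lambda>_. 0"])
       (auto simp: sets_P borel_singleton_fun)
  have "AE x in \<nu>. normalize_head m x \<in> good_heads"
    using AE_normalize_head_good zero_good by (simp add: AE_\<nu> normalize_head_0)
  then have family: "lift_family P \<nu> (normalize_head m) good_heads {e \<in> borel_measurable borel. depends_upto j e}
      (\<lambda>x. primitives j (tail m c x))"
    by (rule lift_family_primitives[OF \<nu>])
  obtain b where b: "(\<lambda>(x, h). b x h) \<in> borel_measurable (borel \<Otimes>\<^sub>M P)"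
    "\<And>x. b x \<in> {e \<in> borel_measurable borel. depends_upto j e}"
    "AE x in \<nu>. b (normalize_head m x) \<in> primitives j (tail m c (normalize_head m x))"
    "AE x in \<nu>. continuous_in_measure P b (normalize_head m x)"
    by (rule lift_family.almost_continuous_selection[OF family]) blast
  show ?thesis
  proof (rule that)
    show "(\<lambda>(x, h). b x h) \<in> borel_measurable (borel \<Otimes>\<^sub>M borel)"
      using b(1) measurable_cong_sets[OF sets_pair_measure_cong[OF refl sets_P] refl] by blast
    show "depends_upto j (b x)" for x using b(2) by simp
    show "AE x in P. b (normalize_head m x) \<in> primitives j (tail m c (normalize_head m x)) \<and>
        continuous_in_measure P b (normalize_head m x)"
      using b(3,4) by (simp add: AE_\<nu>)
    show "continuous_in_measure P b (\<lambda>_. 0)" using b(4) by (simp add: AE_\<nu> normalize_head_0)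
  qed
qed

lemma almost_continuous_lift:
  obtains F where "cochain (m + j) F" "almost_continuous_head m F"
    "AE x in P. pcobd m (m + Suc j) F x = alt m (c x)"
proof -
  obtain b where b: "(\<lambda>(x, h). b x h) \<in> borel_measurable (borel \<Otimes>\<^sub>M borel)" "\<And>x. depends_upto j (b x)"
    and AE_b: "AE x in P. b (normalize_head m x) \<in> primitives j (tail m c (normalize_head m x)) \<and>
       continuous_in_measure P b (normalize_head m x)"
    and b_0: "continuous_in_measure P b (\<lambda>_. 0)"
    by (rule almost_continuous_primitives) blast
  let ?F = "equivariant_extension m b"
  have F: "cochain (m + j) ?F" by (rule cochain_equivariant_extension[OF head_nonempty b])
  note [measurable] = cochain_measurable[OF F]
  show ?thesis
  proof (rule that[OF F])
    have "AE x in P. continuous_head m ?F x"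
      using AE_b by eventually_elim (auto intro: continuous_head_equivariant_extension[OF head_nonempty b(2)])
    then show "almost_continuous_head m ?F"
      using b_0 continuous_head_equivariant_extension[OF head_nonempty b(2), where x = "\<lambda>_. 0"]
      by (simp add: almost_continuous_head_def normalize_head_0)
    show "AE x in P. pcobd m (m + Suc j) ?F x = alt m (c x)"
    proof (rule AE_comb_seqI[where m = m])
      show "Measurable.pred borel (\<lambda>x. pcobd m (m + Suc j) ?F x = alt m (c x))"
        by (rule measurable_pred_eq) measurable
      show "AE x in P. AE h in P. pcobd m (m + Suc j) ?F (comb_seq m x h) = alt m (c (comb_seq m x h))"
        using AE_b by eventually_elim (rule AE_pcobd_equivariant_extension[OF head_nonempty cochain_c conjunct1])
    qed
  qed
qed

end

section \<open>Almost continuous representatives\<close>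

context polish_module
begin

lemma almost_continuous_lift_step:
  assumes \<sigma>: "cochain n \<sigma>" "AE x in P. pcobd 0 (Suc n) \<sigma> x = 0" and m: "m < n"
    and F: "cochain n F" "almost_continuous_head m F"
    and v: "cochain (n - 1) v" and F_eq: "AE x in P. F x = \<sigma> x + pcobd 0 m u x + pcobd m n v x"
  obtains F' where "cochain n F'" "almost_continuous_head (Suc m) F'"
    "AE x in P. pcobd (Suc m) (Suc n) F' x = pcobd (Suc m) (Suc n) (\<lambda>x. \<sigma> x + pcobd 0 (Suc m) v x) x"
proof -
  define T where "T x = \<sigma> x + pcobd 0 (Suc m) v x" for x
  define c where "c x = alt m (pcobd 0 (Suc m) F x)" for x
  have T_c: "AE x in P. pcobd (Suc m) (Suc n) T x = alt (Suc m) (c x)"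
    using \<sigma>(2) AE_pcobd_cong[OF F_eq, of 0 "Suc m"]
  proof eventually_elim
    case (elim x)
    with pcobd_tail_eq_minus_head[OF elim(1), of m v u] m show ?case
      by (simp add: T_def[abs_def] c_def alt_Suc)
  qed
  obtain j where n: "n = Suc m + j" using m less_iff_Suc_add by auto
  interpret continuous_tail_cocycle L \<alpha> "Suc m" j c
  proof unfold_locales
    show "cochain (Suc m + Suc j) c"
      unfolding c_def using cochain_alt[OF cochain_pcobd[OF F(1)]] n by simp
    show "almost_continuous_head (Suc m) c"
      unfolding c_def[abs_def] by (rule almost_continuous_head_pcobd[OF cochain_measurable[OF F(1)] F(2)])
    have "AE x in P. pcobd (Suc m) (Suc (Suc n)) (pcobd (Suc m) (Suc n) T) x =
        pcobd (Suc m) (Suc (Suc n)) (\<lambda>x. alt (Suc m) (c x)) x"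
      by (rule AE_pcobd_cong[OF T_c])
    then show "AE x in P. pcobd (Suc m) (Suc m + Suc (Suc j)) c x = 0"
      by eventually_elim (use n in \<open>simp add: pcobd_pcobd pcobd_alt\<close>)
  qed simp
  obtain F' where F': "cochain (Suc m + j) F'" "almost_continuous_head (Suc m) F'"
    "AE x in P. pcobd (Suc m) (Suc m + Suc j) F' x = alt (Suc m) (c x)"
    by (rule almost_continuous_lift) blast
  from F'(3) T_c have "AE x in P. pcobd (Suc m) (Suc n) F' x = pcobd (Suc m) (Suc n) T x"
    by eventually_elim (simp add: n)
  with F'(1,2) n show ?thesis unfolding T_def[abs_def] by (intro that[of F']) auto
qed

lemma partially_continuous_representative:
  assumes \<sigma>: "cochain n \<sigma>" "AE x in P. pcobd 0 (Suc n) \<sigma> x = 0" and m: "1 \<le> m" "m \<le> n"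
  shows "\<exists>F u v. cochain n F \<and> almost_continuous_head m F \<and> cochain (n - 1) u \<and> cochain (n - 1) v \<and>
    (AE x in P. F x = \<sigma> x + pcobd 0 m u x + pcobd m n v x)"
  using m
proof (induction m rule: dec_induct)
  case base
  have "almost_continuous_head 1 \<sigma>"
    using continuous_head_1[of "n - 1" \<sigma>] \<sigma>(1) base by (simp add: almost_continuous_head_def)
  then show ?case
    by (intro exI[of _ \<sigma>] exI[of _ "\<lambda>x. 0"]) (simp add: \<sigma> cochain_0)
next
  case (step m)
  then obtain F u v where F: "cochain n F" "almost_continuous_head m F" and v: "cochain (n - 1) v"
    and F_eq: "AE x in P. F x = \<sigma> x + pcobd 0 m u x + pcobd m n v x" by auto
  let ?T = "\<lambda>x. \<sigma> x + pcobd 0 (Suc m) v x"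
  have T: "cochain n ?T"
    using cochain_add[OF \<sigma>(1)] cochain_pcobd[OF v, of 0 "Suc m"] step by simp
  obtain F' where F': "cochain n F'" "almost_continuous_head (Suc m) F'"
    "AE x in P. pcobd (Suc m) (Suc n) F' x = pcobd (Suc m) (Suc n) ?T x"
    by (rule almost_continuous_lift_step[OF \<sigma> _ F v F_eq]) (use step in auto)
  have cocycle: "AE x in P. pcobd (Suc m) (Suc n) (\<lambda>x. F' x - ?T x) x = 0"
    using F'(3) by eventually_elim (simp add: pcobd_diff)
  obtain w where w: "cochain (n - 1) w" "AE x in P. pcobd (Suc m) n w x = F' x - ?T x"
    by (rule pcobd_exact[OF _ _ _ cochain_diff[OF F'(1) T] cocycle]) (use step in auto)
  from w(2) have "AE x in P. F' x = \<sigma> x + pcobd 0 (Suc m) v x + pcobd (Suc m) n w x"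
    by eventually_elim (simp add: algebra_simps)
  with F' w(1) v show ?case by blast
qed

theorem almost_continuous_representative:
  assumes "cochain n \<sigma>" "AE x in P. pcobd 0 (Suc n) \<sigma> x = 0" and n: "1 \<le> n"
  obtains F u where "cochain n F" "almost_continuous_head n F" "cochain (n - 1) u"
    "AE x in P. F x = \<sigma> x + pcobd 0 n u x" "n = 1 \<Longrightarrow> u = (\<lambda>_. 0)"
proof (cases "n = 1")
  case True
  have "almost_continuous_head n \<sigma>"
    using continuous_head_1[of 0 \<sigma>] assms(1) True by (simp add: almost_continuous_head_def)
  then show ?thesis using assms(1) by (intro that[of \<sigma> "\<lambda>_. 0"]) (auto intro: cochain_0)
next
  case False
  from partially_continuous_representative[OF assms(1,2) n order_refl] obtain F u where
    "cochain n F" "almost_continuous_head n F" "cochain (n - 1) u" "AE x in P. F x = \<sigma> x + pcobd 0 n u x"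
    by auto
  with False show ?thesis by (intro that[of F u]) auto
qed

end

section \<open>Strictly equivariant representatives\<close>

context polish_module
begin

lemma AE_shift_by_first_coord:
  assumes R: "\<And>\<gamma>. AE x in P. R \<gamma> x" and pred: "Measurable.pred (borel \<Otimes>\<^sub>M borel) (\<lambda>z. R (fst z) (snd z))"
  shows "AE y in L. AE x in P. R (y + - x 0) x"
proof -
  have "Measurable.pred (L \<Otimes>\<^sub>M P) (\<lambda>z. R (fst z) (snd z))" using pred by simp
  from LP.AE_commute[OF predE[OF this]] R have "AE x in P. AE \<gamma> in L. R \<gamma> x" by simp
  then have "AE x in P. AE y in L. R (y + - x 0) x"
    by eventually_elim (rule AE_right_translate)
  moreover have shifted: "Measurable.pred (L \<Otimes>\<^sub>M P) (\<lambda>z. R (fst z + - snd z 0) (snd z))"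
  proof -
    have [measurable]: "(\<lambda>z. snd z 0) \<in> borel_measurable (borel \<Otimes>\<^sub>M (borel :: (nat \<Rightarrow> 'g) measure))"
      by (rule measurable_product_then_coordinatewise) simp
    have "(\<lambda>z. (fst z + - snd z 0, snd z))
        \<in> measurable (borel \<Otimes>\<^sub>M borel) (borel \<Otimes>\<^sub>M (borel :: (nat \<Rightarrow> 'g) measure))"
      by measurable
    from measurable_compose[OF this pred] show ?thesis by simp
  qed
  ultimately show ?thesis
    using LP.AE_commute[of "\<lambda>y x. R (y + - x 0) x", OF predE[OF shifted]] by simp
qed

text \<open>The value at \<open>x\<close> is transported from the translate of \<open>x\<close> whose first coordinate is \<open>y\<close>.\<close>

definition strictify :: "'g \<Rightarrow> ((nat \<Rightarrow> 'g) \<Rightarrow> 'a) \<Rightarrow> (nat \<Rightarrow> 'g) \<Rightarrow> 'a" where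
  "strictify y f x = \<alpha> (- (y + - x 0)) (f (translate (y + - x 0) x))"

lemma cochain_strictify:
  assumes [measurable]: "f \<in> borel_measurable borel" and dep: "depends_upto n f" and "1 \<le> n"
  shows "cochain n (strictify y f)"
  unfolding cochain_def
proof (intro conjI allI)
  show "strictify y f \<in> borel_measurable borel" unfolding strictify_def[abs_def] by measurable
  show "depends_upto n (strictify y f)"
  proof (rule depends_uptoI)
    fix x x' :: "nat \<Rightarrow> 'g" assume eq: "\<And>i. i < n \<Longrightarrow> x i = x' i"
    have "x 0 = x' 0" using eq \<open>1 \<le> n\<close> by simp
    moreover have "f (translate (y + - x' 0) x) = f (translate (y + - x' 0) x')"
      by (rule depends_uptoD[OF dep]) (simp add: eq translate_def)
    ultimately show "strictify y f x = strictify y f x'" by (simp add: strictify_def)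
  qed
  fix g x
  have "y + - translate g x 0 + g = y + - x 0" "- (y + - translate g x 0) = g + - (y + - x 0)"
    by (simp_all only: translate_def minus_add add.assoc minus_minus left_minus add_0_right)
  then show "strictify y f (translate g x) = \<alpha> g (strictify y f x)"
    by (simp only: strictify_def translate_translate act_act)
qed

lemma strict_cochain:
  assumes f [measurable]: "f \<in> borel_measurable borel" and "depends_upto n f" "1 \<le> n"
    and equivariant: "\<And>g. AE x in P. f (translate g x) = \<alpha> g (f x)"
  obtains \<sigma> where "cochain n \<sigma>" "AE x in P. \<sigma> x = f x"
proof -
  have "AE y in L. AE x in P. strictify y f x = f x"
    unfolding strictify_def
  proof (rule AE_shift_by_first_coord[where R = "\<lambda>\<gamma> x. \<alpha> (- \<gamma>) (f (translate \<gamma> x)) = f x"])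
    show "AE x in P. \<alpha> (- \<gamma>) (f (translate \<gamma> x)) = f x" for \<gamma>
      using equivariant[of \<gamma>] by eventually_elim (simp add: act_act)
    show "Measurable.pred (borel \<Otimes>\<^sub>M borel) (\<lambda>z. \<alpha> (- fst z) (f (translate (fst z) (snd z))) = f (snd z))"
      by (rule measurable_pred_eq) measurable
  qed
  from eventually_happens'[OF ae_filter_bot this]
  obtain y where "AE x in P. strictify y f x = f x" by (elim exE)
  with cochain_strictify[OF assms(1-3)] show ?thesis by (rule that)
qed

end

section \<open>Continuity points\<close>

definition continuity_points :: "('x::topological_space \<Rightarrow> 'b::topological_space) \<Rightarrow> 'x set" where
  "continuity_points F = {x. (F \<longlongrightarrow> F x) (at x)}"

lemma continuity_points_iff_oscillation:
  fixes F :: "'x::topological_space \<Rightarrow> 'b::metric_space"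
  shows "x \<in> continuity_points F \<longleftrightarrow>
    (\<forall>k::nat. \<exists>V. open V \<and> x \<in> V \<and> (\<forall>a\<in>V. \<forall>b\<in>V. dist (F a) (F b) < 1 / real (Suc k)))"
proof
  assume "x \<in> continuity_points F"
  then have cont: "(F \<longlongrightarrow> F x) (nhds x)" by (simp add: continuity_points_def tendsto_at_iff_tendsto_nhds)
  show "\<forall>k::nat. \<exists>V. open V \<and> x \<in> V \<and> (\<forall>a\<in>V. \<forall>b\<in>V. dist (F a) (F b) < 1 / real (Suc k))"
  proof
    fix k :: nat
    define r where "r = 1 / real (Suc k)"
    have "\<forall>\<^sub>F y in nhds x. dist (F y) (F x) < r / 2" by (rule tendstoD[OF cont]) (simp add: r_def)
    then obtain V where V: "open V" "x \<in> V" "\<And>y. y \<in> V \<Longrightarrow> dist (F y) (F x) < r / 2"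
      by (auto simp: eventually_nhds)
    have "dist (F a) (F b) < r" if "a \<in> V" "b \<in> V" for a b
      using V(3)[OF that(1)] V(3)[OF that(2)] by (rule dist_triangle_half_l)
    with V(1,2) show "\<exists>V. open V \<and> x \<in> V \<and> (\<forall>a\<in>V. \<forall>b\<in>V. dist (F a) (F b) < 1 / real (Suc k))"
      unfolding r_def by blast
  qed
next
  assume small: "\<forall>k::nat. \<exists>V. open V \<and> x \<in> V \<and> (\<forall>a\<in>V. \<forall>b\<in>V. dist (F a) (F b) < 1 / real (Suc k))"
  have "(F \<longlongrightarrow> F x) (nhds x)"
  proof (rule tendstoI)
    fix e :: real assume "0 < e"
    then obtain k where k: "1 / real (Suc k) < e" using nat_approx_posE by blast
    obtain V where "open V" "x \<in> V" "\<forall>a\<in>V. \<forall>b\<in>V. dist (F a) (F b) < 1 / real (Suc k)"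
      using small by blast
    with k show "\<forall>\<^sub>F y in nhds x. dist (F y) (F x) < e"
      unfolding eventually_nhds by (intro exI[of _ V]) (auto intro: less_trans)
  qed
  then show "x \<in> continuity_points F" by (simp add: continuity_points_def tendsto_at_iff_tendsto_nhds)
qed

lemma continuity_points_eq_Inter_open:
  fixes F :: "'x::topological_space \<Rightarrow> 'b::metric_space"
  shows "\<exists>W. (\<forall>k::nat. open (W k)) \<and> continuity_points F = (\<Inter>k. W k)"
proof -
  define W where "W k = \<Union>{V. open V \<and> (\<forall>a\<in>V. \<forall>b\<in>V. dist (F a) (F b) < 1 / real (Suc k))}" for k
  have "open (W k)" for k unfolding W_def by blast
  moreover have "x \<in> continuity_points F \<longleftrightarrow> (\<forall>k. x \<in> W k)" for x
    by (simp only: continuity_points_iff_oscillation W_def Union_iff Bex_def mem_Collect_eq conj_ac)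
  then have "continuity_points F = (\<Inter>k. W k)" by blast
  ultimately show ?thesis by blast
qed

lemma gdelta_in_continuity_points:
  fixes F :: "'x::topological_space \<Rightarrow> 'b::metric_space"
  shows "gdelta_in euclidean (continuity_points F)"
proof -
  obtain W where W: "\<forall>k::nat. open (W k)" "continuity_points F = (\<Inter>k. W k)"
    using continuity_points_eq_Inter_open by metis
  show ?thesis
    unfolding W(2) using W(1) by (intro gdelta_in_Inter) (auto intro: open_imp_gdelta_in)
qed

lemma gdelta_in_subspace_continuity_points:
  fixes F :: "'x::topological_space \<Rightarrow> 'b::metric_space"
  shows "gdelta_in (top_of_set A) (A \<inter> continuity_points F)"
  unfolding gdelta_in_subtopology using gdelta_in_continuity_points[of F] by blast

lemma borel_continuity_points:
  fixes F :: "'x::topological_space \<Rightarrow> 'b::metric_space"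
  shows "continuity_points F \<in> sets borel"
proof -
  obtain W where W: "\<forall>k::nat. open (W k)" "continuity_points F = (\<Inter>k. W k)"
    using continuity_points_eq_Inter_open by metis
  show ?thesis
    unfolding W(2) using W(1) by (intro sets.countable_INT) auto
qed

lemma continuity_points_cong:
  fixes F :: "(nat \<Rightarrow> 'g::topological_space) \<Rightarrow> 'b::topological_space"
  assumes F: "depends_upto n F" and x: "x \<in> continuity_points F" and eq: "\<And>i. i < n \<Longrightarrow> x i = y i"
  shows "y \<in> continuity_points F"
proof -
  let ?T = "\<lambda>z i. if i < n then z i else x i"
  have "((\<lambda>z. ?T z i) \<longlongrightarrow> x i) (at y)" for i
    using eq tendsto_fun_iff[of "\<lambda>z. z" y "at y"] by (cases "i < n") auto
  then have "(?T \<longlongrightarrow> x) (at y)" by (simp add: tendsto_fun_iff)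
  moreover have "(F \<longlongrightarrow> F x) (nhds x)"
    using x by (simp add: continuity_points_def tendsto_at_iff_tendsto_nhds)
  ultimately have "((\<lambda>z. F (?T z)) \<longlongrightarrow> F x) (at y)" by (rule filterlim_compose[rotated])
  moreover have "F (?T z) = F z" for z by (rule depends_uptoD[OF F]) simp
  moreover have "F x = F y" using eq by (rule depends_uptoD[OF F])
  ultimately show ?thesis by (simp add: continuity_points_def)
qed

lemma (in polish_module) continuity_point_if_continuous_head:
  assumes F: "cochain n F" and x: "continuous_head n F x"
  shows "x \<in> continuity_points F"
  unfolding continuity_points_def mem_Collect_eq tendsto_at_iff_sequentially
proof (intro allI impI)
  fix X assume X: "X \<longlonglongrightarrow> x"
  have "tail n F y = (\<lambda>_. F y)" for y
    unfolding tail_def by (intro ext depends_uptoD[OF cochain_depends[OF F]]) (simp add: comb_seq_def)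
  then have "tendsto_in_measure P (\<lambda>k _. F (X k)) (\<lambda>_. F x)"
    using continuous_in_measureD[OF x[unfolded continuous_head_def] X] by simp
  then have "(\<lambda>k. min 1 (dist (F (X k)) (F x))) \<longlonglongrightarrow> 0"
    using seq.P.prob_space by (simp add: tendsto_in_measure_def meas_dist_def)
  then show "(F \<circ> X) \<longlonglongrightarrow> F x" by (simp add: min_1_dist_tendsto_0_iff o_def)
qed

section \<open>Products of Haar measure\<close>

lemma density_PiM:
  assumes M: "product_sigma_finite M" "product_sigma_finite (\<lambda>i. density (M i) (f i))"
    and I: "finite I" and [measurable]: "\<And>i. f i \<in> borel_measurable (M i)"
  shows "density (PiM I M) (\<lambda>x. \<Prod>i\<in>I. f i (x i)) = PiM I (\<lambda>i. density (M i) (f i))"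
proof (rule product_sigma_finite.PiM_eqI[OF M(2) I])
  let ?d = "\<lambda>x. \<Prod>i\<in>I. f i (x i)"
  show "sets (density (PiM I M) ?d) = sets (PiM I (\<lambda>i. density (M i) (f i)))"
    by (simp, intro sets_PiM_cong) auto
  fix A assume A: "\<And>i. i \<in> I \<Longrightarrow> A i \<in> sets (density (M i) (f i))"
  have "emeasure (density (PiM I M) ?d) (Pi\<^sub>E I A) = (\<integral>\<^sup>+x. ?d x * indicator (Pi\<^sub>E I A) x \<partial>PiM I M)"
    by (rule emeasure_density) (use A I in \<open>auto intro!: sets_PiM_I_finite\<close>)
  also have "\<dots> = (\<integral>\<^sup>+x. (\<Prod>i\<in>I. f i (x i) * indicator (A i) (x i)) \<partial>PiM I M)"
  proof (rule nn_integral_cong)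
    fix x assume x: "x \<in> space (PiM I M)"
    have "indicator (Pi\<^sub>E I A) x = (\<Prod>i\<in>I. indicator (A i) (x i) :: ennreal)"
    proof (cases "x \<in> Pi\<^sub>E I A")
      case False
      then obtain i where "i \<in> I" "x i \<notin> A i" using x by (auto simp: space_PiM PiE_iff)
      then have "(\<Prod>i\<in>I. indicator (A i) (x i) :: ennreal) = 0" using I by (intro prod_zero bexI[of _ i]) auto
      then show ?thesis using False by simp
    qed (auto simp: PiE_iff)
    then show "?d x * indicator (Pi\<^sub>E I A) x = (\<Prod>i\<in>I. f i (x i) * indicator (A i) (x i))"
      by (simp add: prod.distrib)
  qed
  also have "\<dots> = (\<Prod>i\<in>I. \<integral>\<^sup>+x. f i x * indicator (A i) x \<partial>M i)"
    by (rule product_sigma_finite.product_nn_integral_prod[OF M(1) I]) (use A in auto)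
  also have "\<dots> = (\<Prod>i\<in>I. emeasure (density (M i) (f i)) (A i))"
    by (intro prod.cong refl emeasure_density[symmetric]) (use A in auto)
  finally show "emeasure (density (PiM I M) ?d) (Pi\<^sub>E I A) = (\<Prod>i\<in>I. emeasure (density (M i) (f i)) (A i))" .
qed

lemma AE_PiM_density:
  assumes M: "product_sigma_finite M" "product_sigma_finite (\<lambda>i. density (M i) (f i))"
    and I: "finite I" and f [measurable]: "\<And>i. f i \<in> borel_measurable (M i)" and pos: "\<And>i x. 0 < f i x"
  shows "(AE x in PiM I (\<lambda>i. density (M i) (f i)). Q x) \<longleftrightarrow> (AE x in PiM I M. Q x)"
proof -
  have [measurable]: "(\<lambda>x. \<Prod>i\<in>I. f i (x i)) \<in> borel_measurable (PiM I M)" by measurable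
  have "0 < (\<Prod>i\<in>I. f i (x i))" for x
    using pos I by (simp add: zero_less_iff_neq_zero prod_zero_iff)
  then show ?thesis unfolding density_PiM[OF M I f, symmetric] by (subst AE_density) auto
qed

section \<open>Cochains on powers of the group\<close>

definition extend :: "nat \<Rightarrow> ((nat \<Rightarrow> 'g) \<Rightarrow> 'b) \<Rightarrow> (nat \<Rightarrow> 'g) \<Rightarrow> 'b" where
  "extend n \<phi> x = \<phi> (restrict x {..<n})"

lemma extend_Gpow: "x \<in> Gpow n \<Longrightarrow> extend n \<phi> x = \<phi> x"
  by (simp add: extend_def Gpow_def PiE_def extensional_restrict)

lemma depends_upto_extend: "depends_upto n (extend n \<phi>)"
  by (intro depends_uptoI) (auto simp: extend_def restrict_def intro!: arg_cong[where f = \<phi>])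

lemma cobd_eq_pcobd:
  assumes "depends_upto n F"
  shows "cobd n F x = alt n (pcobd 0 (Suc n) F x)"
proof -
  have "F (omit n i x) = F (face i x)" for i
    by (rule depends_uptoD[OF assms]) (auto simp: omit_def face_def)
  then show ?thesis
    unfolding cobd_def pcobd_def alt_sum atLeast0LessThan
    by (intro sum.cong refl) (auto simp: alt_def even_diff_nat)
qed

lemma cobd_extend: "cobd n (extend n \<phi>) x = cobd n \<phi> x"
  unfolding cobd_def by (intro sum.cong refl) (simp add: extend_def omit_def restrict_def cong: if_cong)

locale haar_module = haar \<mu>
  for \<mu> :: "'g::{topological_group_add, t2_space, second_countable_topology} measure" +
  fixes w :: "'g \<Rightarrow> real" and \<alpha> :: "'g \<Rightarrow> 'a::{topological_ab_group_add, polish_space} \<Rightarrow> 'a"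
  assumes weight_measurable: "w \<in> borel_measurable borel"
    and weight_pos: "\<And>x. 0 < w x"
    and weight_quasi_invariant: "quasi_invariant (density \<mu> w)"
    and action: "G_module_action \<alpha>"
begin

abbreviation "L \<equiv> density \<mu> (\<lambda>x. ennreal (w x))"

sublocale M: polish_module L \<alpha>
  using weight_quasi_invariant action by (intro polish_module.intro polish_module_axioms.intro)

lemma space_Mpow: "space (Mpow \<mu> n) = Gpow n"
  by (simp add: Mpow_def Gpow_def space_PiM)

lemma AE_Mpow_cong:
  assumes "\<And>x. x \<in> Gpow n \<Longrightarrow> Q x \<longleftrightarrow> Q' x"
  shows "(AE x in Mpow \<mu> n. Q x) \<longleftrightarrow> (AE x in Mpow \<mu> n. Q' x)"
  using assms by (intro AE_cong) (simp add: space_Mpow)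

lemma measurable_Mpow_id: "(\<lambda>x. x) \<in> borel_measurable (Mpow \<mu> n)"
proof (rule measurable_coordinatewise_then_product)
  fix i
  show "(\<lambda>x. x i) \<in> borel_measurable (Mpow \<mu> n)"
  proof (cases "i < n")
    case True
    then show ?thesis
      unfolding Mpow_def using measurable_component_singleton[of i "{..<n}" "\<lambda>_. \<mu>"] by simp
  next
    case False
    have "(\<lambda>x. undefined) \<in> borel_measurable (Mpow \<mu> n)" by simp
    then show ?thesis
      by (rule measurable_cong[THEN iffD1, rotated])
         (use False in \<open>auto simp: Mpow_def space_PiM PiE_def extensional_def\<close>)
  qed
qed

lemma measurable_extend:
  assumes "\<phi> \<in> borel_measurable (Mpow \<mu> n)"
  shows "extend n \<phi> \<in> borel_measurable borel"
proof -
  have "(\<lambda>x. restrict x {..<n}) \<in> measurable borel (Mpow \<mu> n)"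
    unfolding Mpow_def by (rule measurable_restrict) simp
  from measurable_compose[OF this assms] show ?thesis unfolding extend_def[abs_def] .
qed

lemma AE_Mpow: "(AE x in Mpow \<mu> n. Q x) \<longleftrightarrow> (AE x in PiM {..<n} (\<lambda>_. L). Q x)"
  unfolding Mpow_def
proof (rule AE_PiM_density[symmetric])
  show "product_sigma_finite (\<lambda>_::nat. \<mu>)" "product_sigma_finite (\<lambda>_::nat. L)"
    by (intro product_sigma_finite.intro sigma_finite_measure_axioms M.sigma_finite_measure_axioms)+
qed (use weight_measurable weight_pos in auto)

lemma distr_restrict: "distr M.P (PiM {..<n} (\<lambda>_. L)) (\<lambda>x. restrict x {..<n}) = PiM {..<n} (\<lambda>_. L)"
  by (rule M.seq.distr_PiM_restrict_finite) auto

lemma measurable_restrict_P: "(\<lambda>x. restrict x {..<n}) \<in> measurable M.P (PiM {..<n} (\<lambda>_. L))"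
  by (rule measurable_restrict) (auto intro: measurable_component_singleton)

lemma AE_MpowD:
  assumes "AE x in Mpow \<mu> n. Q x"
  shows "AE x in M.P. Q (restrict x {..<n})"
proof -
  have "AE x in distr M.P (PiM {..<n} (\<lambda>_. L)) (\<lambda>x. restrict x {..<n}). Q x"
    using assms by (simp only: distr_restrict AE_Mpow)
  then show ?thesis by (rule AE_distrD[OF measurable_restrict_P])
qed

lemma AE_MpowI:
  assumes Q: "Measurable.pred borel Q" and "AE x in M.P. Q x" and dep: "depends_upto n Q"
  shows "AE x in Mpow \<mu> n. Q x"
proof -
  have "Measurable.pred (Mpow \<mu> n) Q" using measurable_compose[OF measurable_Mpow_id Q] .
  moreover have "sets (Mpow \<mu> n) = sets (PiM {..<n} (\<lambda>_. L))"
    unfolding Mpow_def by (rule sets_PiM_cong) auto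
  ultimately have "Measurable.pred (PiM {..<n} (\<lambda>_. L)) Q"
    using measurable_cong_sets by blast
  then have pred: "{x \<in> space (PiM {..<n} (\<lambda>_. L)). Q x} \<in> sets (PiM {..<n} (\<lambda>_. L))"
    by (rule predE)
  have "Q (restrict x {..<n}) = Q x" for x by (rule depends_uptoD[OF dep]) simp
  then have "AE x in distr M.P (PiM {..<n} (\<lambda>_. L)) (\<lambda>x. restrict x {..<n}). Q x"
    using assms(2) by (subst AE_distr_iff[OF measurable_restrict_P pred]) simp
  then show ?thesis by (simp only: distr_restrict AE_Mpow)
qed

lemma AE_Mpow_eqI:
  fixes F H :: "(nat \<Rightarrow> 'g) \<Rightarrow> 'a"
  assumes meas: "F \<in> borel_measurable borel" "H \<in> borel_measurable borel"
    and dep: "depends_upto n F" "depends_upto n H" and eq: "AE x in M.P. F x = H x"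
  shows "AE x in Mpow \<mu> n. F x = H x"
proof (rule AE_MpowI[OF _ eq depends_upto_compose2[OF dep]])
  show "Measurable.pred borel (\<lambda>x. F x = H x)" by (rule measurable_pred_eq[OF meas])
qed

lemma equiv_cochain_if_cochain:
  assumes F: "M.cochain n F"
  shows "equiv_cochain \<mu> \<alpha> n F"
  unfolding equiv_cochain_def
proof (intro conjI allI AE_I2)
  show "F \<in> borel_measurable (Mpow \<mu> n)"
    using measurable_compose[OF measurable_Mpow_id M.cochain_measurable[OF F]] .
  fix g x
  have "F (\<lambda>j\<in>{..<n}. - g + x j) = F (translate (- g) x)"
    by (rule depends_uptoD[OF M.cochain_depends[OF F]]) (simp add: translate_def)
  then show "cochain_act \<alpha> n g F x = F x"
    by (simp add: cochain_act_def M.cochain_equivariant[OF F] M.act_act)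
qed

lemma AE_extend_equivariant:
  assumes "equiv_cochain \<mu> \<alpha> n \<phi>"
  shows "AE x in M.P. extend n \<phi> (translate g x) = \<alpha> g (extend n \<phi> x)"
proof -
  have "AE x in Mpow \<mu> n. cochain_act \<alpha> n (- g) \<phi> x = \<phi> x"
    using assms by (simp add: equiv_cochain_def)
  from AE_MpowD[OF this] show ?thesis
  proof eventually_elim
    case (elim x)
    have "(\<lambda>j\<in>{..<n}. - (- g) + restrict x {..<n} j) = restrict (translate g x) {..<n}"
      by (auto simp: translate_def)
    with elim have "\<alpha> (- g) (extend n \<phi> (translate g x)) = extend n \<phi> x"
      by (simp add: cochain_act_def extend_def)
    from arg_cong[OF this, of "\<alpha> g"] show ?case by (simp add: M.act_act)
  qed
qed

lemma strict_cocycle_representative: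
  assumes \<phi>: "equiv_cocycle \<mu> \<alpha> p \<phi>"
  obtains \<sigma> where "M.cochain (Suc p) \<sigma>" "AE x in M.P. pcobd 0 (Suc (Suc p)) \<sigma> x = 0"
    "AE x in Mpow \<mu> (Suc p). \<sigma> x = \<phi> x"
proof -
  let ?f = "extend (Suc p) \<phi>"
  have cochain: "equiv_cochain \<mu> \<alpha> (Suc p) \<phi>" using \<phi> by (simp add: equiv_cocycle_def)
  then have f: "?f \<in> borel_measurable borel" by (intro measurable_extend) (simp add: equiv_cochain_def)
  obtain \<sigma> where \<sigma>: "M.cochain (Suc p) \<sigma>" "AE x in M.P. \<sigma> x = ?f x"
    by (rule M.strict_cochain[OF f depends_upto_extend _ AE_extend_equivariant[OF cochain]]) auto
  show ?thesis
  proof (rule that[OF \<sigma>(1)])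
    have "AE x in Mpow \<mu> (Suc (Suc p)). cobd (Suc p) ?f x = 0"
      using \<phi> by (simp add: equiv_cocycle_def cobd_extend)
    then have "AE x in Mpow \<mu> (Suc (Suc p)). pcobd 0 (Suc (Suc p)) ?f x = 0"
      by (simp add: cobd_eq_pcobd[OF depends_upto_extend])
    from AE_MpowD[OF this] M.AE_pcobd_cong[OF \<sigma>(2), of 0 "Suc (Suc p)"]
    show "AE x in M.P. pcobd 0 (Suc (Suc p)) \<sigma> x = 0"
    proof eventually_elim
      case (elim x)
      have "pcobd 0 (Suc (Suc p)) ?f (restrict x {..<Suc (Suc p)}) = pcobd 0 (Suc (Suc p)) ?f x"
        by (rule depends_uptoD[OF depends_upto_pcobd[OF depends_upto_extend]]) simp
      with elim show ?case by simp
    qed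
    have "AE x in Mpow \<mu> (Suc p). \<sigma> x = ?f x"
      by (rule AE_Mpow_eqI[OF M.cochain_measurable[OF \<sigma>(1)] f M.cochain_depends[OF \<sigma>(1)]
            depends_upto_extend \<sigma>(2)])
    then show "AE x in Mpow \<mu> (Suc p). \<sigma> x = \<phi> x"
      by (subst (asm) AE_Mpow_cong[of _ _ "\<lambda>x. \<sigma> x = \<phi> x"]) (simp_all add: extend_Gpow)
  qed
qed

lemma equiv_cocycle_add_pcobd:
  assumes F: "M.cochain (Suc p) F" and \<sigma>: "AE x in M.P. pcobd 0 (Suc (Suc p)) \<sigma> x = 0"
    and F_eq: "AE x in M.P. F x = \<sigma> x + pcobd 0 (Suc p) u x"
  shows "equiv_cocycle \<mu> \<alpha> p F"
proof -
  have "AE x in M.P. pcobd 0 (Suc (Suc p)) F x = 0"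
    using \<sigma> M.AE_pcobd_cong[OF F_eq, of 0 "Suc (Suc p)"]
    by eventually_elim (simp add: pcobd_add pcobd_pcobd)
  moreover have "M.cochain (Suc (Suc p)) (pcobd 0 (Suc (Suc p)) F)" by (rule M.cochain_pcobd[OF F])
  ultimately have "AE x in Mpow \<mu> (Suc (Suc p)). pcobd 0 (Suc (Suc p)) F x = 0"
    using M.cochain_0 by (intro AE_Mpow_eqI M.cochain_measurable M.cochain_depends)
  then show ?thesis
    using equiv_cochain_if_cochain[OF F]
    by (simp add: equiv_cocycle_def cobd_eq_pcobd[OF M.cochain_depends[OF F]])
qed

lemma cohomologousI:
  assumes F: "M.cochain (Suc p) F" and \<sigma>: "M.cochain (Suc p) \<sigma>" and u: "M.cochain p u"
    and F_eq: "AE x in M.P. F x = \<sigma> x + pcobd 0 (Suc p) u x" and u_0: "p = 0 \<Longrightarrow> u = (\<lambda>_. 0)"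
    and \<sigma>_eq: "AE x in Mpow \<mu> (Suc p). \<sigma> x = \<phi> x"
  shows "cohomologous \<mu> \<alpha> p F \<phi>"
proof -
  have "M.cochain (Suc p) (\<lambda>x. \<sigma> x + pcobd 0 (Suc p) u x)" by (intro M.cochain_add \<sigma> M.cochain_pcobd u)
  then have "AE x in Mpow \<mu> (Suc p). F x = \<sigma> x + pcobd 0 (Suc p) u x"
    by (intro AE_Mpow_eqI[OF M.cochain_measurable[OF F] _ M.cochain_depends[OF F] _ F_eq]
        M.cochain_measurable[of "Suc p"] M.cochain_depends)
  with \<sigma>_eq have diff: "AE x in Mpow \<mu> (Suc p). F x - \<phi> x = pcobd 0 (Suc p) u x"
    by eventually_elim simp
  have \<psi>: "M.cochain p (\<lambda>x. alt p (u x))" by (rule M.cochain_alt[OF u])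
  have "cobd p (\<lambda>x. alt p (u x)) x = pcobd 0 (Suc p) u x" for x
    by (simp add: cobd_eq_pcobd[OF M.cochain_depends[OF \<psi>]] pcobd_alt)
  with diff u_0 equiv_cochain_if_cochain[OF \<psi>] show ?thesis
    unfolding cohomologous_def by auto
qed

lemma Gpow_subset_closure_continuity_points:
  assumes F: "M.cochain n F" and cont: "AE x in M.P. M.continuous_head n F x"
  shows "Gpow n \<subseteq> closure (Gpow n \<inter> continuity_points F)"
proof
  fix x :: "nat \<Rightarrow> 'g" assume x: "x \<in> Gpow n"
  obtain X where X: "X \<longlonglongrightarrow> x" "\<And>k::nat. M.continuous_head n F (X k)"
    by (rule M.AE_P_approximating_sequence[OF cont]) blast
  define Y where "Y k i = (if i < n then X k i else x i)" for k i
  have "(\<lambda>k. Y k i) \<longlonglongrightarrow> x i" for i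
    using X(1) by (cases "i < n") (simp_all add: Y_def tendsto_fun_iff)
  then have "Y \<longlonglongrightarrow> x" by (simp add: tendsto_fun_iff)
  moreover have "Y k \<in> continuity_points F" for k
    using M.continuity_point_if_continuous_head[OF F X(2)]
    by (rule continuity_points_cong[OF M.cochain_depends[OF F]]) (simp add: Y_def)
  moreover have "Y k \<in> Gpow n" for k
    using x by (auto simp: Gpow_def Y_def PiE_def extensional_def)
  ultimately show "x \<in> closure (Gpow n \<inter> continuity_points F)"
    by (intro Lim_in_closed_set[OF closed_closure, of Y])
      (auto intro!: always_eventually closure_subset[THEN subsetD])
qed

lemma AE_Mpow_continuity_points:
  assumes F: "M.cochain n F" and cont: "AE x in M.P. M.continuous_head n F x"
  shows "AE x in Mpow \<mu> n. x \<in> Gpow n \<inter> continuity_points F"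
proof -
  have "AE x in Mpow \<mu> n. x \<in> continuity_points F"
  proof (rule AE_MpowI)
    show "Measurable.pred borel (\<lambda>x. x \<in> continuity_points F)"
      using borel_continuity_points[of F] by (simp add: pred_def)
    show "AE x in M.P. x \<in> continuity_points F"
      using cont by eventually_elim (rule M.continuity_point_if_continuous_head[OF F])
    show "depends_upto n (\<lambda>x. x \<in> continuity_points F)"
      using continuity_points_cong[OF M.cochain_depends[OF F]] by (intro depends_uptoI iffI) metis+
  qed
  then show ?thesis by (subst AE_Mpow_cong[of _ _ "\<lambda>x. x \<in> continuity_points F"]) simp_all
qed

lemma zero_mem_continuity_points:
  assumes F: "M.cochain n F" and cont: "M.continuous_head n F (\<lambda>_. 0)"
  shows "(\<lambda>i\<in>{..<n}. 0) \<in> Gpow n \<inter> continuity_points F"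
proof -
  have "(\<lambda>i\<in>{..<n}. 0) \<in> continuity_points F"
    using M.cochain_depends[OF F] M.continuity_point_if_continuous_head[OF F cont]
    by (rule continuity_points_cong) simp
  then show ?thesis by (simp add: Gpow_def)
qed

end

theorem theoremB:
  fixes \<mu> :: "'g::{topological_group_add, t2_space, second_countable_topology} measure"
    and \<alpha> :: "'g \<Rightarrow> 'a::{topological_ab_group_add, polish_space} \<Rightarrow> 'a"
    and \<phi> :: "(nat \<Rightarrow> 'g) \<Rightarrow> 'a"
    and p :: nat
  assumes "locally_compact_space (euclidean :: 'g topology)"
    and "haar_measure \<mu>"
    and "G_module_action \<alpha>"
    and "equiv_cocycle \<mu> \<alpha> p \<phi>"
  shows "\<exists>\<sigma> S. equiv_cocycle \<mu> \<alpha> p \<sigma> \<and> cohomologous \<mu> \<alpha> p \<sigma> \<phi> \<and>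
           S \<subseteq> Gpow (Suc p) \<and>
           gdelta_in (top_of_set (Gpow (Suc p))) S \<and>
           Gpow (Suc p) \<subseteq> closure S \<and>
           (AE x in Mpow \<mu> (Suc p). x \<in> S) \<and>
           (\<lambda>i\<in>{..<Suc p}. 0) \<in> S \<and>
           (\<forall>x\<in>S. (\<sigma> \<longlongrightarrow> \<sigma> x) (at x within Gpow (Suc p)))"
proof -
  interpret haar \<mu> using assms(1,2) by unfold_locales
  obtain w :: "'g \<Rightarrow> real" where w: "w \<in> borel_measurable borel" "\<And>x. 0 < w x"
    "quasi_invariant (density \<mu> w)"
    by (rule equivalent_quasi_invariant) blast
  interpret haar_module \<mu> w \<alpha> by (intro haar_module.intro haar_module_axioms.intro haar_axioms w assms(3))
  obtain \<sigma> where \<sigma>: "M.cochain (Suc p) \<sigma>" "AE x in M.P. pcobd 0 (Suc (Suc p)) \<sigma> x = 0"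
    "AE x in Mpow \<mu> (Suc p). \<sigma> x = \<phi> x"
    by (rule strict_cocycle_representative[OF assms(4)]) blast
  obtain F u where F: "M.cochain (Suc p) F" "M.almost_continuous_head (Suc p) F" and u: "M.cochain p u"
    "p = 0 \<Longrightarrow> u = (\<lambda>_. 0)" and F_eq: "AE x in M.P. F x = \<sigma> x + pcobd 0 (Suc p) u x"
    by (rule M.almost_continuous_representative[OF \<sigma>(1,2)]) simp_all
  note F_head = M.almost_continuous_headD[OF F(2)]
  have "equiv_cocycle \<mu> \<alpha> p F" by (rule equiv_cocycle_add_pcobd[OF F(1) \<sigma>(2) F_eq])
  moreover have "cohomologous \<mu> \<alpha> p F \<phi>" by (rule cohomologousI[OF F(1) \<sigma>(1) u(1) F_eq u(2) \<sigma>(3)])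
  moreover define S where "S = Gpow (Suc p) \<inter> continuity_points F"
  moreover have "gdelta_in (top_of_set (Gpow (Suc p))) S"
    unfolding S_def by (rule gdelta_in_subspace_continuity_points)
  moreover have "\<forall>x\<in>S. (F \<longlongrightarrow> F x) (at x within Gpow (Suc p))"
    by (auto simp: S_def continuity_points_def intro: tendsto_within_subset)
  ultimately show ?thesis
    using Gpow_subset_closure_continuity_points[OF F(1) F_head(1)] AE_Mpow_continuity_points[OF F(1) F_head(1)]
      zero_mem_continuity_points[OF F(1) F_head(2)]
    by (intro exI[of _ F] exI[of _ S]) simp
qed

end
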